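(* There exists a constant $\mathcal{C}\in(0,\infty)$ such that for every $q>0$, if $\frac{r}{\sqrt{T}}\to 0$ (with $r,T>0$), then $$\frac{r}{T^{1/2}}\, I_W(T,r)\to \mathcal{C}\ \text{ in } L_q \qquad\text{and}\qquad \frac{r}{T^{1/2}}\, I_W^0(T,r)\to \mathcal{C}\ \text{ in } L_q,$$ that is, $\mathbb{E}\left|\frac{r}{T^{1/2}} I_W(T,r)-\mathcal{C}\right|^q\to 0$ and $\mathbb{E}\left|\frac{r}{T^{1/2}} I_W^0(T,r)-\mathcal{C}\right|^q\to 0$ as $\frac{r}{\sqrt{T}}\to 0$. The constant $\mathcal{C}$ is the same in both limits and for all $q$.
   Context: $W=(W(t))_{t\ge 0}$ is a standard one-dimensional Wiener process with $W(0)=0$. For $T>0$, $\|h\|_T:=\sup_{0\le t\le T}|h(t)|$ for continuous $h$ on $[0,T]$; $AC[0,T]$ is the set of absolutely continuous real functions on $[0,T]$, and $|h|_T:=\left(\int_0^T h'(t)^2\,dt\right)^{1/2}$ (possibly $+\infty$) for $h\in AC[0,T]$. For $T,r>0$ define the random variables $$I_W(T,r):=\inf\{|h|_T:\ h\in AC[0,T],\ \|h-W\|_T\le r,\ h(0)=0\},$$ $$I_W^0(T,r):=\inf\{|h|_T:\ h\in AC[0,T],\ \|h-W\|_T\le r,\ h(0)=0,\ h(T)=W(T)\}.$$ *)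

theory Defs
  imports "HOL-Probability.Probability"
begin

locale wiener_process = prob_space M for M :: "'a measure" +
  fixes W :: "real \<Rightarrow> 'a \<Rightarrow> real"
  assumes start: "\<And>\<omega>. \<omega> \<in> space M \<Longrightarrow> W 0 \<omega> = 0"
    and continuous_paths: "\<And>\<omega>. \<omega> \<in> space M \<Longrightarrow> continuous_on {0..} (\<lambda>t. W t \<omega>)"
    and gaussian_increments: "\<And>s t. 0 \<le> s \<Longrightarrow> s < t \<Longrightarrow>
      distributed M lborel (\<lambda>\<omega>. W t \<omega> - W s \<omega>) (normal_density 0 (sqrt (t - s)))"
    and independent_increments: "\<And>(n::nat) (t :: nat \<Rightarrow> real).
      0 \<le> t 0 \<Longrightarrow> (\<And>i. i < n \<Longrightarrow> t i \<le> t (Suc i)) \<Longrightarrow>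
      indep_vars (\<lambda>_. borel) (\<lambda>i \<omega>. W (t (Suc i)) \<omega> - W (t i) \<omega>) {..<n}"

definition sup_norm :: "real \<Rightarrow> (real \<Rightarrow> real) \<Rightarrow> real" where
  "sup_norm T h = (SUP t\<in>{0..T}. \<bar>h t\<bar>)"

definition abs_continuous_on :: "real \<Rightarrow> real \<Rightarrow> (real \<Rightarrow> real) \<Rightarrow> bool" where
  "abs_continuous_on a b h \<longleftrightarrow>
    (\<forall>\<epsilon>>0. \<exists>\<delta>>0. \<forall>(n::nat) (u :: nat \<Rightarrow> real) (v :: nat \<Rightarrow> real).
      (\<forall>i<n. a \<le> u i \<and> u i \<le> v i \<and> v i \<le> b) \<and>
      disjoint_family_on (\<lambda>i. {u i<..<v i}) {..<n} \<and>
      (\<Sum>i<n. v i - u i) < \<delta> \<longrightarrow> (\<Sum>i<n. \<bar>h (v i) - h (u i)\<bar>) < \<epsilon>)"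

(* An absolutely continuous function is differentiable almost everywhere on [0,T]; the unspecified
   values of deriv elsewhere do not affect the integral. It is taken over lebesgue rather than
   lborel so that these values cannot spoil measurability. *)
definition energy_norm :: "real \<Rightarrow> (real \<Rightarrow> real) \<Rightarrow> ennreal" where
  "energy_norm T h =
    (let E = (\<integral>\<^sup>+t\<in>{0..T}. ennreal ((deriv h t)\<^sup>2) \<partial>lebesgue)
     in if E = \<infinity> then \<infinity> else ennreal (sqrt (enn2real E)))"

(* Functions on [0,T] are represented by total functions; their values outside [0,T] are
   irrelevant. *)
definition I_free :: "real \<Rightarrow> real \<Rightarrow> (real \<Rightarrow> real) \<Rightarrow> ennreal" where
  "I_free T r w =
    Inf {energy_norm T h | h. abs_continuous_on 0 T h \<and> sup_norm T (\<lambda>t. h t - w t) \<le> r \<and> h 0 = 0}"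

definition I_pinned :: "real \<Rightarrow> real \<Rightarrow> (real \<Rightarrow> real) \<Rightarrow> ennreal" where
  "I_pinned T r w =
    Inf {energy_norm T h | h. abs_continuous_on 0 T h \<and> sup_norm T (\<lambda>t. h t - w t) \<le> r \<and>
      h 0 = 0 \<and> h T = w T}"

(* Convergence in L_q to a constant along a filter. Measurability, almost sure finiteness and
   integrability are required explicitly, since enn2real sends infinity to 0 and the Bochner
   integral of a non-integrable function is 0. *)
definition tends_in_Lq ::
    "'a measure \<Rightarrow> real \<Rightarrow> ('i \<Rightarrow> 'a \<Rightarrow> ennreal) \<Rightarrow> real \<Rightarrow> 'i filter \<Rightarrow> bool" where
  "tends_in_Lq M q X c F \<longleftrightarrow>
    (\<forall>\<^sub>F i in F. X i \<in> borel_measurable M \<and> (AE \<omega> in M. X i \<omega> < \<infinity>) \<and>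
      integrable M (\<lambda>\<omega>. \<bar>enn2real (X i \<omega>) - c\<bar> powr q)) \<and>
    ((\<lambda>i. \<integral>\<omega>. \<bar>enn2real (X i \<omega>) - c\<bar> powr q \<partial>M) \<longlongrightarrow> 0) F"

text \<open>The limit \<open>r / sqrt T \<rightarrow> 0\<close> over pairs \<open>(T, r)\<close> of positive reals.\<close>

definition small_ratio :: "(real \<times> real) filter" where
  "small_ratio =
    inf (filtercomap (\<lambda>(T, r). r / sqrt T) (nhds 0)) (principal ({0<..} \<times> {0<..}))"

lemma eventually_small_ratio:
  "eventually P small_ratio \<longleftrightarrow>
    (\<exists>\<delta>>0. \<forall>T>0. \<forall>r>0. r / sqrt T < \<delta> \<longrightarrow> P (T, r))"
proof
  assume "eventually P small_ratio"
  then obtain Q where Q: "eventually Q (nhds (0::real))"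
    and P: "\<And>T r. Q (r / sqrt T) \<Longrightarrow> T > 0 \<Longrightarrow> r > 0 \<Longrightarrow> P (T, r)"
    unfolding small_ratio_def eventually_inf_principal eventually_filtercomap by fastforce
  from Q obtain d where "d > 0" and d: "\<And>x. dist x 0 < d \<Longrightarrow> Q x"
    unfolding eventually_nhds_metric by blast
  have "P (T, r)" if "T > 0" "r > 0" "r / sqrt T < d" for T r
    using that by (intro P d) auto
  with \<open>d > 0\<close> show "\<exists>\<delta>>0. \<forall>T>0. \<forall>r>0. r / sqrt T < \<delta> \<longrightarrow> P (T, r)" by blast
next
  assume "\<exists>\<delta>>0. \<forall>T>0. \<forall>r>0. r / sqrt T < \<delta> \<longrightarrow> P (T, r)"
  then obtain d where "d > 0" and d: "\<And>T r. T > 0 \<Longrightarrow> r > 0 \<Longrightarrow> r / sqrt T < d \<Longrightarrow> P (T, r)"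
    by blast
  have "eventually (\<lambda>x. x < d) (nhds (0::real))"
    using \<open>d > 0\<close> by (rule eventually_nhds_in_open[of "{..<d}", simplified])
  then show "eventually P small_ratio"
    unfolding small_ratio_def eventually_inf_principal eventually_filtercomap
    by (intro exI[of _ "\<lambda>x. x < d"]) (auto intro: d)
qed

end

theory Submission
  imports Defs
begin

text \<open>
  Put \<open>\<epsilon> = r / sqrt T\<close>. The variational problem is first replaced by a finite-dimensional one: on a grid
  of \<open>N\<close> equal cells a string is given by its deviations \<open>y\<close> from the path at the nodes, and \<open>taut N r \<rho> d\<close>
  is the least sum of squared increments of such a string when \<open>d\<close> lists the increments of the path,
  the deviations are at most \<open>r\<close>, and the last one is at most \<open>\<rho>\<close> (so \<open>\<rho> = 0\<close> is the pinned and \<open>\<rho> = r\<close>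
  the free problem). For a continuous path the grid values converge to the infimum over absolutely
  continuous functions (\<open>grid_energy_tendsto_I_within\<close>). They do not exceed it because an absolutely
  continuous \<open>h\<close> satisfies \<open>(h b - h a)^2 \<le> (b - a) * \<integral> h'^2\<close> (\<open>abs_continuous_increment_le\<close>), which rests
  on its differentiability almost everywhere; conversely the polygon through a nearly optimal grid
  string almost fits the tube, and fits it after a small convex mixture with a fixed string that runs
  well inside. Consequently the random variables are measurable, and the law of each of them depends on
  \<open>\<epsilon>\<close> only, since the normalised increments of \<open>W\<close> are independent standard normal variables.
  This is why one constant serves all probability spaces.

  Let \<open>V \<epsilon>\<close> be the square of \<open>\<epsilon> * I\<close> for the pinned string of ratio \<open>\<epsilon>\<close>. Pinned strings on
  consecutive blocks can be joined, so \<open>V \<epsilon>\<close> is at most the average of \<open>m\<close> independent copies of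
  \<open>V (\<epsilon> * sqrt m)\<close>, and \<open>E (V \<epsilon>) / \<epsilon>^2\<close> decreases in \<open>\<epsilon>\<close> because a wider tube allows more strings. These two facts
  give \<open>E (V \<epsilon>) \<rightarrow> c\<close> with \<open>c = inf E V\<close>. By the law of large numbers for the blocks the positive part of
  \<open>V \<epsilon> - c\<close> tends to \<open>0\<close> in mean (\<open>pinned_upper_deviation\<close>); since \<open>E (V \<epsilon>) \<ge> c\<close>, the negative part has a mean
  that is no larger, so \<open>V \<epsilon> \<rightarrow> c\<close> in mean (\<open>pinned_energy_L1\<close>).
  The block inequality also bounds every moment of \<open>V \<epsilon>\<close> as \<open>\<epsilon> \<rightarrow> 0\<close>, and interpolation upgrades the
  convergence of \<open>sqrt (V \<epsilon>)\<close> to all \<open>L_q\<close>. A free string can be steered into a pinned one during the last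
  block, at the cost of one pinned block and a short ramp (\<open>taut_pinned_le_free\<close>); so both problems
  have the same limit.

  Two estimates make this work. The moments are finite (\<open>taut_moment_finite\<close>): refine a string
  dyadically, placing each new node at the midpoint of its neighbours and moving it only by the excess
  of the path over a tolerance \<open>c_j\<close>; since \<open>c_j\<close> decays more slowly than the standard deviation of the
  increments, high powers of the excess are summable. And \<open>c > 0\<close> (\<open>excess_constant_le_moment\<close>): on
  every cell of length about \<open>r^2\<close> the path moves by more than three times its standard deviation with positive
  probability, and then the string has to follow.
\<close>

section \<open>Differentiability of monotone functions\<close>

text \<open>
  Using intervals that contain \<open>x\<close> in their interior makes these sets open, hence the upper and lower
  derivates below are Borel sets without further work. The set for \<open>- F\<close> and \<open>- p\<close> collects the points with
  slopes below \<open>p\<close>.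
\<close>

definition steep :: "(real \<Rightarrow> real) \<Rightarrow> real \<Rightarrow> real \<Rightarrow> real set" where
  "steep F R d = (\<Union>(u, v)\<in>{(u, v). u < v \<and> v - u < d \<and> R * (v - u) < F v - F u}. {u<..<v})"

definition steep_limit :: "(real \<Rightarrow> real) \<Rightarrow> real \<Rightarrow> real set" where
  "steep_limit F R = (\<Inter>n::nat. steep F R (1 / real (Suc n)))"

lemma steep_iff:
  "x \<in> steep F R d \<longleftrightarrow> (\<exists>u v. u < x \<and> x < v \<and> v - u < d \<and> R * (v - u) < F v - F u)"
proof
  assume "\<exists>u v. u < x \<and> x < v \<and> v - u < d \<and> R * (v - u) < F v - F u"
  then obtain u v where "u < x" "x < v" "v - u < d" "R * (v - u) < F v - F u" by blast
  then show "x \<in> steep F R d" unfolding steep_def by (intro UN_I[of "(u, v)"]) auto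
qed (auto simp: steep_def)

lemma steep_limit_iff: "x \<in> steep_limit F R \<longleftrightarrow> (\<forall>d>0. x \<in> steep F R d)"
proof
  assume x: "x \<in> steep_limit F R"
  show "\<forall>d>0. x \<in> steep F R d"
  proof (intro allI impI)
    fix d :: real assume "d > 0"
    then obtain n where n: "1 / real (Suc n) < d"
      using nat_approx_posE by blast
    from x have "x \<in> steep F R (1 / real (Suc n))" unfolding steep_limit_def by blast
    then show "x \<in> steep F R d"
      using n unfolding steep_iff by (meson less_trans)
  qed
qed (auto simp: steep_limit_def)

lemma borel_steep_limit [measurable]: "steep_limit F R \<in> sets borel"
proof -
  have "open (steep F R d)" for d unfolding steep_def by (intro open_UN ballI) auto
  then show ?thesis unfolding steep_limit_def by (intro sets.countable_INT'') auto
qed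

text \<open>
  Vitali's covering theorem in the form needed for derivates: the intervals only have to contain the
  point, which need not be their centre.
\<close>

lemma Vitali_intervals:
  fixes E U :: "real set"
  assumes "open U" "E \<subseteq> U"
    and P: "\<And>x d. x \<in> E \<Longrightarrow> d > 0 \<Longrightarrow> \<exists>u v. u < x \<and> x < v \<and> v - u < d \<and> P u v"
  obtains C :: "(real \<times> real) set" where "countable C"
    "\<And>u v. (u, v) \<in> C \<Longrightarrow> u < v \<and> P u v \<and> {u..v} \<subseteq> U"
    "disjoint_family_on (\<lambda>(u, v). {u..v}) C"
    "negligible (E - (\<Union>(u, v)\<in>C. {u..v}))"
proof -
  define K where "K = {(u, v). u < v \<and> P u v \<and> {u..v} \<subseteq> U}"
  define a where "a = (\<lambda>(u, v). (u + v) / 2 :: real)"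
  define r where "r = (\<lambda>(u, v). (v - u) / 2 :: real)"
  have cb: "cball (a i) (r i) = (case i of (u, v) \<Rightarrow> {u..v})" for i
    by (auto simp: a_def r_def cball_def dist_real_def abs_le_iff field_simps split: prod.split)
  have ex: "\<exists>i. i \<in> K \<and> x \<in> cball (a i) (r i) \<and> r i < d" if x: "x \<in> E" and d: "0 < d" for x d
  proof -
    obtain e where e: "e > 0" "ball x e \<subseteq> U"
      using assms x open_contains_ball by blast
    obtain u v where uv: "u < x" "x < v" "v - u < min d e" "P u v"
      using P[OF x, of "min d e"] d e by auto
    have "{u..v} \<subseteq> U"
      using uv e by (intro subset_trans[OF _ e(2)]) (auto simp: dist_real_def)
    then have "(u, v) \<in> K" "x \<in> cball (a (u, v)) (r (u, v))" "r (u, v) < d"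
      using uv by (auto simp: K_def cb) (auto simp: r_def)
    then show ?thesis by blast
  qed
  obtain C where C: "countable C" "C \<subseteq> K"
     "pairwise (\<lambda>i j. disjnt (cball (a i) (r i)) (cball (a j) (r j))) C"
     "negligible(E - (\<Union>i \<in> C. cball (a i) (r i)))"
  proof (rule Vitali_covering_theorem_cballs[of K r E a])
    show "0 < r i" if "i \<in> K" for i using that by (auto simp: K_def r_def)
  qed (rule ex, assumption+)
  show ?thesis
  proof (rule that[OF C(1)])
    show "disjoint_family_on (\<lambda>(u, v). {u..v}) C"
      using C(3) by (auto simp: cb disjoint_family_on_def pairwise_def disjnt_def)
    show "negligible (E - (\<Union>(u, v)\<in>C. {u..v}))"
      using C(4) by (simp add: cb)
  qed (use C(2) in \<open>auto simp: K_def\<close>)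
qed

lemma emeasure_le_cover:
  assumes "E \<in> sets lebesgue" "countable C" "negligible (E - (\<Union>i\<in>C. A i))" "\<And>i. i \<in> C \<Longrightarrow> A i \<in> sets lebesgue"
    and disj: "disjoint_family_on A C"
  shows "emeasure lebesgue E \<le> (\<integral>\<^sup>+i. emeasure lebesgue (E \<inter> A i) \<partial>count_space C)"
proof -
  have UA: "(\<Union>i\<in>C. A i) \<in> sets lebesgue"
    using assms by (intro sets.countable_UN') auto
  have "emeasure lebesgue E = emeasure lebesgue (E \<inter> (\<Union>i\<in>C. A i))"
  proof (rule emeasure_eq_AE)
    have "E - (\<Union>i\<in>C. A i) \<in> null_sets lebesgue"
      using assms(3) by (simp add: negligible_iff_null_sets)
    then show "AE x in lebesgue. (x \<in> E) = (x \<in> E \<inter> (\<Union>i\<in>C. A i))"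
      by (rule AE_I') auto
  qed (use assms UA in auto)
  also have "E \<inter> (\<Union>i\<in>C. A i) = (\<Union>i\<in>C. E \<inter> A i)" by blast
  also have "emeasure lebesgue \<dots> = (\<integral>\<^sup>+i. emeasure lebesgue (E \<inter> A i) \<partial>count_space C)"
  proof (rule emeasure_UN_countable)
    show "disjoint_family_on (\<lambda>i. E \<inter> A i) C"
      using disj unfolding disjoint_family_on_def by blast
  qed (use assms in \<open>auto intro: sets.Int\<close>)
  finally show ?thesis by simp
qed

text \<open>
  Almost all of \<open>E\<close> is covered by disjoint intervals in \<open>U\<close> on which \<open>F\<close> increases at rate at least \<open>R\<close>, and
  their total increase is at most the Stieltjes measure of \<open>U\<close>.
\<close>

lemma steep_measure_le:
  fixes F :: "real \<Rightarrow> real"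
  assumes F: "mono F" "continuous_on UNIV F" and R: "0 \<le> R"
    and E: "E \<in> sets borel" "E \<subseteq> steep_limit F R" "E \<subseteq> U" "open U"
  shows "ennreal R * emeasure lebesgue E \<le> emeasure (interval_measure F) U"
proof -
  let ?\<mu> = "interval_measure F"
  have \<mu>: "emeasure ?\<mu> {u..v} = ennreal (F v - F u)" if "u \<le> v" for u v
    using F that by (intro emeasure_interval_measure_Icc) (auto simp: mono_def)
  have ex: "\<exists>u v. u < x \<and> x < v \<and> v - u < d \<and> R * (v - u) < F v - F u" if "x \<in> E" "d > 0" for x d
    using E that unfolding steep_iff[symmetric] steep_limit_iff by (auto simp: steep_limit_iff)
  obtain C where C: "countable C"
    "\<And>u v. (u, v) \<in> C \<Longrightarrow> u < v \<and> R * (v - u) < F v - F u \<and> {u..v} \<subseteq> U"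
    "disjoint_family_on (\<lambda>(u, v). {u..v}) C"
    "negligible (E - (\<Union>(u, v)\<in>C. {u..v}))"
    by (rule Vitali_intervals[OF E(4) E(3), of "\<lambda>u v. R * (v - u) < F v - F u"]) (use ex in blast)+
  have "ennreal R * emeasure lebesgue E \<le>
    ennreal R * (\<integral>\<^sup>+i. emeasure lebesgue (E \<inter> (case i of (u, v) \<Rightarrow> {u..v})) \<partial>count_space C)"
    using E C by (intro mult_left_mono emeasure_le_cover) auto
  also have "\<dots> = (\<integral>\<^sup>+i. ennreal R * emeasure lebesgue (E \<inter> (case i of (u, v) \<Rightarrow> {u..v})) \<partial>count_space C)"
    by (simp add: nn_integral_cmult)
  also have "\<dots> \<le> (\<integral>\<^sup>+i. emeasure ?\<mu> (case i of (u, v) \<Rightarrow> {u..v}) \<partial>count_space C)"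
  proof (rule nn_integral_mono)
    fix i assume "i \<in> space (count_space C)"
    then obtain u v where i: "i = (u, v)" and uv: "u < v" "R * (v - u) < F v - F u"
      using C(2) by (cases i) auto
    have "emeasure lebesgue (E \<inter> {u..v}) \<le> emeasure lebesgue {u..v}"
      by (intro emeasure_mono) auto
    then have "ennreal R * emeasure lebesgue (E \<inter> {u..v}) \<le> ennreal R * ennreal (v - u)"
      using uv by (intro mult_left_mono) auto
    also have "\<dots> = ennreal (R * (v - u))" using R uv by (simp add: ennreal_mult)
    also have "\<dots> \<le> ennreal (F v - F u)" using uv by (intro ennreal_leI) auto
    finally show "ennreal R * emeasure lebesgue (E \<inter> (case i of (u, v) \<Rightarrow> {u..v}))
        \<le> emeasure ?\<mu> (case i of (u, v) \<Rightarrow> {u..v})"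
      using uv \<mu> i by simp
  qed
  also have "\<dots> = emeasure ?\<mu> (\<Union>i\<in>C. case i of (u, v) \<Rightarrow> {u..v})"
    using C by (intro emeasure_UN_countable[symmetric]) auto
  also have "\<dots> \<le> emeasure ?\<mu> U"
    using C(2) E(4) by (intro emeasure_mono) auto
  finally show ?thesis .
qed

text \<open>
  Cover \<open>E\<close>, up to a null set, by disjoint intervals of slope below \<open>p\<close> inside an open set \<open>U\<close> that is hardly larger than
  \<open>E\<close>. Inside each of them the part of \<open>E\<close> has measure at most \<open>p / R\<close> times the length, by
  \<open>steep_measure_le\<close>. Summing gives \<open>R * |E| \<le> p * |U|\<close>, which forces \<open>|E| = 0\<close>.
\<close>

lemma oscillating_slopes_null:
  fixes F :: "real \<Rightarrow> real"
  assumes F: "mono F" "continuous_on UNIV F" and p: "0 \<le> p" "p < R" and "bounded B"  "B \<in> sets borel"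
  shows "B \<inter> steep_limit F R \<inter> steep_limit (\<lambda>x. - F x) (- p) \<in> null_sets lebesgue"
proof -
  define E where "E = B \<inter> steep_limit F R \<inter> steep_limit (\<lambda>x. - F x) (- p)"
  have E [measurable]: "E \<in> sets borel" using assms by (simp add: E_def)
  have bE: "bounded E" using assms by (auto simp: E_def intro: bounded_subset)
  have El: "E \<in> lmeasurable" using bE E by (simp add: bounded_set_imp_lmeasurable)
  define m where "m = measure lebesgue E"
  have m: "emeasure lebesgue E = ennreal m" unfolding m_def using El
    by (simp add: emeasure_eq_measure2 fmeasurableD2 emeasure_eq_ennreal_measure)
  have m0: "m \<ge> 0" by (simp add: m_def)
  have key: "R * m \<le> p * (m + e)" if e: "e > 0" for e
  proof -
    obtain U where U: "open U" "E \<subseteq> U" "U - E \<in> lmeasurable" "emeasure lebesgue (U - E) < ennreal e"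
      using sets_lebesgue_outer_open[of E e] El e by (auto simp: fmeasurableD)
    have ex: "\<exists>u v. u < x \<and> x < v \<and> v - u < d \<and> F v - F u < p * (v - u)" if "x \<in> E" "d > 0" for x d
    proof -
      have "x \<in> steep (\<lambda>x. - F x) (- p) d" using that by (auto simp: E_def steep_limit_iff)
      then show ?thesis unfolding steep_iff by (auto simp: algebra_simps)
    qed
    obtain C where C: "countable C"
      "\<And>u v. (u, v) \<in> C \<Longrightarrow> u < v \<and> F v - F u < p * (v - u) \<and> {u..v} \<subseteq> U"
      "disjoint_family_on (\<lambda>(u, v). {u..v}) C"
      "negligible (E - (\<Union>(u, v)\<in>C. {u..v}))"
      by (rule Vitali_intervals[OF U(1,2), of "\<lambda>u v. F v - F u < p * (v - u)"]) (use ex in blast)+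
    have "ennreal R * emeasure lebesgue E \<le>
      ennreal R * (\<integral>\<^sup>+i. emeasure lebesgue (E \<inter> (case i of (u, v) \<Rightarrow> {u..v})) \<partial>count_space C)"
      using E C by (intro mult_left_mono emeasure_le_cover) auto
    also have "\<dots> = (\<integral>\<^sup>+i. ennreal R * emeasure lebesgue (E \<inter> (case i of (u, v) \<Rightarrow> {u..v})) \<partial>count_space C)"
      by (simp add: nn_integral_cmult)
    also have "\<dots> \<le> (\<integral>\<^sup>+i. ennreal p * emeasure lebesgue (case i of (u, v) \<Rightarrow> {u..v}) \<partial>count_space C)"
    proof (rule nn_integral_mono)
      fix i assume "i \<in> space (count_space C)"
      then obtain u v where i: "i = (u, v)" and uv: "u < v" "F v - F u < p * (v - u)"
        using C(2) by (cases i) auto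
      have "emeasure lebesgue (E \<inter> {u..v}) = emeasure lebesgue (E \<inter> {u<..<v})"
      proof (rule emeasure_eq_AE)
        have "{u, v} \<in> null_sets lebesgue" by (simp add: negligible_iff_null_sets[symmetric])
        then show "AE x in lebesgue. (x \<in> E \<inter> {u..v}) = (x \<in> E \<inter> {u<..<v})"
          by (rule AE_I') auto
      qed (use E in auto)
      also have "ennreal R * \<dots> \<le> emeasure (interval_measure F) {u<..<v}"
        using F p E by (intro steep_measure_le) (auto simp: E_def)
      also have "\<dots> \<le> emeasure (interval_measure F) {u..v}" by (intro emeasure_mono) auto
      also have "\<dots> = ennreal (F v - F u)"
        using F uv by (intro emeasure_interval_measure_Icc) (auto simp: mono_def)
      also have "\<dots> \<le> ennreal (p * (v - u))" using uv by (intro ennreal_leI) auto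
      also have "\<dots> = ennreal p * ennreal (v - u)" using p uv by (simp add: ennreal_mult)
      finally show "ennreal R * emeasure lebesgue (E \<inter> (case i of (u, v) \<Rightarrow> {u..v}))
          \<le> ennreal p * emeasure lebesgue (case i of (u, v) \<Rightarrow> {u..v})"
        using uv i by simp
    qed
    also have "\<dots> = ennreal p * emeasure lebesgue (\<Union>i\<in>C. case i of (u, v) \<Rightarrow> {u..v})"
      using C by (subst emeasure_UN_countable) (auto simp: nn_integral_cmult)
    also have "\<dots> \<le> ennreal p * emeasure lebesgue U"
      using C(2) U(1) by (intro mult_left_mono emeasure_mono) auto
    also have "emeasure lebesgue U = emeasure lebesgue (E \<union> (U - E))"
      using U(2) by (simp add: Un_absorb1)
    also have "\<dots> \<le> emeasure lebesgue E + emeasure lebesgue (U - E)"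
      using U E by (intro emeasure_subadditive) (auto simp: fmeasurableD)
    also have "\<dots> \<le> ennreal m + ennreal e"
      using U m by (intro add_mono) auto
    finally have "ennreal R * ennreal m \<le> ennreal p * (ennreal m + ennreal e)"
      using m by (simp add: mult_left_mono)
    then have "ennreal (R * m) \<le> ennreal (p * (m + e))"
      using m0 e p by (simp add: ennreal_mult ennreal_plus)
    then show ?thesis using m0 e p by (subst (asm) ennreal_le_iff) auto
  qed
  have "R * m \<le> p * m"
  proof (rule ccontr)
    assume "\<not> R * m \<le> p * m"
    then have "m > 0" and "R * m - p * m > 0" using m0 by (auto simp: less_le)
    then have "R * m \<le> p * (m + (R * m - p * m) / (2 * (p + 1)))" using p by (intro key) auto
    also have "\<dots> = p * m + (p / (p + 1)) * ((R * m - p * m) / 2)"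
      using p by (simp add: field_simps)
    also have "\<dots> \<le> p * m + 1 * ((R * m - p * m) / 2)"
      using p \<open>R * m - p * m > 0\<close> by (intro add_left_mono mult_right_mono) auto
    finally show False using \<open>R * m - p * m > 0\<close> by (simp add: field_simps)
  qed
  then have "(R - p) * m \<le> 0" by (simp add: algebra_simps)
  then have "m = 0" using p m0 by (simp add: mult_le_0_iff)
  then have "emeasure lebesgue E = 0" using m by simp
  then show ?thesis unfolding E_def[symmetric] using E by (auto intro!: null_setsI)
qed

lemma infinite_slopes_null:
  fixes F :: "real \<Rightarrow> real"
  assumes F: "mono F" "continuous_on UNIV F" and B: "B \<subseteq> {a<..<b}" "B \<in> sets borel" and "a < b"
  shows "B \<inter> (\<Inter>n::nat. steep_limit F (real n)) \<in> null_sets lebesgue"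
proof -
  define E where "E = B \<inter> (\<Inter>n::nat. steep_limit F (real n))"
  have E [measurable]: "E \<in> sets borel" using assms by (simp add: E_def)
  have El: "E \<in> lmeasurable" using B E
    by (intro bounded_set_imp_lmeasurable bounded_subset[OF bounded_box[of a b]])
      (auto simp: E_def)
  have m: "emeasure lebesgue E = ennreal (measure lebesgue E)" using El
    by (simp add: emeasure_eq_measure2 fmeasurableD2 emeasure_eq_ennreal_measure)
  have "real n * measure lebesgue E \<le> F b - F a" for n
  proof -
    have "ennreal (real n) * emeasure lebesgue E \<le> emeasure (interval_measure F) {a<..<b}"
      using F B by (intro steep_measure_le) (auto simp: E_def)
    also have "\<dots> \<le> emeasure (interval_measure F) {a..b}" by (intro emeasure_mono) auto
    also have "\<dots> = ennreal (F b - F a)"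
      using F \<open>a < b\<close> by (intro emeasure_interval_measure_Icc) (auto simp: mono_def)
    finally have "ennreal (real n * measure lebesgue E) \<le> ennreal (F b - F a)"
      unfolding m by (simp add: ennreal_mult)
    then show ?thesis using F \<open>a < b\<close> by (subst (asm) ennreal_le_iff) (auto simp: mono_def)
  qed
  then have "measure lebesgue E \<le> 0"
    by (metis linorder_not_less reals_Archimedean3)
  then have "measure lebesgue E = 0" using measure_nonneg[of lebesgue E] by linarith
  then have "emeasure lebesgue E = 0" using m by simp
  then show ?thesis unfolding E_def[symmetric] using E by (auto intro!: null_setsI)
qed

text \<open>
  The derivative is the infimum \<open>L\<close> of the rational bounds that eventually dominate all slopes around
  \<open>x\<close>. A rational \<open>R < L\<close> is not such a bound, so by \<open>osc\<close> all slopes are eventually at least \<open>p\<close>, for any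
  nonnegative rational \<open>p < R\<close>.
\<close>

lemma mono_differentiable_at:
  fixes F :: "real \<Rightarrow> real"
  assumes F: "mono F" "continuous_on UNIV F"
    and osc: "\<And>p R. p \<in> \<rat> \<Longrightarrow> R \<in> \<rat> \<Longrightarrow> 0 \<le> p \<Longrightarrow> p < R \<Longrightarrow>
      x \<notin> steep_limit F R \<or> x \<notin> steep_limit (\<lambda>x. - F x) (- p)"
    and fin: "\<exists>n::nat. x \<notin> steep_limit F (real n)"
  shows "F differentiable at x"
proof -
  define A where "A = {R \<in> \<rat>. x \<notin> steep_limit F R}"
  define L where "L = Inf A"
  have A0: "R \<ge> 0" if "R \<in> A" for R
  proof (rule ccontr)
    assume "\<not> R \<ge> 0"
    then have R: "R < 0" by simp
    have "x \<in> steep F R d" if "d > 0" for d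
      unfolding steep_iff
    proof (intro exI conjI)
      have "R * ((x + d / 3) - (x - d / 3)) < 0" using R that by (simp add: mult_neg_pos)
      also have "0 \<le> F (x + d/3) - F (x - d/3)" using F that by (simp add: mono_def)
      finally show "R * ((x + d / 3) - (x - d / 3)) < F (x + d/3) - F (x - d/3)" .
    qed (use that in auto)
    then show False using \<open>R \<in> A\<close> unfolding A_def steep_limit_iff by blast
  qed
  obtain n :: nat where "x \<notin> steep_limit F (real n)" using fin by blast
  then have "real n \<in> A" by (simp add: A_def)
  then have Ane: "A \<noteq> {}" by blast
  have bdd: "bdd_below A" by (rule bdd_belowI[of A 0]) (rule A0)
  have L0: "L \<ge> 0" unfolding L_def by (rule cInf_greatest[OF Ane]) (rule A0)
  have upper: "\<exists>d>0. \<forall>u v. u < x \<and> x < v \<and> v - u < d \<longrightarrow> F v - F u \<le> (L + e) * (v - u)" if "e > 0" for e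
  proof -
    have "Inf A < L + e" using that by (simp add: L_def)
    then obtain R where R: "R \<in> A" "R < L + e"
      using cInf_lessD[OF Ane] by blast
    then obtain d where "d > 0" "x \<notin> steep F R d" by (auto simp: A_def steep_limit_iff)
    moreover have "R * (v - u) \<le> (L + e) * (v - u)" if "u < v" for u v :: real
      using R that by (intro mult_right_mono) auto
    ultimately show ?thesis unfolding steep_iff
      by (meson less_trans not_le order_trans)
  qed
  have lower: "\<exists>d>0. \<forall>u v. u < x \<and> x < v \<and> v - u < d \<longrightarrow> (L - e) * (v - u) \<le> F v - F u" if "e > 0" for e
  proof (cases "L - e < 0")
    case True
    have "(L - e) * (v - u) \<le> F v - F u" if "u < v" for u v
    proof -
      have "(L - e) * (v - u) \<le> 0" using True that by (simp add: mult_nonpos_nonneg)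
      also have "0 \<le> F v - F u" using F that by (simp add: mono_def)
      finally show ?thesis .
    qed
    then show ?thesis by (meson less_trans zero_less_one)
  next
    case False
    obtain p where p: "p \<in> \<rat>" "L - e < p" "p < L" 
    proof -
      have "L - e < L" using \<open>e > 0\<close> by simp
      from Rats_dense_in_real[OF this] show ?thesis using that by blast
    qed
    obtain R where R: "R \<in> \<rat>" "p < R" "R < L" 
      using Rats_dense_in_real[OF p(3)] by blast
    have "R \<notin> A" using R cInf_lower[OF _ bdd] unfolding L_def by force
    then have "x \<in> steep_limit F R" using R by (simp add: A_def)
    then have "x \<notin> steep_limit (\<lambda>x. - F x) (- p)" using osc[of p R] p R False by auto
    then obtain d where d: "d > 0" "x \<notin> steep (\<lambda>x. - F x) (- p) d" by (auto simp: steep_limit_iff)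
    have "(L - e) * (v - u) \<le> F v - F u" if "u < x" "x < v" "v - u < d" for u v
    proof -
      have "(L - e) * (v - u) \<le> p * (v - u)" using p that by (intro mult_right_mono) auto
      also have "\<dots> \<le> F v - F u"
      proof (rule ccontr)
        assume "\<not> p * (v - u) \<le> F v - F u"
        then have "- p * (v - u) < - F v - - F u" by simp
        then show False using d that unfolding steep_iff by blast
      qed
      finally show ?thesis .
    qed
    then show ?thesis using d by blast
  qed
  have "(F has_field_derivative L) (at x)"
    unfolding has_field_derivative_iff tendsto_iff
  proof (intro allI impI)
    fix e :: real assume "e > 0"
    then have e: "e / 2 > 0" by simp
    obtain d1 where d1: "d1 > 0" "\<And>u v. u < x \<Longrightarrow> x < v \<Longrightarrow> v - u < d1 \<Longrightarrow> F v - F u \<le> (L + e/2) * (v - u)"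
      using upper[OF e] by blast
    obtain d2 where d2: "d2 > 0" "\<And>u v. u < x \<Longrightarrow> x < v \<Longrightarrow> v - u < d2 \<Longrightarrow> (L - e/2) * (v - u) \<le> F v - F u"
      using lower[OF e] by blast
    define d where "d = min d1 d2"
    have d: "d > 0" using d1 d2 by (simp add: d_def)
    \<comment> \<open>One-sided difference quotients are limits of slopes over intervals
      that contain x in their interior, because F is continuous.\<close>
    have closed: "F q - F p \<le> (L + e/2) * (q - p) \<and> (L - e/2) * (q - p) \<le> F q - F p"
      if pq: "p \<le> x" "x \<le> q" "q - p < d" for p q
    proof
      define s where "s n = 1 / real (Suc n)" for n
      have s: "s \<longlonglongrightarrow> 0" "s n > 0" for n
        using LIMSEQ_Suc[OF lim_1_over_n] by (auto simp: s_def[abs_def])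
      have lim: "(\<lambda>n. F (q + s n) - F (p - s n)) \<longlonglongrightarrow> F q - F p"
      proof (intro tendsto_diff)
        have "isCont F y" for y using F(2) by (simp add: continuous_on_eq_continuous_at)
        then show "(\<lambda>n. F (q + s n)) \<longlonglongrightarrow> F q" "(\<lambda>n. F (p - s n)) \<longlonglongrightarrow> F p"
          using isCont_tendsto_compose[of q F "\<lambda>n. q + s n"] isCont_tendsto_compose[of p F "\<lambda>n. p - s n"]
            tendsto_add[OF tendsto_const s(1), of q] tendsto_diff[OF tendsto_const s(1), of p] by auto
      qed
      have slopes: "(\<lambda>n. k * ((q + s n) - (p - s n))) \<longlonglongrightarrow> k * (q - p)" for k
        using tendsto_mult[OF tendsto_const[of k] tendsto_diff[OF tendsto_add[OF tendsto_const[of q] s(1)]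
          tendsto_diff[OF tendsto_const[of p] s(1)]]] by simp
      have "(\<lambda>n. 2 * s n) \<longlonglongrightarrow> 2 * 0" by (intro tendsto_intros s)
      then have "eventually (\<lambda>n. 2 * s n < d - (q - p)) sequentially"
        by (rule order_tendstoD(2)) (use pq in simp)
      then have ev: "eventually (\<lambda>n. p - s n < x \<and> x < q + s n \<and> (q + s n) - (p - s n) < d) sequentially"
      proof eventually_elim
        case (elim n)
        then show ?case using s(2)[of n] pq(1,2) by (intro conjI) linarith+
      qed
      show "F q - F p \<le> (L + e/2) * (q - p)"
      proof (rule tendsto_le[OF _ slopes lim])
        show "eventually (\<lambda>n. F (q + s n) - F (p - s n) \<le> (L + e/2) * ((q + s n) - (p - s n))) sequentially"
          using ev by eventually_elim (rule d1(2), simp_all add: d_def)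
      qed simp
      show "(L - e/2) * (q - p) \<le> F q - F p"
      proof (rule tendsto_le[OF _ lim slopes])
        show "eventually (\<lambda>n. (L - e/2) * ((q + s n) - (p - s n)) \<le> F (q + s n) - F (p - s n)) sequentially"
          using ev by eventually_elim (rule d2(2), simp_all add: d_def)
      qed simp
    qed
    have slope: "\<bar>s / t - L\<bar> \<le> k" if "0 < t" "s \<le> (L + k) * t" "(L - k) * t \<le> s" for s t k :: real
      using that pos_divide_le_eq[of t s "L + k"] pos_le_divide_eq[of t "L - k" s] by linarith
    show "\<forall>\<^sub>F y in at x. dist ((F y - F x) / (y - x)) L < e"
      unfolding eventually_at
    proof (intro exI[of _ d] conjI ballI impI)
      fix y :: real assume y: "y \<noteq> x \<and> dist y x < d"
      have "\<bar>(F y - F x) / (y - x) - L\<bar> \<le> e / 2"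
      proof (cases "y > x")
        case True
        then show ?thesis using closed[of x y] y by (intro slope) (auto simp: dist_real_def)
      next
        case False
        then have "(F y - F x) / (y - x) = (F x - F y) / (x - y)" "x - y > 0"
          using y by (simp_all add: field_simps)
        moreover have "\<bar>(F x - F y) / (x - y) - L\<bar> \<le> e / 2"
          using closed[of y x] y False \<open>x - y > 0\<close> by (intro slope) (auto simp: dist_real_def)
        ultimately show ?thesis by simp
      qed
      then show "dist ((F y - F x) / (y - x)) L < e" using \<open>e > 0\<close> by (simp add: dist_real_def)
    qed (use d in auto)
  qed
  then show ?thesis by (auto simp: real_differentiable_def)
qed

text \<open>
  Lebesgue's theorem for continuous monotone functions.
\<close>

theorem mono_AE_differentiable:
  fixes F :: "real \<Rightarrow> real"
  assumes F: "mono F" "continuous_on UNIV F"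
  shows "AE x in lebesgue. F differentiable at x"
proof -
  have osc: "AE x in lebesgue. \<not> (x \<in> {-real k<..<real k} \<inter> steep_limit F R \<inter> steep_limit (\<lambda>x. - F x) (- p))"
    if "0 \<le> p" "p < R" for k p R
    by (intro AE_not_in oscillating_slopes_null F that)
      (use bounded_box[of "- real k" "real k"] in simp_all)
  have inf: "AE x in lebesgue. \<not> (x \<in> {-real (Suc k)<..<real (Suc k)} \<inter> (\<Inter>n::nat. steep_limit F (real n)))" for k
    by (intro AE_not_in infinite_slopes_null[where a = "-real (Suc k)" and b = "real (Suc k)"] F) auto
  have "AE x in lebesgue. \<forall>k::nat. \<forall>p\<in>\<rat>. \<forall>R\<in>\<rat>. 0 \<le> p \<longrightarrow> p < R \<longrightarrow>
     \<not> (x \<in> {-real k<..<real k} \<inter> steep_limit F R \<inter> steep_limit (\<lambda>x. - F x) (- p))"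
    unfolding AE_all_countable
    by (intro allI AE_ball_countable' countable_rat) (use osc in auto)
  moreover have "AE x in lebesgue. \<forall>k. \<not> (x \<in> {-real (Suc k)<..<real (Suc k)} \<inter> (\<Inter>n::nat. steep_limit F (real n)))"
    unfolding AE_all_countable using inf by blast
  ultimately show ?thesis
  proof eventually_elim
    case (elim x)
    obtain k where k: "\<bar>x\<bar> < real k" using reals_Archimedean2 by blast
    then have xk: "x \<in> {-real k<..<real k}" "x \<in> {-real (Suc k)<..<real (Suc k)}" by auto
    show ?case
    proof (rule mono_differentiable_at[OF F])
      show "\<exists>n. x \<notin> steep_limit F (real n)" using elim(2) xk by blast
    qed (use elim(1) xk in blast)
  qed
qed

section \<open>Absolutely continuous functions\<close>

definition intervals_in :: "real \<Rightarrow> real \<Rightarrow> nat \<Rightarrow> (nat \<Rightarrow> real) \<Rightarrow> (nat \<Rightarrow> real) \<Rightarrow> bool" where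
  "intervals_in a b n u v \<longleftrightarrow> (\<forall>i<n. a \<le> u i \<and> u i \<le> v i \<and> v i \<le> b) \<and>
    disjoint_family_on (\<lambda>i. {u i<..<v i}) {..<n}"

definition increment_sum :: "(real \<Rightarrow> real) \<Rightarrow> nat \<Rightarrow> (nat \<Rightarrow> real) \<Rightarrow> (nat \<Rightarrow> real) \<Rightarrow> real" where
  "increment_sum h n u v = (\<Sum>i<n. \<bar>h (v i) - h (u i)\<bar>)"

lemma abs_continuous_onD:
  assumes "abs_continuous_on a b h" "\<epsilon> > 0"
  obtains \<delta> where "\<delta> > 0" "\<And>n u v. intervals_in a b n u v \<Longrightarrow> (\<Sum>i<n. v i - u i) < \<delta> \<Longrightarrow> increment_sum h n u v < \<epsilon>"
proof -
  from assms obtain \<delta> where "\<delta> > 0" "\<forall>(n::nat) (u :: nat \<Rightarrow> real) (v :: nat \<Rightarrow> real).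
      (\<forall>i<n. a \<le> u i \<and> u i \<le> v i \<and> v i \<le> b) \<and>
      disjoint_family_on (\<lambda>i. {u i<..<v i}) {..<n} \<and>
      (\<Sum>i<n. v i - u i) < \<delta> \<longrightarrow> (\<Sum>i<n. \<bar>h (v i) - h (u i)\<bar>) < \<epsilon>"
    unfolding abs_continuous_on_def by blast
  then show ?thesis by (intro that[of \<delta>]) (simp_all add: intervals_in_def increment_sum_def)
qed

lemma intervals_in_length:
  assumes "intervals_in a b n u v" "a \<le> b"
  shows "(\<Sum>i<n. v i - u i) \<le> b - a"
proof -
  have "ennreal (\<Sum>i<n. v i - u i) = (\<Sum>i<n. emeasure lborel {u i<..<v i})"
    using assms by (subst sum_ennreal[symmetric]) (auto simp: intervals_in_def)
  also have "\<dots> = emeasure lborel (\<Union>i\<in>{..<n}. {u i<..<v i})"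
    using assms by (intro sum_emeasure) (auto simp: intervals_in_def)
  also have "\<dots> \<le> emeasure lborel {a..b}"
    using assms by (intro emeasure_mono) (fastforce simp: intervals_in_def)+
  also have "\<dots> = ennreal (b - a)" using assms by simp
  finally show ?thesis using assms by (subst (asm) ennreal_le_iff) auto
qed

text \<open>
  Cutting every interval of a family at \<open>y\<close>; this carries both the boundedness and the continuity of
  the variation.
\<close>

lemma increment_sum_split:
  "increment_sum h n u v \<le>
    increment_sum h n (\<lambda>i. min (u i) y) (\<lambda>i. min (v i) y) + increment_sum h n (\<lambda>i. max (u i) y) (\<lambda>i. max (v i) y)"
  unfolding increment_sum_def sum.distrib[symmetric]
  by (intro sum_mono) (auto simp: min_def max_def)

lemma intervals_in_split:
  assumes "intervals_in a b n u v" "a \<le> y" "y \<le> b"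
  shows "intervals_in a y n (\<lambda>i. min (u i) y) (\<lambda>i. min (v i) y)"
    and "intervals_in y b n (\<lambda>i. max (u i) y) (\<lambda>i. max (v i) y)"
proof -
  have disj: "disjoint_family_on I {..<n}" if "\<And>i. I i \<subseteq> {u i<..<v i}" for I
    using assms(1) that unfolding intervals_in_def disjoint_family_on_def by blast
  have "disjoint_family_on (\<lambda>i. {min (u i) y<..<min (v i) y}) {..<n}" by (rule disj) auto
  then show "intervals_in a y n (\<lambda>i. min (u i) y) (\<lambda>i. min (v i) y)"
    using assms by (auto simp: intervals_in_def intro: min.mono)
  have "disjoint_family_on (\<lambda>i. {max (u i) y<..<max (v i) y}) {..<n}" by (rule disj) auto
  then show "intervals_in y b n (\<lambda>i. max (u i) y) (\<lambda>i. max (v i) y)"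
    using assms by (auto simp: intervals_in_def intro: max.mono)
qed

lemma intervals_in_mono: "intervals_in a x n u v \<Longrightarrow> x \<le> y \<Longrightarrow> intervals_in a y n u v"
  by (auto simp: intervals_in_def)

lemma intervals_in_mono_left: "intervals_in y b n u v \<Longrightarrow> a \<le> y \<Longrightarrow> intervals_in a b n u v"
  by (auto simp: intervals_in_def)

text \<open>
  Absolute continuity bounds the variation on intervals shorter than \<open>\<delta>\<close> by \<open>1\<close>, and \<open>[a, b]\<close> is a
  finite union of such intervals.
\<close>

lemma increment_sum_bounded:
  assumes h: "abs_continuous_on a b h" and "a \<le> b"
  obtains B where "\<And>n u v. intervals_in a b n u v \<Longrightarrow> increment_sum h n u v \<le> B"
proof -
  obtain \<delta> where \<delta>: "\<delta> > 0" "\<And>n u v. intervals_in a b n u v \<Longrightarrow> (\<Sum>i<n. v i - u i) < \<delta> \<Longrightarrow> increment_sum h n u v < 1"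
    using abs_continuous_onD[OF h, of 1] by auto
  have *: "increment_sum h n u v \<le> real k + 1"
    if "intervals_in a x n u v" "a \<le> x" "x \<le> b" "x \<le> a + real k * (\<delta> / 2)" for k n u v x
    using that
  proof (induction k arbitrary: x n u v)
    case 0
    then have "(\<Sum>i<n. v i - u i) < \<delta>" using intervals_in_length[OF 0(1)] \<delta> by auto
    then show ?case using \<delta>(2)[of n u v] intervals_in_mono[OF 0(1), of b] 0 by auto
  next
    case (Suc k)
    show ?case
    proof (cases "x \<le> a + real k * (\<delta> / 2)")
      case True
      then show ?thesis using Suc.IH[of x n u v] Suc.prems by auto
    next
      case False
      define y where "y = a + real k * (\<delta> / 2)"
      have "a + real (Suc k) * (\<delta> / 2) = y + \<delta> / 2" by (simp add: y_def algebra_simps)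
      then have "x \<le> y + \<delta> / 2" using Suc.prems(4) by (simp only:)
      moreover have "a \<le> y" "y \<le> x" using False \<delta>(1) by (auto simp: y_def)
      ultimately have y: "a \<le> y" "y \<le> x" "x - y < \<delta>" using \<delta>(1) by linarith+
      note sp = intervals_in_split[OF Suc.prems(1) y(1,2)]
      have "increment_sum h n (\<lambda>i. min (u i) y) (\<lambda>i. min (v i) y) \<le> real k + 1"
        using Suc.IH[OF sp(1)] y Suc.prems by (auto simp: y_def)
      moreover have "increment_sum h n (\<lambda>i. max (u i) y) (\<lambda>i. max (v i) y) < 1"
        using intervals_in_length[OF sp(2)] y Suc.prems
        by (intro \<delta>(2) intervals_in_mono_left[OF intervals_in_mono[OF sp(2)]]) auto
      ultimately show ?thesis using increment_sum_split[of h n u v y] by simp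
    qed
  qed
  obtain k :: nat where "(b - a) / (\<delta> / 2) < real k" using reals_Archimedean2 by blast
  then have "b \<le> a + real k * (\<delta> / 2)" using \<delta> by (simp add: field_simps)
  then show ?thesis using * \<open>a \<le> b\<close> by (intro that[of "real k + 1"]) auto
qed

definition variation_function :: "(real \<Rightarrow> real) \<Rightarrow> real \<Rightarrow> real \<Rightarrow> real" where
  "variation_function h a x = Sup {increment_sum h n u v | n u v. intervals_in a x n u v}"

lemma variation_function_properties:
  assumes h: "abs_continuous_on a b h" and "a \<le> b"
  defines "V \<equiv> variation_function h a"
  shows increment_le_variation: "\<And>x y. a \<le> x \<Longrightarrow> x \<le> y \<Longrightarrow> y \<le> b \<Longrightarrow> \<bar>h y - h x\<bar> \<le> V y - V x"
    and variation_uniform: "\<And>\<epsilon>. \<epsilon> > 0 \<Longrightarrow>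
       \<exists>\<delta>>0. \<forall>x y. a \<le> x \<longrightarrow> x \<le> y \<longrightarrow> y \<le> b \<longrightarrow> y - x < \<delta> \<longrightarrow> V y \<le> V x + \<epsilon>"
proof -
  obtain B where B: "\<And>n u v. intervals_in a b n u v \<Longrightarrow> increment_sum h n u v \<le> B"
    using increment_sum_bounded[OF assms(1,2)] by blast
  have V_upper: "increment_sum h n u v \<le> V x" if "intervals_in a x n u v" "x \<le> b" for n u v x
    unfolding V_def variation_function_def
  proof (rule cSup_upper)
    show "bdd_above {increment_sum h n u v |n u v. intervals_in a x n u v}"
      using B intervals_in_mono that(2) by (intro bdd_aboveI[of _ B]) blast
  qed (use that in blast)
  have V_least: "V x \<le> c" if "\<And>n u v. intervals_in a x n u v \<Longrightarrow> increment_sum h n u v \<le> c" for c x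
    unfolding V_def variation_function_def
  proof (rule cSup_least)
    have "intervals_in a x 0 (\<lambda>_. a) (\<lambda>_. a)" by (simp add: intervals_in_def disjoint_family_on_def)
    then show "{increment_sum h n u v |n u v. intervals_in a x n u v} \<noteq> {}" by blast
  qed (use that in blast)
  show "\<bar>h y - h x\<bar> \<le> V y - V x" if "a \<le> x" "x \<le> y" "y \<le> b" for x y
  proof -
    have "V x \<le> V y - \<bar>h y - h x\<bar>"
    proof (rule V_least)
      fix n u v assume uv: "intervals_in a x n u v"
      have "intervals_in a y (Suc n) (u(n := x)) (v(n := y))"
        using uv that unfolding intervals_in_def disjoint_family_on_def
        by (fastforce simp: less_Suc_eq)
      then have "increment_sum h (Suc n) (u(n := x)) (v(n := y)) \<le> V y"
        using V_upper that by blast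
      then show "increment_sum h n u v \<le> V y - \<bar>h y - h x\<bar>"
        by (simp add: increment_sum_def)
    qed
    then show ?thesis by simp
  qed
  show "\<exists>\<delta>>0. \<forall>x y. a \<le> x \<longrightarrow> x \<le> y \<longrightarrow> y \<le> b \<longrightarrow> y - x < \<delta> \<longrightarrow> V y \<le> V x + \<epsilon>" if "\<epsilon> > 0" for \<epsilon>
  proof -
    obtain \<delta> where \<delta>: "\<delta> > 0" "\<And>n u v. intervals_in a b n u v \<Longrightarrow> (\<Sum>i<n. v i - u i) < \<delta> \<Longrightarrow> increment_sum h n u v < \<epsilon>"
      using abs_continuous_onD[OF h \<open>\<epsilon> > 0\<close>] by auto
    show ?thesis
    proof (intro exI[of _ \<delta>] conjI allI impI \<delta>(1))
      fix x y assume xy: "a \<le> x" "x \<le> y" "y \<le> b" "y - x < \<delta>"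
      show "V y \<le> V x + \<epsilon>"
      proof (rule V_least)
        fix n u v assume "intervals_in a y n u v"
        note sp = intervals_in_split[OF this xy(1,2)]
        have "increment_sum h n (\<lambda>i. min (u i) x) (\<lambda>i. min (v i) x) \<le> V x"
          using V_upper sp(1) xy by auto
        moreover have "increment_sum h n (\<lambda>i. max (u i) x) (\<lambda>i. max (v i) x) < \<epsilon>"
          using intervals_in_length[OF sp(2)] xy
          by (intro \<delta>(2) intervals_in_mono_left[OF intervals_in_mono[OF sp(2)]]) auto
        ultimately show "increment_sum h n u v \<le> V x + \<epsilon>" using increment_sum_split[of h n u v x] by simp
      qed
    qed
  qed
qed

lemma mono_uniform_imp_continuous:
  fixes F :: "real \<Rightarrow> real"
  assumes "mono F" and unif: "\<And>\<epsilon>. \<epsilon> > 0 \<Longrightarrow> \<exists>\<delta>>0. \<forall>x y. x \<le> y \<longrightarrow> y - x < \<delta> \<longrightarrow> F y \<le> F x + \<epsilon>"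
  shows "continuous_on UNIV F"
proof (rule continuous_onI)
  fix x e :: real assume "e > 0"
  then obtain \<delta> where \<delta>: "\<delta> > 0" "\<And>x y. x \<le> y \<Longrightarrow> y - x < \<delta> \<Longrightarrow> F y \<le> F x + e"
    using unif by blast
  have "dist (F y) (F x) \<le> e" if "dist y x < \<delta>" for y
  proof (cases "x \<le> y")
    case True
    then show ?thesis using \<delta>(2)[of x y] that monoD[OF \<open>mono F\<close> True] by (simp add: dist_real_def)
  next
    case False
    then have "y \<le> x" by simp
    then show ?thesis using \<delta>(2)[of y x] that monoD[OF \<open>mono F\<close> \<open>y \<le> x\<close>] by (simp add: dist_real_def)
  qed
  then show "\<exists>d>0. \<forall>x'\<in>UNIV. dist x' x < d \<longrightarrow> dist (F x') (F x) \<le> e" using \<delta> by blast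
qed

text \<open>
  \<open>h = V - (V - h)\<close> with \<open>V\<close> the variation of \<open>h\<close>, and both terms are continuous and increasing.
  Composition with the projection onto \<open>[a, b]\<close> extends them to the whole line.
\<close>

theorem abs_continuous_AE_differentiable:
  assumes h: "abs_continuous_on a b h" and ab: "a \<le> b"
  shows "AE x in lebesgue. x \<in> {a<..<b} \<longrightarrow> h differentiable at x"
proof -
  define V where "V = variation_function h a"
  define c where "c x = max a (min b x)" for x
  have c: "a \<le> c x" "c x \<le> b" for x using ab by (auto simp: c_def)
  have cm: "c x \<le> c y" if "x \<le> y" for x y using that by (auto simp: c_def)
  have cd: "c y - c x \<le> y - x" if "x \<le> y" for x y using that by (auto simp: c_def)
  note inc = increment_le_variation[OF h ab, folded V_def]
  note unif = variation_uniform[OF h ab, folded V_def]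
  have inc': "\<bar>h (c y) - h (c x)\<bar> \<le> V (c y) - V (c x)" if "x \<le> y" for x y
    using inc c cm[OF that] by blast
  have unif1: "\<exists>\<delta>>0. \<forall>x y. x \<le> y \<longrightarrow> y - x < \<delta> \<longrightarrow> V (c y) \<le> V (c x) + \<epsilon>" if e: "\<epsilon> > 0" for \<epsilon>
  proof -
    obtain \<delta> where \<delta>: "\<delta> > 0" "\<And>x y. a \<le> x \<Longrightarrow> x \<le> y \<Longrightarrow> y \<le> b \<Longrightarrow> y - x < \<delta> \<Longrightarrow> V y \<le> V x + \<epsilon>"
      using unif[OF e] by blast
    have "V (c y) \<le> V (c x) + \<epsilon>" if "x \<le> y" "y - x < \<delta>" for x y
      using \<delta>(2)[of "c x" "c y"] c cm[OF that(1)] cd[OF that(1)] that by auto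
    then show ?thesis using \<delta>(1) by blast
  qed
  have m1: "mono (\<lambda>x. V (c x))" using inc' by (intro monoI) (smt (verit))
  have m2: "mono (\<lambda>x. V (c x) - h (c x))" using inc' by (intro monoI) (smt (verit))
  have u2: "\<exists>\<delta>>0. \<forall>x y. x \<le> y \<longrightarrow> y - x < \<delta> \<longrightarrow> V (c y) - h (c y) \<le> V (c x) - h (c x) + \<epsilon>" if e: "\<epsilon> > 0" for \<epsilon>
  proof -
    obtain \<delta> where "\<delta> > 0" "\<forall>x y. x \<le> y \<longrightarrow> y - x < \<delta> \<longrightarrow> V (c y) \<le> V (c x) + \<epsilon> / 2"
      using unif1[of "\<epsilon> / 2"] e by auto
    then show ?thesis using inc' by (intro exI[of _ \<delta>]) (smt (verit) field_sum_of_halves)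
  qed
  have "AE x in lebesgue. (\<lambda>x. V (c x)) differentiable at x"
    by (intro mono_AE_differentiable m1 mono_uniform_imp_continuous unif1)
  moreover have "AE x in lebesgue. (\<lambda>x. V (c x) - h (c x)) differentiable at x"
    by (intro mono_AE_differentiable m2 mono_uniform_imp_continuous u2)
  ultimately show ?thesis
  proof eventually_elim
    case (elim x)
    show ?case
    proof
      assume x: "x \<in> {a<..<b}"
      have "(\<lambda>x. V (c x) - (V (c x) - h (c x))) differentiable at x"
        using elim by (rule differentiable_diff)
      then obtain D where "((\<lambda>x. h (c x)) has_real_derivative D) (at x)"
        by (auto simp: real_differentiable_def)
      then have "(h has_real_derivative D) (at x)"
        by (rule has_field_derivative_transform_within_open[of _ _ _ "{a<..<b}"])
          (use x in \<open>auto simp: c_def\<close>)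
      then show "h differentiable at x" by (auto simp: real_differentiable_def)
    qed
  qed
qed

lemma straddle_slopes_tendsto:
  fixes h :: "real \<Rightarrow> real"
  assumes h: "(h has_real_derivative D) (at x)"
    and uv: "\<And>n. u n \<le> x" "\<And>n. x < v n" "u \<longlonglongrightarrow> x" "v \<longlonglongrightarrow> x"
  shows "(\<lambda>n. (h (v n) - h (u n)) / (v n - u n)) \<longlonglongrightarrow> D"
proof (rule LIMSEQ_I)
  fix e :: real assume e: "e > 0"
  obtain d where d: "d > 0" "\<And>y. y \<noteq> x \<Longrightarrow> \<bar>y - x\<bar> < d \<Longrightarrow> \<bar>(h y - h x) / (y - x) - D\<bar> < e / 2"
    using h[unfolded has_field_derivative_iff tendsto_iff, rule_format, of "e / 2"] e
    unfolding eventually_at dist_real_def by auto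
  have d': "\<bar>h y - h x - D * (y - x)\<bar> \<le> e / 2 * \<bar>y - x\<bar>" if "\<bar>y - x\<bar> < d" for y
  proof (cases "y = x")
    case False
    have "h y - h x - D * (y - x) = ((h y - h x) / (y - x) - D) * (y - x)"
      using False by (subst left_diff_distrib) simp
    then have "\<bar>h y - h x - D * (y - x)\<bar> = \<bar>((h y - h x) / (y - x) - D) * (y - x)\<bar>" by simp
    also have "\<dots> \<le> e / 2 * \<bar>y - x\<bar>" unfolding abs_mult
      using d(2)[of y] False that by (intro mult_right_mono) auto
    finally show ?thesis .
  qed simp
  have "eventually (\<lambda>n. dist (u n) x < d \<and> dist (v n) x < d) sequentially"
    using uv d by (auto intro!: eventually_conj dest: tendstoD)
  then obtain N where N: "\<And>n. n \<ge> N \<Longrightarrow> dist (u n) x < d \<and> dist (v n) x < d"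
    by (auto simp: eventually_sequentially)
  have "norm ((h (v n) - h (u n)) / (v n - u n) - D) < e" if "n \<ge> N" for n
  proof -
    have pos: "v n - u n > 0" using uv(1,2)[of n] by simp
    have "\<bar>h (v n) - h (u n) - D * (v n - u n)\<bar> \<le>
        \<bar>h (v n) - h x - D * (v n - x)\<bar> + \<bar>h (u n) - h x - D * (u n - x)\<bar>"
      by (simp add: algebra_simps)
    also have "\<dots> \<le> e / 2 * \<bar>v n - x\<bar> + e / 2 * \<bar>u n - x\<bar>"
      using N[OF that] by (intro add_mono d') (auto simp: dist_real_def)
    also have "\<dots> = e / 2 * (v n - u n)"
      using uv(1,2)[of n] unfolding distrib_left[symmetric] by simp
    also have "\<dots> < e * (v n - u n)" using e pos by simp
    finally have "\<bar>h (v n) - h (u n) - D * (v n - u n)\<bar> < e * (v n - u n)" .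
    moreover have "(h (v n) - h (u n)) / (v n - u n) - D = (h (v n) - h (u n) - D * (v n - u n)) / (v n - u n)"
      using pos by (simp add: field_simps)
    ultimately show ?thesis using pos by (simp add: abs_divide pos_divide_less_eq)
  qed
  then show "\<exists>N. \<forall>n\<ge>N. norm ((h (v n) - h (u n)) / (v n - u n) - D) < e" by blast
qed

lemma abs_continuous_on_subinterval:
  assumes "abs_continuous_on a b h" "a \<le> c" "d \<le> b"
  shows "abs_continuous_on c d h"
  unfolding abs_continuous_on_def
proof (intro allI impI)
  fix \<epsilon> :: real assume "\<epsilon> > 0"
  from abs_continuous_onD[OF assms(1) this] obtain \<delta> where \<delta>: "\<delta> > 0"
    "\<And>n u v. intervals_in a b n u v \<Longrightarrow> (\<Sum>i<n. v i - u i) < \<delta> \<Longrightarrow> increment_sum h n u v < \<epsilon>"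
    by blast
  show "\<exists>\<delta>>0. \<forall>(n::nat) (u :: nat \<Rightarrow> real) (v :: nat \<Rightarrow> real). (\<forall>i<n. c \<le> u i \<and> u i \<le> v i \<and> v i \<le> d) \<and>
      disjoint_family_on (\<lambda>i. {u i<..<v i}) {..<n} \<and> (\<Sum>i<n. v i - u i) < \<delta> \<longrightarrow>
      (\<Sum>i<n. \<bar>h (v i) - h (u i)\<bar>) < \<epsilon>"
  proof (intro exI[of _ \<delta>] conjI allI impI \<delta>(1))
    fix n :: nat and u v :: "nat \<Rightarrow> real"
    assume *: "(\<forall>i<n. c \<le> u i \<and> u i \<le> v i \<and> v i \<le> d) \<and>
      disjoint_family_on (\<lambda>i. {u i<..<v i}) {..<n} \<and> (\<Sum>i<n. v i - u i) < \<delta>"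
    then have "intervals_in a b n u v" using assms(2,3) by (force simp: intervals_in_def)
    then show "(\<Sum>i<n. \<bar>h (v i) - h (u i)\<bar>) < \<epsilon>"
      using \<delta>(2) * by (simp add: increment_sum_def)
  qed
qed

text \<open>
  The cells of a uniform grid on which the slope exceeds \<open>K\<close> have small total length, since the
  variation is bounded; so by absolute continuity they contribute at most \<open>\<epsilon>\<close> to the increment. In
  other words, the slopes are uniformly integrable as the grid is refined.
\<close>

lemma abs_continuous_truncated_slopes:
  assumes h: "abs_continuous_on a b h" and ab: "a < b" and \<epsilon>: "\<epsilon> > 0"
  obtains K where "K > 0" "\<And>n. n > 0 \<Longrightarrow>
    \<bar>h b - h a\<bar> \<le> \<epsilon> + (\<Sum>k<n. (b - a) / real n *
       min K \<bar>(h (a + real (Suc k) * ((b - a) / real n)) - h (a + real k * ((b - a) / real n))) / ((b - a) / real n)\<bar>)"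
proof -
  obtain \<delta> where \<delta>: "\<delta> > 0"
    "\<And>n u v. intervals_in a b n u v \<Longrightarrow> (\<Sum>i<n. v i - u i) < \<delta> \<Longrightarrow> increment_sum h n u v < \<epsilon>"
    using abs_continuous_onD[OF h \<epsilon>] by blast
  obtain B where B: "\<And>n u v. intervals_in a b n u v \<Longrightarrow> increment_sum h n u v \<le> B"
    using increment_sum_bounded[OF h less_imp_le[OF ab]] by blast
  \<comment> \<open>Cells of slope above K have total length at most B / K, which is below \<delta>.\<close>
  define K where "K = (\<bar>B\<bar> + 1) / \<delta>"
  have K: "K > 0" using \<delta> by (simp add: K_def)
  show ?thesis
  proof (rule that[OF K])
    fix n :: nat assume n: "n > 0"
    define w where "w = (b - a) / real n"
    have w: "w > 0" using ab n by (simp add: w_def)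
    have nw: "real n * w = b - a" using n by (simp add: w_def)
    define t where "t k = a + real k * w" for k
    have t: "t k \<le> t l" if "k \<le> l" for k l using that w by (simp add: t_def)
    have t0: "t 0 = a" "t n = b" using nw by (simp_all add: t_def)
    have tS: "t (Suc k) - t k = w" for k by (simp add: t_def algebra_simps)
    define \<Delta> where "\<Delta> k = h (t (Suc k)) - h (t k)" for k
    define S where "S = {k. k < n \<and> \<bar>\<Delta> k\<bar> > K * w}"
    define v where "v k = (if k \<in> S then t (Suc k) else t k)" for k
    have inS: "intervals_in a b n t v"
      unfolding intervals_in_def
    proof (intro conjI allI impI)
      fix k assume "k < n"
      then show "a \<le> t k" "t k \<le> v k" "v k \<le> b"
        using t[of 0 k] t[of k "Suc k"] t[of "Suc k" n] t[of k n] by (auto simp: v_def t0)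
    next
      have "{t k<..<v k} \<inter> {t l<..<v l} = {}" if "k < l" for k l
      proof -
        have "v k \<le> t (Suc k)" using t[of k "Suc k"] by (simp add: v_def)
        also have "\<dots> \<le> t l" using that by (intro t) auto
        finally show ?thesis by auto
      qed
      then show "disjoint_family_on (\<lambda>i. {t i<..<v i}) {..<n}"
        unfolding disjoint_family_on_def by (metis inf_commute nat_neq_iff)
    qed
    have fS: "finite S" by (simp add: S_def)
    have SS: "increment_sum h n t v = (\<Sum>k\<in>S. \<bar>\<Delta> k\<bar>)"
    proof -
      have "increment_sum h n t v = (\<Sum>k<n. if k \<in> S then \<bar>\<Delta> k\<bar> else 0)"
        unfolding increment_sum_def by (intro sum.cong) (auto simp: v_def \<Delta>_def)
      also have "\<dots> = (\<Sum>k\<in>{..<n} \<inter> S. \<bar>\<Delta> k\<bar>)" by (simp add: sum.inter_restrict)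
      also have "{..<n} \<inter> S = S" by (auto simp: S_def)
      finally show ?thesis .
    qed
    have len: "(\<Sum>k<n. v k - t k) = real (card S) * w"
    proof -
      have "(\<Sum>k<n. v k - t k) = (\<Sum>k<n. if k \<in> S then w else 0)"
        by (intro sum.cong) (auto simp: v_def tS)
      also have "\<dots> = (\<Sum>k\<in>{..<n} \<inter> S. w)" by (rule sum.inter_restrict[symmetric]) simp
      also have "{..<n} \<inter> S = S" by (auto simp: S_def)
      finally show ?thesis by simp
    qed
    have "real (card S) * (K * w) \<le> (\<Sum>k\<in>S. \<bar>\<Delta> k\<bar>)"
      using sum_mono[of S "\<lambda>_. K * w" "\<lambda>k. \<bar>\<Delta> k\<bar>"] by (auto simp: S_def)
    also have "\<dots> \<le> \<bar>B\<bar>" using B[OF inS] SS by simp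
    finally have "K * (real (card S) * w) \<le> \<bar>B\<bar>" by (simp add: mult_ac)
    then have "real (card S) * w \<le> \<bar>B\<bar> / K" using K by (simp add: field_simps)
    also have "\<dots> = \<delta> * (\<bar>B\<bar> / (\<bar>B\<bar> + 1))" using \<delta> by (simp add: K_def)
    also have "\<dots> < \<delta> * 1" using \<delta> by (intro mult_strict_left_mono) (auto simp: field_simps)
    finally have "(\<Sum>k<n. v k - t k) < \<delta>" using len by simp
    then have big: "(\<Sum>k\<in>S. \<bar>\<Delta> k\<bar>) < \<epsilon>" using \<delta>(2)[OF inS] SS by simp
    have "\<bar>h b - h a\<bar> = \<bar>\<Sum>k<n. \<Delta> k\<bar>"
      unfolding \<Delta>_def by (subst sum_lessThan_telescope[of "\<lambda>k. h (t k)"]) (simp add: t0)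
    also have "\<dots> \<le> (\<Sum>k<n. \<bar>\<Delta> k\<bar>)" by (rule sum_abs)
    also have "\<dots> \<le> (\<Sum>k<n. (if k \<in> S then \<bar>\<Delta> k\<bar> else 0) + w * min K \<bar>\<Delta> k / w\<bar>)"
      using w K by (intro sum_mono) (auto simp: S_def min_def field_simps abs_divide)
    also have "\<dots> = (\<Sum>k\<in>{..<n} \<inter> S. \<bar>\<Delta> k\<bar>) + (\<Sum>k<n. w * min K \<bar>\<Delta> k / w\<bar>)"
      by (simp add: sum.distrib sum.inter_restrict)
    also have "{..<n} \<inter> S = S" by (auto simp: S_def)
    finally have "\<bar>h b - h a\<bar> \<le> \<epsilon> + (\<Sum>k<n. w * min K \<bar>\<Delta> k / w\<bar>)" using big by simp
    then show "\<bar>h b - h a\<bar> \<le> \<epsilon> + (\<Sum>k<n. (b - a) / real n *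
       min K \<bar>(h (a + real (Suc k) * ((b - a) / real n)) - h (a + real k * ((b - a) / real n))) / ((b - a) / real n)\<bar>)"
      by (simp add: \<Delta>_def t_def w_def)
  qed
qed

lemma abs_continuous_imp_continuous:
  assumes h: "abs_continuous_on a b h"
  shows "continuous_on {a..b} h"
proof (rule continuous_onI)
  fix x e :: real assume x: "x \<in> {a..b}" and "e > 0"
  obtain \<delta> where \<delta>: "\<delta> > 0" "\<And>n u v. intervals_in a b n u v \<Longrightarrow> (\<Sum>i<n. v i - u i) < \<delta> \<Longrightarrow> increment_sum h n u v < e"
    using abs_continuous_onD[OF h \<open>e > 0\<close>] by blast
  have "dist (h y) (h x) \<le> e" if y: "y \<in> {a..b}" "dist y x < \<delta>" for y
  proof -
    have "intervals_in a b 1 (\<lambda>_. min x y) (\<lambda>_. max x y)"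
      using x y by (auto simp: intervals_in_def disjoint_family_on_def)
    moreover have "(\<Sum>i<1::nat. max x y - min x y) < \<delta>" using y(2) by (auto simp: dist_real_def)
    ultimately have "increment_sum h 1 (\<lambda>_. min x y) (\<lambda>_. max x y) < e" by (rule \<delta>(2))
    then show ?thesis
      by (cases "x \<le> y") (auto simp: increment_sum_def dist_real_def max_def min_def)
  qed
  then show "\<exists>d>0. \<forall>x'\<in>{a..b}. dist x' x < d \<longrightarrow> dist (h x') (h x) \<le> e" using \<delta>(1) by blast
qed

text \<open>
  Provides a measurable version of the derivative, so that integrals over disjoint cells can be added.
\<close>

lemma abs_continuous_deriv_measurable:
  assumes h: "abs_continuous_on a b h" and ab: "a \<le> b"
  obtains G where "G \<in> borel_measurable lebesgue"
    "AE x in lebesgue. x \<in> {a<..<b} \<longrightarrow> deriv h x = G x"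
proof -
  define c where "c x = max a (min b x)" for x
  have "continuous_on UNIV (\<lambda>x. h (c x))"
    by (rule continuous_on_compose2[OF abs_continuous_imp_continuous[OF h]])
      (use ab in \<open>auto simp: c_def intro!: continuous_intros\<close>)
  then have [measurable]: "(\<lambda>x. h (c x)) \<in> borel_measurable borel"
    by (rule borel_measurable_continuous_onI)
  define q where "q n x = (h (c (x + 1 / real (Suc n))) - h (c x)) / (1 / real (Suc n))" for n x
  have qm: "q n \<in> borel_measurable borel" for n
    unfolding q_def by measurable
  have [measurable]: "q n \<in> borel_measurable lebesgue" for n
    using qm by (intro measurable_completion) simp
  show ?thesis
  proof (rule that)
    show "(\<lambda>x. lim (\<lambda>n. q n x)) \<in> borel_measurable lebesgue" by measurable
    show "AE x in lebesgue. x \<in> {a<..<b} \<longrightarrow> deriv h x = lim (\<lambda>n. q n x)"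
      using abs_continuous_AE_differentiable[OF h ab]
    proof eventually_elim
      case (elim x)
      show ?case
      proof
        assume x: "x \<in> {a<..<b}"
        then have "(h has_real_derivative deriv h x) (at x)"
          using elim by (simp add: DERIV_deriv_iff_real_differentiable)
        then have "((\<lambda>x. h (c x)) has_real_derivative deriv h x) (at x)"
          by (rule has_field_derivative_transform_within_open[of _ _ _ "{a<..<b}"])
            (use x in \<open>auto simp: c_def\<close>)
        from straddle_slopes_tendsto[OF this, of "\<lambda>_. x" "\<lambda>n. x + 1 / real (Suc n)"]
        have "(\<lambda>n. q n x) \<longlonglongrightarrow> deriv h x"
          using tendsto_add[OF tendsto_const[of x] LIMSEQ_Suc[OF lim_1_over_n]] by (simp add: q_def)
        then show "deriv h x = lim (\<lambda>n. q n x)" by (simp add: limI)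
      qed
    qed
  qed
qed

text \<open>
  The slopes over the cells of the grid of \<open>n\<close> cells converge to \<open>deriv h\<close> almost everywhere as
  \<open>n\<close> grows. Truncated at \<open>K\<close> they are dominated, hence
  \<open>abs_continuous_truncated_slopes\<close> passes to the limit and gives \<open>|h b - h a| \<le> \<integral> |h'|\<close>. The
  Cauchy-Schwarz inequality does the rest.
\<close>

theorem abs_continuous_increment_le:
  assumes h: "abs_continuous_on a b h" and ab: "a < b"
  shows "ennreal ((h b - h a)\<^sup>2) \<le>
    ennreal (b - a) * (\<integral>\<^sup>+t\<in>{a<..<b}. ennreal ((deriv h t)\<^sup>2) \<partial>lebesgue)"
proof -
  define w where "w n = (b - a) / real (Suc n)" for n
  have w: "w n > 0" for n using ab by (simp add: w_def)
  define u where "u n x = a + of_int \<lfloor>(x - a) / w n\<rfloor> * w n" for n x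
  define v where "v n x = a + (of_int \<lfloor>(x - a) / w n\<rfloor> + 1) * w n" for n x
  define g where "g n x = (h (v n x) - h (u n x)) / w n" for n x
  define G where "G x = lim (\<lambda>n. g n x)" for x
  have gm: "g n \<in> borel_measurable borel" for n
  proof -
    have "(\<lambda>x. (\<lambda>i. (h (a + (of_int i + 1) * w n) - h (a + of_int i * w n)) / w n) \<lfloor>(x - a) / w n\<rfloor>)
        \<in> borel_measurable borel"
      by (rule measurable_compose[where N = "count_space UNIV"]) measurable
    then show ?thesis by (simp add: g_def[abs_def] u_def v_def)
  qed
  have gm' [measurable]: "g n \<in> borel_measurable lebesgue" for n
    using gm by (intro measurable_completion) simp
  have Gm [measurable]: "G \<in> borel_measurable lebesgue"
    unfolding G_def by measurable
  have Im [measurable]: "(indicator {a<..<b} :: real \<Rightarrow> ennreal) \<in> borel_measurable lebesgue"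
    by (intro borel_measurable_indicator) auto
  have uv: "u n x \<le> x" "x < v n x" "v n x - u n x = w n" "\<bar>u n x - x\<bar> \<le> w n" "\<bar>v n x - x\<bar> \<le> w n" for n x
  proof -
    have "of_int \<lfloor>(x - a) / w n\<rfloor> \<le> (x - a) / w n" "(x - a) / w n < of_int \<lfloor>(x - a) / w n\<rfloor> + 1"
      by linarith+
    then have 1: "of_int \<lfloor>(x - a) / w n\<rfloor> * w n \<le> x - a" "x - a < (of_int \<lfloor>(x - a) / w n\<rfloor> + 1) * w n"
      using pos_le_divide_eq[OF w] pos_divide_less_eq[OF w] by blast+
    then show "u n x \<le> x" "x < v n x" by (simp_all add: u_def v_def)
    show "v n x - u n x = w n" by (simp add: u_def v_def algebra_simps)
    then show "\<bar>u n x - x\<bar> \<le> w n" "\<bar>v n x - x\<bar> \<le> w n"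
      using \<open>u n x \<le> x\<close> \<open>x < v n x\<close> by auto
  qed
  have w0: "w \<longlonglongrightarrow> 0"
    unfolding w_def by (rule LIMSEQ_Suc[of "\<lambda>n. (b - a) / real n"]) (rule lim_const_over_n)
  have uvlim: "(\<lambda>n. u n x) \<longlonglongrightarrow> x" "(\<lambda>n. v n x) \<longlonglongrightarrow> x" for x
    by (rule Lim_transform_bound[OF _ w0, THEN LIM_zero_cancel];
        use uv w in \<open>auto intro!: always_eventually simp: less_imp_le\<close>)+
  have lim: "(\<lambda>n. g n x) \<longlonglongrightarrow> deriv h x" if "h differentiable at x" for x
  proof -
    have "(h has_real_derivative deriv h x) (at x)"
      using that by (simp add: DERIV_deriv_iff_real_differentiable)
    from straddle_slopes_tendsto[OF this uv(1,2) uvlim] show ?thesis by (simp add: g_def uv)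
  qed
  have AEd: "AE x in lebesgue. x \<in> {a<..<b} \<longrightarrow> G x = deriv h x \<and> (\<lambda>n. g n x) \<longlonglongrightarrow> G x"
    using abs_continuous_AE_differentiable[OF h less_imp_le[OF ab]]
  proof eventually_elim
    case (elim x)
    then show ?case using lim[of x] limI[OF lim[of x]] by (auto simp: G_def)
  qed
  have key: "ennreal \<bar>h b - h a\<bar> \<le> (\<integral>\<^sup>+x. ennreal \<bar>G x\<bar> * indicator {a<..<b} x \<partial>lebesgue)"
  proof (rule ennreal_le_epsilon)
    fix \<epsilon> :: real assume \<epsilon>: "\<epsilon> > 0"
    obtain K where K: "K > 0" "\<And>n. n > 0 \<Longrightarrow>
      \<bar>h b - h a\<bar> \<le> \<epsilon> + (\<Sum>k<n. (b - a) / real n *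
       min K \<bar>(h (a + real (Suc k) * ((b - a) / real n)) - h (a + real k * ((b - a) / real n))) / ((b - a) / real n)\<bar>)"
      using abs_continuous_truncated_slopes[OF h ab \<epsilon>] by blast
    define \<phi> where "\<phi> n x = ennreal (min K \<bar>g n x\<bar>) * indicator {a<..<b} x" for n x
    define \<phi>' where "\<phi>' x = ennreal (min K \<bar>G x\<bar>) * indicator {a<..<b} x" for x
    have \<phi>m [measurable]: "\<phi> n \<in> borel_measurable lebesgue" "\<phi>' \<in> borel_measurable lebesgue" for n
      unfolding \<phi>_def \<phi>'_def by (intro borel_measurable_times_ennreal Im; measurable)+
    have conv: "(\<lambda>n. \<integral>\<^sup>+x. \<phi> n x \<partial>lebesgue) \<longlonglongrightarrow> (\<integral>\<^sup>+x. \<phi>' x \<partial>lebesgue)"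
    proof (rule nn_integral_dominated_convergence[where w = "\<lambda>x. ennreal K * indicator {a<..<b} x"])
      show "AE x in lebesgue. \<phi> n x \<le> ennreal K * indicator {a<..<b} x" for n
        by (auto simp: \<phi>_def indicator_def intro!: ennreal_leI)
      show "(\<integral>\<^sup>+x. ennreal K * indicator {a<..<b} x \<partial>lebesgue) < \<infinity>"
        using ab by (subst nn_integral_cmult_indicator) (auto simp: ennreal_mult_less_top)
      show "AE x in lebesgue. (\<lambda>n. \<phi> n x) \<longlonglongrightarrow> \<phi>' x"
        using AEd
      proof eventually_elim
        case (elim x)
        show ?case
        proof (cases "x \<in> {a<..<b}")
          case True
          then have "(\<lambda>n. g n x) \<longlonglongrightarrow> G x" using elim by blast
          then have "(\<lambda>n. min K \<bar>g n x\<bar>) \<longlonglongrightarrow> min K \<bar>G x\<bar>" by (intro tendsto_intros)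
          then show ?thesis using True by (simp add: \<phi>_def \<phi>'_def)
        qed (simp add: \<phi>_def \<phi>'_def)
      qed
    qed auto
    have bound: "ennreal \<bar>h b - h a\<bar> \<le> ennreal \<epsilon> + (\<integral>\<^sup>+x. \<phi> n x \<partial>lebesgue)" for n
    proof -
      define t where "t k = a + real k * w n" for k
      have tS: "t (Suc k) = t k + w n" for k by (simp add: t_def algebra_simps)
      have tm: "t k \<le> t l" if "k \<le> l" for k l using that w[of n] by (simp add: t_def)
      have t0: "t 0 = a" "t (Suc n) = b" by (simp_all add: t_def w_def)
      define m where "m k = min K \<bar>(h (t (Suc k)) - h (t k)) / w n\<bar>" for k
      have "(\<Sum>k<Suc n. ennreal (m k) * indicator {t k<..<t (Suc k)} x) \<le> \<phi> n x" for x
      proof (cases "\<exists>k<Suc n. x \<in> {t k<..<t (Suc k)}")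
        case True
        then obtain k where k: "k < Suc n" "x \<in> {t k<..<t (Suc k)}" by blast
        have fl: "\<lfloor>(x - a) / w n\<rfloor> = int k"
          using k w[of n] by (intro floor_unique) (auto simp: t_def field_simps)
        have uniq: "j = k" if "x \<in> {t j<..<t (Suc j)}" for j
        proof -
          have "\<lfloor>(x - a) / w n\<rfloor> = int j"
            using that w[of n] by (intro floor_unique) (auto simp: t_def field_simps)
          then show ?thesis using fl by simp
        qed
        have xab: "x \<in> {a<..<b}" using k t0 tm[of 0 k] tm[of "Suc k" "Suc n"] by auto
        have "(\<Sum>j<Suc n. ennreal (m j) * indicator {t j<..<t (Suc j)} x)
            = (\<Sum>j\<in>{k}. ennreal (m j) * indicator {t j<..<t (Suc j)} x)"
        proof (rule sum.mono_neutral_right)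
          show "\<forall>j\<in>{..<Suc n} - {k}. ennreal (m j) * indicator {t j<..<t (Suc j)} x = 0"
          proof
            fix j assume "j \<in> {..<Suc n} - {k}"
            then have "x \<notin> {t j<..<t (Suc j)}" using uniq[of j] by blast
            then show "ennreal (m j) * indicator {t j<..<t (Suc j)} x = 0" by simp
          qed
        qed (use k in auto)
        also have "\<dots> = ennreal (m k)" using k by simp
        also have "m k = min K \<bar>g n x\<bar>"
          by (simp add: m_def g_def u_def v_def fl t_def add.commute)
        finally show ?thesis using xab by (simp add: \<phi>_def)
      next
        case False
        then have "(\<Sum>j<Suc n. ennreal (m j) * indicator {t j<..<t (Suc j)} x) = 0"
          by (intro sum.neutral) (auto simp: indicator_def)
        then show ?thesis by (metis zero_le)
      qed
      then have "(\<integral>\<^sup>+x. (\<Sum>k<Suc n. ennreal (m k) * indicator {t k<..<t (Suc k)} x) \<partial>lebesgue) \<le> (\<integral>\<^sup>+x. \<phi> n x \<partial>lebesgue)"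
        by (intro nn_integral_mono)
      moreover have "(\<integral>\<^sup>+x. (\<Sum>k<Suc n. ennreal (m k) * indicator {t k<..<t (Suc k)} x) \<partial>lebesgue)
          = (\<Sum>k<Suc n. ennreal (m k) * ennreal (w n))"
        using w[of n] tS
        by (subst nn_integral_sum) (auto simp: nn_integral_cmult_indicator simp del: sum.lessThan_Suc
            intro!: sum.cong borel_measurable_times_ennreal borel_measurable_indicator)
      moreover have "(\<Sum>k<Suc n. ennreal (m k) * ennreal (w n)) = ennreal (\<Sum>k<Suc n. w n * m k)"
        using K w[of n] by (subst sum_ennreal[symmetric]) (auto simp: m_def ennreal_mult mult.commute simp del: sum.lessThan_Suc)
      ultimately have 1: "ennreal (\<Sum>k<Suc n. w n * m k) \<le> (\<integral>\<^sup>+x. \<phi> n x \<partial>lebesgue)" by simp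
      have "\<bar>h b - h a\<bar> \<le> \<epsilon> + (\<Sum>k<Suc n. w n * m k)"
        using K(2)[of "Suc n"] by (simp add: w_def m_def t_def del: sum.lessThan_Suc of_nat_Suc)
      then have "ennreal \<bar>h b - h a\<bar> \<le> ennreal (\<epsilon> + (\<Sum>k<Suc n. w n * m k))" by (rule ennreal_leI)
      also have "\<dots> = ennreal \<epsilon> + ennreal (\<Sum>k<Suc n. w n * m k)"
        using \<epsilon> K w[of n] by (intro ennreal_plus sum_nonneg) (auto simp: m_def)
      also have "\<dots> \<le> ennreal \<epsilon> + (\<integral>\<^sup>+x. \<phi> n x \<partial>lebesgue)" using 1 by (rule add_left_mono)
      finally show ?thesis .
    qed
    have "ennreal \<bar>h b - h a\<bar> \<le> ennreal \<epsilon> + (\<integral>\<^sup>+x. \<phi>' x \<partial>lebesgue)"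
      by (rule LIMSEQ_le_const[OF tendsto_add[OF tendsto_const conv]]) (use bound in auto)
    also have "\<dots> \<le> ennreal \<epsilon> + (\<integral>\<^sup>+x. ennreal \<bar>G x\<bar> * indicator {a<..<b} x \<partial>lebesgue)"
      unfolding \<phi>'_def by (intro add_left_mono nn_integral_mono mult_right_mono ennreal_leI) auto
    finally show "ennreal \<bar>h b - h a\<bar> \<le> (\<integral>\<^sup>+x. ennreal \<bar>G x\<bar> * indicator {a<..<b} x \<partial>lebesgue) + ennreal \<epsilon>"
      by (simp add: add.commute)
  qed
  have "ennreal ((h b - h a)\<^sup>2) = (ennreal \<bar>h b - h a\<bar>)\<^sup>2" by (simp add: ennreal_power)
  also have "\<dots> \<le> (\<integral>\<^sup>+x. ennreal \<bar>G x\<bar> * indicator {a<..<b} x \<partial>lebesgue)\<^sup>2"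
    using key by (rule power_mono) simp
  also have "(\<integral>\<^sup>+x. ennreal \<bar>G x\<bar> * indicator {a<..<b} x \<partial>lebesgue) =
      (\<integral>\<^sup>+x. (ennreal \<bar>G x\<bar> * indicator {a<..<b} x) * indicator {a<..<b} x \<partial>lebesgue)"
    by (intro nn_integral_cong) (auto simp: indicator_def)
  also have "\<dots>\<^sup>2 \<le> (\<integral>\<^sup>+x. (ennreal \<bar>G x\<bar> * indicator {a<..<b} x)\<^sup>2 \<partial>lebesgue) *
      (\<integral>\<^sup>+x. (indicator {a<..<b} x)\<^sup>2 \<partial>lebesgue)"
    by (rule Cauchy_Schwarz_nn_integral) auto
  also have "(\<integral>\<^sup>+x. (indicator {a<..<b} x)\<^sup>2 \<partial>lebesgue) = (\<integral>\<^sup>+x. indicator {a<..<b} x \<partial>lebesgue)"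
    by (intro nn_integral_cong) (auto simp: indicator_def)
  also have "\<dots> = ennreal (b - a)" using ab by simp
  also have "(\<integral>\<^sup>+x. (ennreal \<bar>G x\<bar> * indicator {a<..<b} x)\<^sup>2 \<partial>lebesgue) \<le>
      (\<integral>\<^sup>+t\<in>{a<..<b}. ennreal ((deriv h t)\<^sup>2) \<partial>lebesgue)"
  proof (rule nn_integral_mono_AE)
    show "AE x in lebesgue. (ennreal \<bar>G x\<bar> * indicator {a<..<b} x)\<^sup>2 \<le> ennreal ((deriv h x)\<^sup>2) * indicator {a<..<b} x"
      using AEd by eventually_elim (auto simp: indicator_def ennreal_power)
  qed
  finally show ?thesis by (simp add: mult.commute mult_right_mono)
qed

section \<open>Polygons through the nodes of a grid\<close>

lemma cells_disjoint:
  assumes "w \<ge> 0"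
  shows "disjoint_family (\<lambda>k::nat. {a + real k * w<..<a + real (Suc k) * w})"
proof -
  have "{a + real k * w<..<a + real (Suc k) * w} \<inter> {a + real l * w<..<a + real (Suc l) * w} = {}"
    if "k < l" for k l
  proof -
    have "real (Suc k) * w \<le> real l * w" using that assms by (intro mult_right_mono) auto
    then show ?thesis by auto
  qed
  then show ?thesis unfolding disjoint_family_on_def by (metis inf_commute nat_neq_iff)
qed

text \<open>
  Writing the polygon as a sum of clamped ramps makes it a Lipschitz function on the whole line.
\<close>

definition interpolant :: "nat \<Rightarrow> real \<Rightarrow> (nat \<Rightarrow> real) \<Rightarrow> real \<Rightarrow> real" where
  "interpolant N w x t = x 0 + (\<Sum>j<N. (x (Suc j) - x j) * max 0 (min 1 (t / w - real j)))"

lemma interpolant_eq: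
  assumes "w > 0" "k < N" "0 \<le> \<theta>" "\<theta> \<le> 1"
  shows "interpolant N w x ((real k + \<theta>) * w) = (1 - \<theta>) * x k + \<theta> * x (Suc k)"
proof -
  have "(\<Sum>j<N. (x (Suc j) - x j) * max 0 (min 1 ((real k + \<theta>) * w / w - real j)))
      = (\<Sum>j<N. (x (Suc j) - x j) * (if j < k then 1 else if j = k then \<theta> else 0))"
    using assms by (intro sum.cong refl arg_cong2[where f = "(*)"]) (auto simp: max_def min_def)
  also have "\<dots> = (\<Sum>j\<in>{..<Suc k}. (x (Suc j) - x j) * (if j < k then 1 else if j = k then \<theta> else 0))"
    using assms(2) by (intro sum.mono_neutral_right) auto
  also have "\<dots> = (\<Sum>j<k. x (Suc j) - x j) + (x (Suc k) - x k) * \<theta>" by simp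
  also have "(\<Sum>j<k. x (Suc j) - x j) = x k - x 0" by (rule sum_lessThan_telescope)
  finally show ?thesis by (simp add: interpolant_def algebra_simps)
qed

lemma interpolant_node:
  assumes "w > 0" "k \<le> N" "N > 0"
  shows "interpolant N w x (real k * w) = x k"
proof (cases "k < N")
  case True
  then show ?thesis using interpolant_eq[of w k N 0 x] assms by simp
next
  case False
  then show ?thesis using interpolant_eq[of w "N - 1" N 1 x] assms by (simp add: of_nat_diff)
qed

lemma grid_cases:
  assumes "w > 0" "N > 0" "0 \<le> t" "t \<le> real N * w"
  obtains k \<theta> where "k < N" "0 \<le> \<theta>" "\<theta> \<le> 1" "t = (real k + \<theta>) * w"
proof (cases "t = real N * w")
  case True
  then show ?thesis using that[of "N - 1" 1] assms by (simp add: of_nat_diff)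
next
  case False
  then have t: "0 \<le> t / w" "t / w < real N" using assms by (auto simp: field_simps)
  define k where "k = nat \<lfloor>t / w\<rfloor>"
  have k: "real k \<le> t / w" "t / w < real k + 1" using t unfolding k_def by linarith+
  have "t = (real k + (t / w - real k)) * w" using assms by simp
  then show ?thesis using k t by (intro that[of k "t / w - real k"]) auto
qed

lemma interpolant_Lipschitz:
  assumes "w > 0"
  obtains L where "L \<ge> 0" "\<And>s t. \<bar>interpolant N w x s - interpolant N w x t\<bar> \<le> L * \<bar>s - t\<bar>"
proof
  let ?L = "\<Sum>j<N. \<bar>x (Suc j) - x j\<bar> / w"
  show "?L \<ge> 0" using assms by (intro sum_nonneg) auto
  fix s t :: real
  have clamp: "\<bar>max 0 (min 1 (a::real)) - max 0 (min 1 b)\<bar> \<le> \<bar>a - b\<bar>" for a b by auto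
  have "\<bar>interpolant N w x s - interpolant N w x t\<bar> =
      \<bar>\<Sum>j<N. (x (Suc j) - x j) * (max 0 (min 1 (s / w - real j)) - max 0 (min 1 (t / w - real j)))\<bar>"
    by (simp add: interpolant_def sum_subtractf right_diff_distrib)
  also have "\<dots> \<le> (\<Sum>j<N. \<bar>x (Suc j) - x j\<bar> * \<bar>max 0 (min 1 (s / w - real j)) - max 0 (min 1 (t / w - real j))\<bar>)"
    unfolding abs_mult[symmetric] by (rule sum_abs)
  also have "\<dots> \<le> (\<Sum>j<N. \<bar>x (Suc j) - x j\<bar> * (\<bar>s - t\<bar> / w))"
  proof (intro sum_mono mult_left_mono)
    fix j
    have "\<bar>(s / w - real j) - (t / w - real j)\<bar> = \<bar>s - t\<bar> / w"
      using assms by (simp add: diff_divide_distrib[symmetric] abs_divide)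
    then show "\<bar>max 0 (min 1 (s / w - real j)) - max 0 (min 1 (t / w - real j))\<bar> \<le> \<bar>s - t\<bar> / w"
      using clamp by metis
  qed auto
  also have "\<dots> = ?L * \<bar>s - t\<bar>" by (simp add: sum_distrib_right)
  finally show "\<bar>interpolant N w x s - interpolant N w x t\<bar> \<le> ?L * \<bar>s - t\<bar>" .
qed

lemma Lipschitz_imp_abs_continuous:
  assumes L: "L \<ge> 0" "\<And>s t. \<bar>h s - h t\<bar> \<le> L * \<bar>s - t\<bar>"
  shows "abs_continuous_on a b h"
  unfolding abs_continuous_on_def
proof (intro allI impI)
  fix \<epsilon> :: real assume \<epsilon>: "\<epsilon> > 0"
  show "\<exists>\<delta>>0. \<forall>(n::nat) (u :: nat \<Rightarrow> real) (v :: nat \<Rightarrow> real). (\<forall>i<n. a \<le> u i \<and> u i \<le> v i \<and> v i \<le> b) \<and>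
      disjoint_family_on (\<lambda>i. {u i<..<v i}) {..<n} \<and> (\<Sum>i<n. v i - u i) < \<delta> \<longrightarrow>
      (\<Sum>i<n. \<bar>h (v i) - h (u i)\<bar>) < \<epsilon>"
  proof (intro exI[of _ "\<epsilon> / (L + 1)"] conjI allI impI)
    fix n :: nat and u v :: "nat \<Rightarrow> real"
    assume *: "(\<forall>i<n. a \<le> u i \<and> u i \<le> v i \<and> v i \<le> b) \<and>
      disjoint_family_on (\<lambda>i. {u i<..<v i}) {..<n} \<and> (\<Sum>i<n. v i - u i) < \<epsilon> / (L + 1)"
    have "(\<Sum>i<n. \<bar>h (v i) - h (u i)\<bar>) \<le> (\<Sum>i<n. L * (v i - u i))"
    proof (rule sum_mono)
      fix i assume "i \<in> {..<n}"
      then show "\<bar>h (v i) - h (u i)\<bar> \<le> L * (v i - u i)" using L(2)[of "v i" "u i"] * by auto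
    qed
    also have "\<dots> = L * (\<Sum>i<n. v i - u i)" by (simp add: sum_distrib_left)
    also have "\<dots> \<le> L * (\<epsilon> / (L + 1))" using * L by (intro mult_left_mono) auto
    also have "\<dots> < \<epsilon>" using L \<epsilon> by (simp add: field_simps)
    finally show "(\<Sum>i<n. \<bar>h (v i) - h (u i)\<bar>) < \<epsilon>" .
  qed (use L \<epsilon> in auto)
qed

lemma energy_norm_interpolant:
  assumes T: "T > 0" and N: "N > 0"
  shows "energy_norm T (interpolant N (T / real N) x) \<le>
    ennreal (sqrt (real N / T * (\<Sum>k<N. (x (Suc k) - x k)\<^sup>2)))"
proof -
  define w where "w = T / real N"
  have w: "w > 0" "real N * w = T" using T N by (auto simp: w_def)
  define h where "h = interpolant N w x"
  define s where "s k = (x (Suc k) - x k) / w" for k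
  define c where "c k = {0 + real k * w<..<0 + real (Suc k) * w}" for k
  have deriv: "deriv h t = s k" if k: "k < N" "t \<in> c k" for k t
  proof -
    have "((\<lambda>t. x k + s k * (t - real k * w)) has_real_derivative s k) (at t)"
      by (auto intro!: derivative_eq_intros)
    then have "(h has_real_derivative s k) (at t)"
    proof (rule has_field_derivative_transform_within_open[of _ _ _ "c k"])
      fix z assume z: "z \<in> c k"
      have z1: "0 \<le> z / w - real k" "z / w - real k \<le> 1"
        using z w by (auto simp: c_def field_simps)
      have "h z = h ((real k + (z / w - real k)) * w)" using w by simp
      also have "\<dots> = (1 - (z / w - real k)) * x k + (z / w - real k) * x (Suc k)"
        unfolding h_def by (rule interpolant_eq[OF w(1) k(1) z1])
      also have "\<dots> = x k + s k * (z - real k * w)" using w by (simp add: s_def field_simps)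
      finally show "x k + s k * (z - real k * w) = h z" by simp
    qed (use k in \<open>auto simp: c_def\<close>)
    then show ?thesis by (rule DERIV_imp_deriv)
  qed
  have disj: "disjoint_family_on c {..<N}"
    unfolding c_def by (rule disjoint_family_on_mono[OF _ cells_disjoint]) (use w in auto)
  have AEg: "AE t in lebesgue. t \<notin> (\<lambda>k. real k * w) ` {..N}"
  proof (rule AE_not_in)
    show "(\<lambda>k. real k * w) ` {..N} \<in> null_sets lebesgue"
      unfolding negligible_iff_null_sets[symmetric] by (intro negligible_finite) auto
  qed
  have "(\<integral>\<^sup>+t\<in>{0..T}. ennreal ((deriv h t)\<^sup>2) \<partial>lebesgue) \<le>
      (\<integral>\<^sup>+t. (\<Sum>k<N. ennreal ((s k)\<^sup>2) * indicator (c k) t) \<partial>lebesgue)"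
  proof (rule nn_integral_mono_AE)
    show "AE t in lebesgue. ennreal ((deriv h t)\<^sup>2) * indicator {0..T} t \<le>
        (\<Sum>k<N. ennreal ((s k)\<^sup>2) * indicator (c k) t)"
      using AEg
    proof eventually_elim
      case (elim t)
      show ?case
      proof (cases "t \<in> {0..T}")
        case True
        then obtain k \<theta> where k: "k < N" "0 \<le> \<theta>" "\<theta> \<le> 1" "t = (real k + \<theta>) * w"
          using grid_cases[of w N t] w N by auto
        have "\<theta> \<noteq> 0" "\<theta> \<noteq> 1"
        proof -
          show "\<theta> \<noteq> 0" using k elim by auto
          show "\<theta> \<noteq> 1"
          proof
            assume "\<theta> = 1"
            then have "t = real (Suc k) * w" using k(4) by simp
            then show False using elim k(1) by (auto simp del: of_nat_Suc)
          qed
        qed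
        then have tc: "t \<in> c k" using k w by (auto simp: c_def algebra_simps)
        have "ennreal ((deriv h t)\<^sup>2) * indicator {0..T} t = ennreal ((s k)\<^sup>2) * indicator (c k) t"
          using deriv[OF k(1) tc] True tc by simp
        also have "\<dots> \<le> (\<Sum>k<N. ennreal ((s k)\<^sup>2) * indicator (c k) t)"
          using k(1) by (intro member_le_sum) auto
        finally show ?thesis .
      qed simp
    qed
  qed
  also have "\<dots> = (\<Sum>k<N. ennreal ((s k)\<^sup>2) * ennreal w)"
  proof -
    have "emeasure lebesgue (c k) = ennreal w" for k
      using w(1) by (simp add: c_def algebra_simps)
    then show ?thesis
      by (subst nn_integral_sum)
        (auto simp: nn_integral_cmult_indicator c_def
          intro!: sum.cong borel_measurable_times_ennreal borel_measurable_indicator)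
  qed
  also have "\<dots> = (\<Sum>k<N. ennreal ((s k)\<^sup>2 * w))"
    using w by (intro sum.cong) (auto simp: ennreal_mult)
  also have "\<dots> = ennreal (\<Sum>k<N. (s k)\<^sup>2 * w)"
    using w by (intro sum_ennreal) auto
  also have "(\<Sum>k<N. (s k)\<^sup>2 * w) = real N / T * (\<Sum>k<N. (x (Suc k) - x k)\<^sup>2)"
    unfolding sum_distrib_left using T N
    by (intro sum.cong) (auto simp: s_def w_def power2_eq_square field_simps)
  finally have E: "(\<integral>\<^sup>+t\<in>{0..T}. ennreal ((deriv h t)\<^sup>2) \<partial>lebesgue) \<le>
      ennreal (real N / T * (\<Sum>k<N. (x (Suc k) - x k)\<^sup>2))" .
  have nn: "0 \<le> real N / T * (\<Sum>k<N. (x (Suc k) - x k)\<^sup>2)" using T by (intro mult_nonneg_nonneg sum_nonneg) auto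
  have "enn2real (\<integral>\<^sup>+t\<in>{0..T}. ennreal ((deriv h t)\<^sup>2) \<partial>lebesgue) \<le> real N / T * (\<Sum>k<N. (x (Suc k) - x k)\<^sup>2)"
    using enn2real_mono[OF E] nn by (simp add: enn2real_ennreal)
  moreover have "(\<integral>\<^sup>+t\<in>{0..T}. ennreal ((deriv h t)\<^sup>2) \<partial>lebesgue) \<noteq> \<infinity>" using E by (auto simp: top_unique)
  ultimately show ?thesis
    unfolding energy_norm_def Let_def h_def[symmetric] w_def[symmetric]
    by (auto intro!: ennreal_leI)
qed

section \<open>Taut strings on a grid\<close>

text \<open>
  Elements are the deviations of the string from the path at the nodes.
\<close>

definition tube :: "nat \<Rightarrow> real \<Rightarrow> real \<Rightarrow> (nat \<Rightarrow> real) set" where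
  "tube N r \<rho> = {y. y 0 = 0 \<and> (\<forall>k\<le>N. \<bar>y k\<bar> \<le> r) \<and> \<bar>y N\<bar> \<le> \<rho>}"

definition string_energy :: "nat \<Rightarrow> (nat \<Rightarrow> real) \<Rightarrow> (nat \<Rightarrow> real) \<Rightarrow> real" where
  "string_energy N d y = (\<Sum>k<N. (d k + y (Suc k) - y k)\<^sup>2)"

definition taut :: "nat \<Rightarrow> real \<Rightarrow> real \<Rightarrow> (nat \<Rightarrow> real) \<Rightarrow> real" where
  "taut N r \<rho> d = (INF y\<in>tube N r \<rho>. string_energy N d y)"

lemma string_energy_nonneg [simp]: "0 \<le> string_energy N d y"
  unfolding string_energy_def by (intro sum_nonneg) auto

lemma bdd_below_string_energy [simp]: "bdd_below (string_energy N d ` A)"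
  by (rule bdd_belowI[of _ 0]) auto

lemma zero_in_tube: "0 \<le> r \<Longrightarrow> 0 \<le> \<rho> \<Longrightarrow> (\<lambda>_. 0) \<in> tube N r \<rho>"
  by (simp add: tube_def)

lemma taut_le: "y \<in> tube N r \<rho> \<Longrightarrow> taut N r \<rho> d \<le> string_energy N d y"
  unfolding taut_def by (rule cINF_lower) auto

lemma taut_greatest:
  assumes "0 \<le> r" "0 \<le> \<rho>" "\<And>y. y \<in> tube N r \<rho> \<Longrightarrow> c \<le> string_energy N d y"
  shows "c \<le> taut N r \<rho> d"
  unfolding taut_def using assms zero_in_tube[of r \<rho> N] by (intro cINF_greatest) auto

lemma taut_nonneg: "0 \<le> r \<Longrightarrow> 0 \<le> \<rho> \<Longrightarrow> 0 \<le> taut N r \<rho> d"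
  by (rule taut_greatest) auto

lemma taut_less_iff:
  assumes "0 \<le> r" "0 \<le> \<rho>"
  shows "taut N r \<rho> d < c \<longleftrightarrow> (\<exists>y\<in>tube N r \<rho>. string_energy N d y < c)"
  unfolding taut_def using zero_in_tube[OF assms, of N] by (subst cINF_less_iff) auto

lemma taut_approx:
  assumes "0 \<le> r" "0 \<le> \<rho>" "e > 0"
  obtains y where "y \<in> tube N r \<rho>" "string_energy N d y < taut N r \<rho> d + e"
  using taut_less_iff[OF assms(1,2), of N d "taut N r \<rho> d + e"] assms(3) by auto

lemma taut_mono_tube:
  assumes "0 \<le> r" "0 \<le> \<rho>" "r \<le> r'" "\<rho> \<le> \<rho>'"
  shows "taut N r' \<rho>' d \<le> taut N r \<rho> d"
proof (rule taut_greatest[OF assms(1,2)])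
  fix y assume "y \<in> tube N r \<rho>"
  then have "y \<in> tube N r' \<rho>'" using assms by (auto simp: tube_def intro: order_trans)
  then show "taut N r' \<rho>' d \<le> string_energy N d y" by (rule taut_le)
qed

lemma taut_cong: "(\<And>k. k < N \<Longrightarrow> d k = d' k) \<Longrightarrow> taut N r \<rho> d = taut N r \<rho> d'"
proof -
  assume "\<And>k. k < N \<Longrightarrow> d k = d' k"
  then have "string_energy N d = string_energy N d'" by (auto simp: string_energy_def fun_eq_iff intro!: sum.cong)
  then show ?thesis by (simp add: taut_def)
qed

lemma taut_scale_le:
  assumes "0 \<le> r" "0 \<le> \<rho>" "a > 0"
  shows "taut N (a * r) (a * \<rho>) (\<lambda>k. a * d k) \<le> a\<^sup>2 * taut N r \<rho> d"
proof -
  have "taut N (a * r) (a * \<rho>) (\<lambda>k. a * d k) / a\<^sup>2 \<le> taut N r \<rho> d"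
  proof (rule taut_greatest[OF assms(1,2)])
    fix y assume "y \<in> tube N r \<rho>"
    then have "(\<lambda>k. a * y k) \<in> tube N (a * r) (a * \<rho>)"
      using assms by (auto simp: tube_def abs_mult)
    from taut_le[OF this, of "\<lambda>k. a * d k"]
    have "taut N (a * r) (a * \<rho>) (\<lambda>k. a * d k) \<le> (\<Sum>k<N. a\<^sup>2 * (d k + y (Suc k) - y k)\<^sup>2)"
      by (simp add: string_energy_def power_mult_distrib[symmetric] algebra_simps)
    also have "\<dots> = a\<^sup>2 * string_energy N d y" by (simp add: string_energy_def sum_distrib_left)
    finally show "taut N (a * r) (a * \<rho>) (\<lambda>k. a * d k) / a\<^sup>2 \<le> string_energy N d y"
      using assms by (simp add: field_simps)
  qed
  then show ?thesis using assms by (simp add: field_simps)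
qed

lemma taut_scale:
  assumes "0 \<le> r" "0 \<le> \<rho>" "a > 0"
  shows "taut N (a * r) (a * \<rho>) (\<lambda>k. a * d k) = a\<^sup>2 * taut N r \<rho> d"
proof (rule antisym)
  have "taut N r \<rho> d \<le> (1 / a)\<^sup>2 * taut N (a * r) (a * \<rho>) (\<lambda>k. a * d k)"
    using taut_scale_le[of "a * r" "a * \<rho>" "1 / a" N "\<lambda>k. a * d k"] assms by simp
  then show "a\<^sup>2 * taut N r \<rho> d \<le> taut N (a * r) (a * \<rho>) (\<lambda>k. a * d k)"
    using assms by (simp add: field_simps)
qed (rule taut_scale_le[OF assms])

lemma sum_lessThan_add:
  fixes f :: "nat \<Rightarrow> 'a::comm_monoid_add"
  shows "(\<Sum>k<l + n. f k) = (\<Sum>k<l. f k) + (\<Sum>k<n. f (l + k))"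
  by (induction n) (auto simp: add.assoc)

lemma sum_lessThan_mult:
  fixes f :: "nat \<Rightarrow> 'a::comm_monoid_add"
  shows "(\<Sum>k<m * n. f k) = (\<Sum>j<m. \<Sum>k<n. f (j * n + k))"
  by (induction m) (auto simp: sum_lessThan_add add.commute[of n])

text \<open>
  Pinned strings over consecutive blocks can be joined at their ends.
\<close>

lemma taut_blocks:
  assumes "0 \<le> r" "n > 0"
  shows "taut (m * n) r 0 d \<le> (\<Sum>j<m. taut n r 0 (\<lambda>k. d (j * n + k)))"
proof (cases "m = 0")
  case True
  then show ?thesis using taut_le[OF zero_in_tube[OF assms(1), of 0 0]] by (simp add: string_energy_def)
next
  case m: False
  show ?thesis
  proof (rule field_le_epsilon)
    fix e :: real assume e: "e > 0"
    have "\<exists>y. \<forall>j. y j \<in> tube n r 0 \<and> string_energy n (\<lambda>k. d (j * n + k)) (y j) < taut n r 0 (\<lambda>k. d (j * n + k)) + e / real m"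
      using taut_approx[OF assms(1) order_refl, of "e / real m" n] e m by (intro choice) (metis divide_pos_pos of_nat_0_less_iff gr0I)
    then obtain y where y: "\<And>j. y j \<in> tube n r 0"
      "\<And>j. string_energy n (\<lambda>k. d (j * n + k)) (y j) < taut n r 0 (\<lambda>k. d (j * n + k)) + e / real m"
      by blast
    \<comment> \<open>At a common node of two blocks the right one is used; both values are 0.\<close>
    define z where "z k = y (k div n) (k mod n)" for k
    have y0: "y j 0 = 0" "y j n = 0" "k \<le> n \<Longrightarrow> \<bar>y j k\<bar> \<le> r" for j k using y(1)[of j] by (auto simp: tube_def)
    have z: "z (j * n + k) = y j k" if "k \<le> n" for j k
    proof (cases "k = n")
      case True
      have "(j * n + n) div n = Suc j" "(j * n + n) mod n = 0" using assms(2) by simp_all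
      then show ?thesis using y0 True by (simp add: z_def)
    qed (use that assms(2) in \<open>simp add: z_def\<close>)
    have "z \<in> tube (m * n) r 0"
      using y0 assms(2) by (auto simp: tube_def z_def mod_le_divisor less_imp_le)
    then have "taut (m * n) r 0 d \<le> string_energy (m * n) d z" by (rule taut_le)
    also have "\<dots> = (\<Sum>j<m. \<Sum>k<n. (d (j * n + k) + z (Suc (j * n + k)) - z (j * n + k))\<^sup>2)"
      unfolding string_energy_def by (rule sum_lessThan_mult)
    also have "\<dots> = (\<Sum>j<m. string_energy n (\<lambda>k. d (j * n + k)) (y j))"
      unfolding string_energy_def
    proof (intro sum.cong refl)
      fix j k assume "k \<in> {..<n}"
      then show "(d (j * n + k) + z (Suc (j * n + k)) - z (j * n + k))\<^sup>2 = (d (j * n + k) + y j (Suc k) - y j k)\<^sup>2"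
        using z[of k j] z[of "Suc k" j] by simp
    qed
    also have "\<dots> \<le> (\<Sum>j<m. taut n r 0 (\<lambda>k. d (j * n + k)) + e / real m)"
      using y(2) by (intro sum_mono) (auto intro: less_imp_le)
    also have "\<dots> = (\<Sum>j<m. taut n r 0 (\<lambda>k. d (j * n + k))) + e" using m by (simp add: sum.distrib)
    finally show "taut (m * n) r 0 d \<le> (\<Sum>j<m. taut n r 0 (\<lambda>k. d (j * n + k))) + e" .
  qed
qed

lemma sqrt_string_energy: "sqrt (string_energy N d y) = L2_set (\<lambda>k. d k + y (Suc k) - y k) {..<N}"
  by (simp add: string_energy_def L2_set_def)

text \<open>
  On the last \<open>n\<close> cells the free string is turned into a pinned string by a convex combination whose
  weight \<open>\<phi>\<close> grows linearly from \<open>0\<close> to \<open>1\<close>; the result stays in the tube by convexity. Its increments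
  exceed those of the two strings by at most \<open>2 * r / n\<close>, which is the last summand.
\<close>

lemma taut_pinned_le_free:
  assumes "0 \<le> r" "n > 0"
  shows "sqrt (taut (l + n) r 0 d) \<le>
    sqrt (taut (l + n) r r d) + sqrt (taut n r 0 (\<lambda>k. d (l + k))) + 2 * r / sqrt (real n)"
proof -
  have main: "sqrt (taut (l + n) r 0 d) \<le> sqrt (string_energy (l + n) d y) +
      sqrt (string_energy n (\<lambda>k. d (l + k)) x) + 2 * r / sqrt (real n)"
    if y: "y \<in> tube (l + n) r r" and x: "x \<in> tube n r 0" for x y
  proof -
    define \<phi> where "\<phi> k = real (k - l) / real n" for k
    define x' where "x' k = x (k - l)" for k
    define z where "z k = (1 - \<phi> k) * y k + \<phi> k * x' k" for k
    have \<phi>: "0 \<le> \<phi> k" "k \<le> l + n \<Longrightarrow> \<phi> k \<le> 1" for k using assms by (auto simp: \<phi>_def field_simps)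
    have yb: "\<bar>y k\<bar> \<le> r" "\<bar>x' k\<bar> \<le> r" if "k \<le> l + n" for k
      using y x that by (auto simp: tube_def x'_def)
    have "\<bar>z k\<bar> \<le> r" if "k \<le> l + n" for k
    proof -
      have "\<bar>z k\<bar> \<le> (1 - \<phi> k) * \<bar>y k\<bar> + \<phi> k * \<bar>x' k\<bar>"
        unfolding z_def using \<phi>(1)[of k] \<phi>(2)[OF that]
        by (intro order_trans[OF abs_triangle_ineq]) (simp add: abs_mult)
      also have "\<dots> \<le> (1 - \<phi> k) * r + \<phi> k * r"
        using \<phi>(1)[of k] \<phi>(2)[OF that] yb[OF that] by (intro add_mono mult_left_mono) auto
      finally show ?thesis by (simp add: algebra_simps)
    qed
    moreover have "z (l + n) = 0" "z 0 = 0"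
      using assms x y by (auto simp: z_def \<phi>_def x'_def tube_def)
    ultimately have zt: "z \<in> tube (l + n) r 0" by (simp add: tube_def)
    define A where "A k = d k + y (Suc k) - y k" for k
    define B where "B k = (if k < l then 0 else d k + x' (Suc k) - x' k)" for k
    define c where "c k = (if k < l then 0 else 2 * r / real n)" for k
    have le: "\<bar>d k + z (Suc k) - z k\<bar> \<le> \<bar>A k\<bar> + \<bar>B k\<bar> + c k" if k: "k < l + n" for k
    proof (cases "k < l")
      case True
      then have "z k = y k" "z (Suc k) = y (Suc k)" by (auto simp: z_def \<phi>_def)
      then show ?thesis using True by (simp add: A_def B_def c_def)
    next
      case False
      then have "\<phi> (Suc k) = \<phi> k + 1 / real n" using assms
        by (simp add: \<phi>_def Suc_diff_le add_divide_distrib)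
      then have "d k + z (Suc k) - z k = (1 - \<phi> (Suc k)) * A k + \<phi> (Suc k) * B k + (1 / real n) * (x' k - y k)"
        using False by (simp add: z_def A_def B_def algebra_simps)
      also have "\<bar>\<dots>\<bar> \<le> \<bar>(1 - \<phi> (Suc k)) * A k\<bar> + \<bar>\<phi> (Suc k) * B k\<bar> + \<bar>(1 / real n) * (x' k - y k)\<bar>"
        by linarith
      also have "\<dots> \<le> \<bar>A k\<bar> + \<bar>B k\<bar> + (1 / real n) * (2 * r)"
      proof (intro add_mono)
        show "\<bar>(1 - \<phi> (Suc k)) * A k\<bar> \<le> \<bar>A k\<bar>" "\<bar>\<phi> (Suc k) * B k\<bar> \<le> \<bar>B k\<bar>"
          using \<phi>(1)[of "Suc k"] \<phi>(2)[of "Suc k"] k by (auto simp: abs_mult intro: mult_left_le_one_le)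
        show "\<bar>(1 / real n) * (x' k - y k)\<bar> \<le> (1 / real n) * (2 * r)"
          unfolding abs_mult using yb[of k] k by (intro mult_mono) auto
      qed
      finally show ?thesis using False by (simp add: c_def)
    qed
    have "sqrt (taut (l + n) r 0 d) \<le> L2_set (\<lambda>k. d k + z (Suc k) - z k) {..<l + n}"
      unfolding sqrt_string_energy[symmetric] using taut_le[OF zt] by simp
    also have "\<dots> = L2_set (\<lambda>k. \<bar>d k + z (Suc k) - z k\<bar>) {..<l + n}" by (simp add: L2_set_def)
    also have "\<dots> \<le> L2_set (\<lambda>k. (\<bar>A k\<bar> + \<bar>B k\<bar>) + c k) {..<l + n}"
      using le by (intro L2_set_mono) auto
    also have "\<dots> \<le> L2_set (\<lambda>k. \<bar>A k\<bar> + \<bar>B k\<bar>) {..<l + n} + L2_set c {..<l + n}" by (rule L2_set_triangle_ineq)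
    also have "\<dots> \<le> (L2_set (\<lambda>k. \<bar>A k\<bar>) {..<l + n} + L2_set (\<lambda>k. \<bar>B k\<bar>) {..<l + n}) + L2_set c {..<l + n}"
      by (intro add_right_mono L2_set_triangle_ineq)
    also have "L2_set (\<lambda>k. \<bar>A k\<bar>) {..<l + n} = sqrt (string_energy (l + n) d y)"
      by (simp add: L2_set_def string_energy_def A_def)
    also have "L2_set (\<lambda>k. \<bar>B k\<bar>) {..<l + n} = sqrt (string_energy n (\<lambda>k. d (l + k)) x)"
    proof -
      have "(\<Sum>k<l + n. (B k)\<^sup>2) = (\<Sum>k<n. (d (l + k) + x (Suc k) - x k)\<^sup>2)"
        by (subst sum_lessThan_add) (simp add: B_def x'_def Suc_diff_le)
      then show ?thesis by (simp add: L2_set_def string_energy_def)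
    qed
    also have "L2_set c {..<l + n} = 2 * r / sqrt (real n)"
    proof -
      have "(\<Sum>k<l + n. (c k)\<^sup>2) = real n * (2 * r / real n)\<^sup>2"
        by (subst sum_lessThan_add) (simp add: c_def)
      also have "\<dots> = (2 * r / sqrt (real n))\<^sup>2" using assms by (simp add: power2_eq_square field_simps)
      finally show ?thesis using assms by (simp add: L2_set_def)
    qed
    finally show ?thesis .
  qed
  show ?thesis
  proof (rule field_le_epsilon)
    fix e :: real assume e: "e > 0"
    obtain y where y: "y \<in> tube (l + n) r r" "string_energy (l + n) d y < taut (l + n) r r d + (e/2)\<^sup>2"
      using taut_approx[of r r "(e/2)\<^sup>2"] assms e by (metis zero_less_power half_gt_zero)
    obtain x where x: "x \<in> tube n r 0" "string_energy n (\<lambda>k. d (l + k)) x < taut n r 0 (\<lambda>k. d (l + k)) + (e/2)\<^sup>2"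
      using taut_approx[of r 0 "(e/2)\<^sup>2"] assms e by (metis zero_less_power half_gt_zero order_refl)
    have s: "sqrt S \<le> sqrt t + e / 2" if "S < t + (e/2)\<^sup>2" "0 \<le> t" for S t
    proof -
      have "sqrt S \<le> sqrt (t + (e/2)\<^sup>2)" using that by simp
      also have "\<dots> \<le> sqrt t + sqrt ((e/2)\<^sup>2)" using that by (intro sqrt_add_le_add_sqrt) auto
      finally show ?thesis using e by simp
    qed
    show "sqrt (taut (l + n) r 0 d) \<le> sqrt (taut (l + n) r r d) + sqrt (taut n r 0 (\<lambda>k. d (l + k))) + 2 * r / sqrt (real n) + e"
      using main[OF y(1) x(1)] s[OF y(2)] s[OF x(2)] assms by (simp add: taut_nonneg)
  qed
qed

text \<open>
  Over one cell the tube absorbs at most \<open>2 * r\<close> of the increment of the path.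
\<close>

lemma taut_lower_bound:
  assumes "0 \<le> r"
  shows "(\<Sum>k<N. (max 0 (\<bar>d k\<bar> - 2 * r))\<^sup>2) \<le> taut N r 0 d"
proof (rule taut_greatest[OF assms order_refl])
  fix y assume y: "y \<in> tube N r 0"
  show "(\<Sum>k<N. (max 0 (\<bar>d k\<bar> - 2 * r))\<^sup>2) \<le> string_energy N d y"
    unfolding string_energy_def
  proof (rule sum_mono)
    fix k assume "k \<in> {..<N}"
    then have "\<bar>y k\<bar> \<le> r" "\<bar>y (Suc k)\<bar> \<le> r" using y by (auto simp: tube_def)
    then have "max 0 (\<bar>d k\<bar> - 2 * r) \<le> \<bar>d k + y (Suc k) - y k\<bar>" by linarith
    then show "(max 0 (\<bar>d k\<bar> - 2 * r))\<^sup>2 \<le> (d k + y (Suc k) - y k)\<^sup>2"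
      by (metis abs_le_square_iff abs_of_nonneg max.cobounded1)
  qed
qed

lemma taut_one: "0 \<le> r \<Longrightarrow> taut 1 r 0 d = (d 0)\<^sup>2"
proof (rule antisym)
  assume r: "0 \<le> r"
  show "taut 1 r 0 d \<le> (d 0)\<^sup>2" using taut_le[OF zero_in_tube[OF r order_refl], of 1 d] by (simp add: string_energy_def)
  show "(d 0)\<^sup>2 \<le> taut 1 r 0 d" by (rule taut_greatest[OF r]) (auto simp: tube_def string_energy_def)
qed

text \<open>
  Halving the cells: the new nodes start at the midpoints of the string and are moved by the part of the
  path's midpoint deviation \<open>Z\<close> that exceeds \<open>c\<close> in absolute value; \<open>|Z|\<close> is at most the larger of the two adjacent
  increments of the path. The deviations of the string grow by at most \<open>c\<close>, and
  moving a midpoint by \<open>z\<close> adds exactly \<open>2 * z^2\<close> to the sum of squares. The factor \<open>1 / 2\<close> disappears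
  after multiplication by the number of cells.
\<close>

lemma taut_refine:
  assumes "0 \<le> r" "0 \<le> c"
  shows "taut (2 * N) (r + c) 0 d \<le> taut N r 0 (\<lambda>k. d (2 * k) + d (Suc (2 * k))) / 2 +
    2 * (\<Sum>k<2 * N. (max 0 (\<bar>d k\<bar> - c))\<^sup>2)"
proof -
  let ?S = "2 * (\<Sum>k<2 * N. (max 0 (\<bar>d k\<bar> - c))\<^sup>2)"
  define D where "D k = d (2 * k) + d (Suc (2 * k))" for k
  have "2 * (taut (2 * N) (r + c) 0 d - ?S) \<le> taut N r 0 D"
  proof (rule taut_greatest[OF assms(1) order_refl])
    fix y assume y: "y \<in> tube N r 0"
    define Z where "Z k = (d (2 * k) - d (Suc (2 * k))) / 2" for k
    \<comment> \<open>At the k-th midpoint the deviation of the string is - cl k plus the average of the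
      deviations at the neighbouring nodes.\<close>
    define cl where "cl k = max (- c) (min c (Z k))" for k
    define z where "z j = (if even j then y (j div 2) else (y (j div 2) + y (Suc (j div 2))) / 2 - cl (j div 2))" for j
    have ze: "z (2 * k) = y k" "z (Suc (2 * k)) = (y k + y (Suc k)) / 2 - cl k" "z (Suc (Suc (2 * k))) = y (Suc k)" for k
      by (simp_all add: z_def)
    have yb: "\<bar>y k\<bar> \<le> r" if "k \<le> N" for k using y that by (auto simp: tube_def)
    have clb: "\<bar>cl k\<bar> \<le> c" for k using assms by (auto simp: cl_def)
    have max_sq: "(max a b)\<^sup>2 \<le> a\<^sup>2 + b\<^sup>2" for a b :: real by (auto simp: max_def)
    have clip: "\<bar>z - max (- c) (min c z)\<bar> \<le> max (max 0 (\<bar>a\<bar> - c)) (max 0 (\<bar>b\<bar> - c))"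
      if "2 * z = a - b" for a b z :: real
      using that assms by (auto simp: max_def min_def abs_if)
    have "\<bar>z j\<bar> \<le> r + c" if "j \<le> 2 * N" for j
    proof (cases "even j")
      case True
      moreover have "\<bar>y (j div 2)\<bar> \<le> r" using that by (intro yb) auto
      ultimately show ?thesis using assms by (simp add: z_def)
    next
      case False
      then have "j \<noteq> 2 * N" by auto
      then have "j div 2 < N" using that by auto
      then have "\<bar>y (j div 2)\<bar> \<le> r" "\<bar>y (Suc (j div 2))\<bar> \<le> r" using yb by auto
      then have "\<bar>(y (j div 2) + y (Suc (j div 2))) / 2\<bar> \<le> r"
        using abs_triangle_ineq[of "y (j div 2)" "y (Suc (j div 2))"] by (simp add: abs_divide)
      then have "\<bar>(y (j div 2) + y (Suc (j div 2))) / 2 - cl (j div 2)\<bar> \<le> r + c"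
        using clb[of "j div 2"] by linarith
      then show ?thesis using False by (simp add: z_def)
    qed
    moreover have "z 0 = 0" "z (2 * N) = 0" using y by (auto simp: z_def tube_def)
    ultimately have "z \<in> tube (2 * N) (r + c) 0" by (simp add: tube_def)
    then have "taut (2 * N) (r + c) 0 d \<le> string_energy (2 * N) d z" by (rule taut_le)
    also have "\<dots> = (\<Sum>k<N. (d (2 * k) + z (Suc (2 * k)) - z (2 * k))\<^sup>2 +
        (d (Suc (2 * k)) + z (Suc (Suc (2 * k))) - z (Suc (2 * k)))\<^sup>2)"
      unfolding string_energy_def by (induction N) auto
    also have "\<dots> = (\<Sum>k<N. (D k + y (Suc k) - y k)\<^sup>2 / 2 + 2 * (Z k - cl k)\<^sup>2)"
    proof (intro sum.cong refl)
      fix k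
      define s where "s = D k + y (Suc k) - y k"
      have 1: "d (2 * k) + z (Suc (2 * k)) - z (2 * k) = s / 2 + (Z k - cl k)"
        unfolding ze s_def D_def Z_def by (simp add: field_simps)
      have 2: "d (Suc (2 * k)) + z (Suc (Suc (2 * k))) - z (Suc (2 * k)) = s / 2 - (Z k - cl k)"
        unfolding ze s_def D_def Z_def by (simp add: field_simps)
      show "(d (2 * k) + z (Suc (2 * k)) - z (2 * k))\<^sup>2 + (d (Suc (2 * k)) + z (Suc (Suc (2 * k))) - z (Suc (2 * k)))\<^sup>2
        = (D k + y (Suc k) - y k)\<^sup>2 / 2 + 2 * (Z k - cl k)\<^sup>2"
        unfolding 1 2 s_def[symmetric] by (simp add: power2_eq_square field_simps)
    qed
    also have "\<dots> \<le> (\<Sum>k<N. (D k + y (Suc k) - y k)\<^sup>2 / 2 +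
        2 * ((max 0 (\<bar>d (2 * k)\<bar> - c))\<^sup>2 + (max 0 (\<bar>d (Suc (2 * k))\<bar> - c))\<^sup>2))"
    proof (intro sum_mono add_left_mono mult_left_mono)
      fix k
      have "\<bar>Z k - cl k\<bar> \<le> max (max 0 (\<bar>d (2 * k)\<bar> - c)) (max 0 (\<bar>d (Suc (2 * k))\<bar> - c))"
        unfolding cl_def by (rule clip) (simp add: Z_def)
      then have "(Z k - cl k)\<^sup>2 \<le> (max (max 0 (\<bar>d (2 * k)\<bar> - c)) (max 0 (\<bar>d (Suc (2 * k))\<bar> - c)))\<^sup>2"
        by (metis abs_le_square_iff abs_of_nonneg max.cobounded1 order_trans)
      also have "\<dots> \<le> (max 0 (\<bar>d (2 * k)\<bar> - c))\<^sup>2 + (max 0 (\<bar>d (Suc (2 * k))\<bar> - c))\<^sup>2"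
        by (rule max_sq)
      finally show "(Z k - cl k)\<^sup>2 \<le> (max 0 (\<bar>d (2 * k)\<bar> - c))\<^sup>2 + (max 0 (\<bar>d (Suc (2 * k))\<bar> - c))\<^sup>2" .
    qed simp
    also have "\<dots> = string_energy N D y / 2 +
        2 * (\<Sum>k<N. (max 0 (\<bar>d (2 * k)\<bar> - c))\<^sup>2 + (max 0 (\<bar>d (Suc (2 * k))\<bar> - c))\<^sup>2)"
      by (simp add: string_energy_def sum.distrib sum_divide_distrib sum_distrib_left)
    also have "(\<Sum>k<N. (max 0 (\<bar>d (2 * k)\<bar> - c))\<^sup>2 + (max 0 (\<bar>d (Suc (2 * k))\<bar> - c))\<^sup>2)
        = (\<Sum>k<2 * N. (max 0 (\<bar>d k\<bar> - c))\<^sup>2)"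
      by (induction N) auto
    finally show "2 * (taut (2 * N) (r + c) 0 d - ?S) \<le> string_energy N D y" by simp
  qed
  then show ?thesis by (simp add: D_def[abs_def])
qed

section \<open>Convergence of the grid energies\<close>

text \<open>
  The common form of \<open>I_pinned\<close> (\<open>\<rho> = 0\<close>) and \<open>I_free\<close> (\<open>\<rho> = r\<close>).
\<close>

definition I_within :: "real \<Rightarrow> real \<Rightarrow> real \<Rightarrow> (real \<Rightarrow> real) \<Rightarrow> ennreal" where
  "I_within T r \<rho> w = Inf {energy_norm T h | h.
     abs_continuous_on 0 T h \<and> sup_norm T (\<lambda>t. h t - w t) \<le> r \<and> h 0 = 0 \<and> \<bar>h T - w T\<bar> \<le> \<rho>}"

lemma sup_norm_le_iff:
  assumes "T \<ge> 0" "continuous_on {0..T} g"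
  shows "sup_norm T g \<le> r \<longleftrightarrow> (\<forall>t\<in>{0..T}. \<bar>g t\<bar> \<le> r)"
proof -
  have "compact ((\<lambda>t. \<bar>g t\<bar>) ` {0..T})"
    by (intro compact_continuous_image continuous_on_rabs assms) simp
  then have "bdd_above ((\<lambda>t. \<bar>g t\<bar>) ` {0..T})"
    by (intro bounded_imp_bdd_above compact_imp_bounded)
  then show ?thesis unfolding sup_norm_def using assms(1) by (subst cSUP_le_iff) auto
qed

lemma I_pinned_eq: "I_pinned T r w = I_within T r 0 w"
  by (simp add: I_pinned_def I_within_def)

lemma I_free_eq:
  assumes "T \<ge> 0" "continuous_on {0..T} w"
  shows "I_free T r w = I_within T r r w"
proof -
  have "\<bar>h T - w T\<bar> \<le> r" if "abs_continuous_on 0 T h" "sup_norm T (\<lambda>t. h t - w t) \<le> r" for h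
  proof -
    have "continuous_on {0..T} (\<lambda>t. h t - w t)"
      by (intro continuous_intros abs_continuous_imp_continuous that assms)
    from sup_norm_le_iff[OF assms(1) this] that(2) assms(1) show ?thesis by auto
  qed
  then show ?thesis unfolding I_free_def I_within_def by (intro arg_cong[where f = Inf]) blast
qed

definition grid_increment :: "real \<Rightarrow> nat \<Rightarrow> (real \<Rightarrow> real) \<Rightarrow> nat \<Rightarrow> real" where
  "grid_increment T N w k = w (real (Suc k) * (T / real N)) - w (real k * (T / real N))"

definition grid_energy :: "real \<Rightarrow> nat \<Rightarrow> real \<Rightarrow> real \<Rightarrow> (real \<Rightarrow> real) \<Rightarrow> real" where
  "grid_energy T N r \<rho> w = real N / T * taut N r \<rho> (grid_increment T N w)"

lemma grid_energy_nonneg: "0 \<le> T \<Longrightarrow> 0 \<le> r \<Longrightarrow> 0 \<le> \<rho> \<Longrightarrow> 0 \<le> grid_energy T N r \<rho> w"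
  by (simp add: grid_energy_def taut_nonneg)

text \<open>
  The polygon through points of the graph of \<open>h\<close> has no more energy than \<open>h\<close>.
\<close>

lemma sum_increments_le_energy:
  assumes T: "T > 0" and N: "N > 0" and h: "abs_continuous_on 0 T h"
  shows "ennreal (sqrt (real N / T * (\<Sum>k<N. (h (real (Suc k) * (T / real N)) - h (real k * (T / real N)))\<^sup>2)))
    \<le> energy_norm T h"
proof -
  define w where "w = T / real N"
  have w: "w > 0" "real N * w = T" using T N by (auto simp: w_def)
  define c where "c k = {0 + real k * w<..<0 + real (Suc k) * w}" for k
  define S where "S = (\<Sum>k<N. (h (real (Suc k) * w) - h (real k * w))\<^sup>2)"
  define E where "E = (\<integral>\<^sup>+t\<in>{0..T}. ennreal ((deriv h t)\<^sup>2) \<partial>lebesgue)"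
  have cT: "c k \<subseteq> {0<..<T}" if "k < N" for k
  proof -
    have "real (Suc k) * w \<le> T"
      unfolding w(2)[symmetric] using that w(1) by (intro mult_right_mono) auto
    moreover have "0 \<le> real k * w" using w by simp
    ultimately show ?thesis unfolding c_def greaterThanLessThan_subseteq_greaterThanLessThan by linarith
  qed
  have disj: "disjoint_family_on c {..<N}"
    unfolding c_def by (rule disjoint_family_on_mono[OF _ cells_disjoint]) (use w in auto)
  obtain G where G [measurable]: "G \<in> borel_measurable lebesgue"
    and AEG: "AE x in lebesgue. x \<in> {0<..<T} \<longrightarrow> deriv h x = G x"
    using abs_continuous_deriv_measurable[OF h less_imp_le[OF T]] by blast
  have cm: "c k \<in> sets lebesgue" for k by (simp add: c_def)
  have "ennreal S = (\<Sum>k<N. ennreal ((h (real (Suc k) * w) - h (real k * w))\<^sup>2))"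
    unfolding S_def by (subst sum_ennreal) auto
  also have "\<dots> \<le> (\<Sum>k<N. ennreal w * (\<integral>\<^sup>+t. ennreal ((G t)\<^sup>2) * indicator (c k) t \<partial>lebesgue))"
  proof (intro sum_mono)
    fix k assume k: "k \<in> {..<N}"
    have "real (Suc k) * w \<le> real N * w" using k w by (intro mult_right_mono) auto
    then have "abs_continuous_on (real k * w) (real (Suc k) * w) h"
      using w by (intro abs_continuous_on_subinterval[OF h]) auto
    from abs_continuous_increment_le[OF this]
    have "ennreal ((h (real (Suc k) * w) - h (real k * w))\<^sup>2) \<le>
        ennreal w * (\<integral>\<^sup>+t\<in>c k. ennreal ((deriv h t)\<^sup>2) \<partial>lebesgue)"
      using w by (simp add: c_def algebra_simps)
    also have "(\<integral>\<^sup>+t\<in>c k. ennreal ((deriv h t)\<^sup>2) \<partial>lebesgue) = (\<integral>\<^sup>+t. ennreal ((G t)\<^sup>2) * indicator (c k) t \<partial>lebesgue)"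
      using AEG
    proof (intro nn_integral_cong_AE, eventually_elim)
      case (elim t)
      then show ?case using cT[of k] k by (cases "t \<in> c k") auto
    qed
    finally show "ennreal ((h (real (Suc k) * w) - h (real k * w))\<^sup>2) \<le>
        ennreal w * (\<integral>\<^sup>+t. ennreal ((G t)\<^sup>2) * indicator (c k) t \<partial>lebesgue)" .
  qed
  also have "\<dots> = ennreal w * (\<integral>\<^sup>+t. (\<Sum>k<N. ennreal ((G t)\<^sup>2) * indicator (c k) t) \<partial>lebesgue)"
    using cm by (subst nn_integral_sum) (auto simp: sum_distrib_left intro!: borel_measurable_times_ennreal borel_measurable_indicator)
  also have "\<dots> \<le> ennreal w * E"
    unfolding E_def
  proof (intro mult_left_mono nn_integral_mono_AE)
    show "AE t in lebesgue. (\<Sum>k<N. ennreal ((G t)\<^sup>2) * indicator (c k) t) \<le> ennreal ((deriv h t)\<^sup>2) * indicator {0..T} t"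
      using AEG
    proof eventually_elim
      case (elim t)
      have "(\<Sum>k<N. ennreal ((G t)\<^sup>2) * indicator (c k) t) = ennreal ((G t)\<^sup>2) * indicator (\<Union>k<N. c k) t"
        using disj by (simp add: indicator_UN_disjoint sum_distrib_left)
      also have "\<dots> \<le> ennreal ((deriv h t)\<^sup>2) * indicator {0..T} t"
      proof (cases "t \<in> (\<Union>k<N. c k)")
        case True
        then have "t \<in> {0<..<T}" using cT by blast
        then show ?thesis using elim True by simp
      qed simp
      finally show ?case .
    qed
  qed simp
  finally have SE: "ennreal S \<le> ennreal w * E" .
  show ?thesis
  proof (cases "E = \<infinity>")
    case True
    then show ?thesis by (simp add: energy_norm_def Let_def E_def[symmetric])
  next
    case False
    then have E: "E = ennreal (enn2real E)" by (simp add: ennreal_enn2real_if)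
    have "ennreal S \<le> ennreal (w * enn2real E)"
      using SE w by (subst (asm) E) (simp add: ennreal_mult)
    then have "S \<le> w * enn2real E" using w by (subst (asm) ennreal_le_iff) auto
    then have "real N / T * S \<le> enn2real E"
      using T N by (simp add: w_def field_simps)
    then show ?thesis using False
      by (simp add: energy_norm_def Let_def E_def[symmetric] S_def w_def ennreal_leI)
  qed
qed

lemma grid_energy_le_I_within:
  assumes T: "T > 0" and N: "N > 0" and r: "0 \<le> r" "0 \<le> \<rho>"
    and w: "continuous_on {0..T} w" "w 0 = 0"
  shows "ennreal (sqrt (grid_energy T N r \<rho> w)) \<le> I_within T r \<rho> w"
  unfolding I_within_def
proof (rule Inf_greatest)
  fix e assume "e \<in> {energy_norm T h | h. abs_continuous_on 0 T h \<and>
    sup_norm T (\<lambda>t. h t - w t) \<le> r \<and> h 0 = 0 \<and> \<bar>h T - w T\<bar> \<le> \<rho>}"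
  then obtain h where h: "e = energy_norm T h" "abs_continuous_on 0 T h"
    "sup_norm T (\<lambda>t. h t - w t) \<le> r" "h 0 = 0" "\<bar>h T - w T\<bar> \<le> \<rho>" by blast
  have "continuous_on {0..T} (\<lambda>t. h t - w t)"
    by (intro continuous_intros abs_continuous_imp_continuous h w)
  then have hr: "\<bar>h t - w t\<bar> \<le> r" if "t \<in> {0..T}" for t
    using h(3) that T by (subst (asm) sup_norm_le_iff) auto
  define y where "y k = h (real k * (T / real N)) - w (real k * (T / real N))" for k
  have "y \<in> tube N r \<rho>"
    using h w N T by (auto simp: tube_def y_def field_simps intro!: hr)
  from taut_le[OF this, of "grid_increment T N w"]
  have "grid_energy T N r \<rho> w \<le> real N / T * string_energy N (grid_increment T N w) y"
    unfolding grid_energy_def using T by (intro mult_left_mono) auto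
  also have "string_energy N (grid_increment T N w) y =
      (\<Sum>k<N. (h (real (Suc k) * (T / real N)) - h (real k * (T / real N)))\<^sup>2)"
    by (simp add: string_energy_def grid_increment_def y_def)
  finally have "ennreal (sqrt (grid_energy T N r \<rho> w)) \<le>
     ennreal (sqrt (real N / T * (\<Sum>k<N. (h (real (Suc k) * (T / real N)) - h (real k * (T / real N)))\<^sup>2)))"
    by (intro ennreal_leI) simp
  also have "\<dots> \<le> e" unfolding h(1) by (rule sum_increments_le_energy[OF T N h(2)])
  finally show "ennreal (sqrt (grid_energy T N r \<rho> w)) \<le> e" .
qed

lemma interpolant_near:
  assumes T: "T > 0" and N: "N > 0"
    and x: "\<And>k. k \<le> N \<Longrightarrow> \<bar>x k - w (real k * (T / real N))\<bar> \<le> q"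
    and osc: "\<And>s t. s \<in> {0..T} \<Longrightarrow> t \<in> {0..T} \<Longrightarrow> \<bar>s - t\<bar> \<le> T / real N \<Longrightarrow> \<bar>w s - w t\<bar> \<le> \<eta>"
    and t: "t \<in> {0..T}"
  shows "\<bar>interpolant N (T / real N) x t - w t\<bar> \<le> q + \<eta>"
proof -
  define u where "u = T / real N"
  have u: "u > 0" "real N * u = T" using T N by (auto simp: u_def)
  obtain k \<theta> where k: "k < N" "0 \<le> \<theta>" "\<theta> \<le> 1" "t = (real k + \<theta>) * u"
    using grid_cases[OF u(1) N, of t] t u(2) by auto
  have kT: "real j * u \<in> {0..T}" if "j \<le> N" for j
    using that u mult_right_mono[of "real j" "real N" u] by auto
  have o1: "\<bar>w (real k * u) - w t\<bar> \<le> \<eta>"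
  proof -
    have "real k * u - t = - (\<theta> * u)" using k by (simp add: algebra_simps)
    then have "\<bar>real k * u - t\<bar> \<le> u" using k u by (simp add: abs_mult mult_left_le_one_le)
    then show ?thesis using k t kT[of k] by (intro osc) (auto simp: u_def[symmetric])
  qed
  have "real (Suc k) * u - t = (1 - \<theta>) * u" using k by (simp add: algebra_simps)
  then have "\<bar>real (Suc k) * u - t\<bar> \<le> u" using k u by (simp add: abs_mult mult_left_le_one_le)
  then have o2: "\<bar>w (real (Suc k) * u) - w t\<bar> \<le> \<eta>"
    using k t kT[of "Suc k"] by (intro osc) (auto simp: u_def[symmetric])
  have "interpolant N u x t - w t =
    (1 - \<theta>) * (x k - w (real k * u)) + \<theta> * (x (Suc k) - w (real (Suc k) * u)) +
    ((1 - \<theta>) * (w (real k * u) - w t) + \<theta> * (w (real (Suc k) * u) - w t))"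
    unfolding k(4) interpolant_eq[OF u(1) k(1-3)] by (simp add: algebra_simps)
  moreover have comb: "\<bar>(1 - \<theta>) * p + \<theta> * p'\<bar> \<le> c" if "\<bar>p\<bar> \<le> c" "\<bar>p'\<bar> \<le> c" for p p' c :: real
  proof -
    have "\<bar>(1 - \<theta>) * p + \<theta> * p'\<bar> \<le> (1 - \<theta>) * \<bar>p\<bar> + \<theta> * \<bar>p'\<bar>"
      using k by (intro order_trans[OF abs_triangle_ineq]) (simp add: abs_mult)
    also have "\<dots> \<le> (1 - \<theta>) * c + \<theta> * c" using k that by (intro add_mono mult_left_mono) auto
    finally show ?thesis by (simp add: algebra_simps)
  qed
  moreover have "\<bar>(1 - \<theta>) * (x k - w (real k * u)) + \<theta> * (x (Suc k) - w (real (Suc k) * u))\<bar> \<le> q"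
    "\<bar>(1 - \<theta>) * (w (real k * u) - w t) + \<theta> * (w (real (Suc k) * u) - w t)\<bar> \<le> \<eta>"
    using x[of k] x[of "Suc k"] o1 o2 k(1) by (auto simp: u_def[symmetric] intro!: comb simp del: of_nat_Suc)
  ultimately show ?thesis unfolding u_def[symmetric] by linarith
qed

lemma uniform_oscillation:
  fixes w :: "real \<Rightarrow> real"
  assumes w: "continuous_on {0..T} w" and T: "T > 0" and \<eta>: "\<eta> > 0"
  obtains N0 where "N0 > 0" "\<And>N s t. N \<ge> N0 \<Longrightarrow> s \<in> {0..T} \<Longrightarrow> t \<in> {0..T} \<Longrightarrow>
    \<bar>s - t\<bar> \<le> T / real N \<Longrightarrow> \<bar>w s - w t\<bar> \<le> \<eta>"
proof -
  have "uniformly_continuous_on {0..T} w" using w by (intro compact_uniformly_continuous) auto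
  then obtain d where d: "d > 0" "\<And>s t. s \<in> {0..T} \<Longrightarrow> t \<in> {0..T} \<Longrightarrow> dist t s < d \<Longrightarrow> dist (w t) (w s) < \<eta>"
    unfolding uniformly_continuous_on_def using \<eta> by blast
  obtain N0 :: nat where N0: "T / d < real N0" using reals_Archimedean2 by blast
  then have N0p: "N0 > 0" using T d by (metis divide_pos_pos gr0I less_asym of_nat_0)
  show ?thesis
  proof (rule that[OF N0p])
    fix N s t assume *: "N \<ge> N0" "s \<in> {0..T}" "t \<in> {0..T}" "\<bar>s - t\<bar> \<le> T / real N"
    have "T / real N \<le> T / real N0" using * N0p T by (intro divide_left_mono) auto
    also have "\<dots> < d" using N0 N0p d by (simp add: field_simps)
    finally have "dist s t < d" using * by (simp add: dist_real_def)
    then show "\<bar>w s - w t\<bar> \<le> \<eta>" using d(2)[OF *(3,2)] by (simp add: dist_real_def)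
  qed
qed

lemma I_within_le_interpolant:
  assumes T: "T > 0" and N: "N > 0" and w: "continuous_on {0..T} w"
    and x: "x 0 = 0" "\<bar>x N - w T\<bar> \<le> \<rho>"
    and near: "\<And>t. t \<in> {0..T} \<Longrightarrow> \<bar>interpolant N (T / real N) x t - w t\<bar> \<le> r"
  shows "I_within T r \<rho> w \<le> ennreal (sqrt (real N / T * (\<Sum>k<N. (x (Suc k) - x k)\<^sup>2)))"
proof -
  let ?h = "interpolant N (T / real N) x"
  have u: "T / real N > 0" using T N by simp
  obtain L where "L \<ge> 0" "\<And>s t. \<bar>?h s - ?h t\<bar> \<le> L * \<bar>s - t\<bar>"
    using interpolant_Lipschitz[OF u] by blast
  then have ac: "abs_continuous_on 0 T ?h" by (rule Lipschitz_imp_abs_continuous)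
  have "sup_norm T (\<lambda>t. ?h t - w t) \<le> r"
  proof -
    have "continuous_on {0..T} (\<lambda>t. ?h t - w t)"
      by (intro continuous_on_diff abs_continuous_imp_continuous ac w)
    then show ?thesis using near T by (subst sup_norm_le_iff) auto
  qed
  moreover have "?h 0 = 0" using interpolant_node[OF u, of 0 N x] N x by simp
  moreover have "\<bar>?h T - w T\<bar> \<le> \<rho>" using interpolant_node[OF u, of N N x] N x by simp
  ultimately have "I_within T r \<rho> w \<le> energy_norm T ?h"
    unfolding I_within_def using ac by (intro Inf_lower) blast
  also have "\<dots> \<le> ennreal (sqrt (real N / T * (\<Sum>k<N. (x (Suc k) - x k)\<^sup>2)))"
    by (rule energy_norm_interpolant[OF T N])
  finally show ?thesis .
qed

text \<open>
  Grid values never exceed \<open>I\<close>. Conversely, fix a polygon \<open>h0\<close> in the tube of radius \<open>r / 2\<close>, with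
  Lipschitz constant \<open>L\<close>. The polygon through \<open>(1 - l)\<close> times a string of the grid plus \<open>l\<close> times \<open>h0\<close> has
  deviations at most \<open>r - l * r / 2\<close> at the nodes, so it stays in the tube once the path oscillates by
  at most \<open>l * r / 2\<close> over a cell. Its energy is at most \<open>(1 - l)\<close> times that of the string plus
  \<open>l * L * sqrt T\<close>, in the sense of norms, and \<open>l\<close> is arbitrary.
\<close>

theorem grid_energy_tendsto_I_within:
  assumes T: "T > 0" and r: "0 < r" "0 \<le> \<rho>" and w: "continuous_on {0..T} w" "w 0 = 0"
  shows "I_within T r \<rho> w < \<infinity>"
    and "(\<lambda>N. sqrt (grid_energy T N r \<rho> w)) \<longlonglongrightarrow> enn2real (I_within T r \<rho> w)"
proof -
  define I where "I = enn2real (I_within T r \<rho> w)"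
  \<comment> \<open>The reference string h0 is a polygon through points of the path.\<close>
  obtain N1 where N1: "N1 > 0" "\<And>N s t. N \<ge> N1 \<Longrightarrow> s \<in> {0..T} \<Longrightarrow> t \<in> {0..T} \<Longrightarrow>
      \<bar>s - t\<bar> \<le> T / real N \<Longrightarrow> \<bar>w s - w t\<bar> \<le> r / 2"
    using uniform_oscillation[OF w(1) T, of "r / 2"] r by auto
  define u1 where "u1 = T / real N1"
  define x1 where "x1 k = w (real k * u1)" for k
  define h0 where "h0 = interpolant N1 u1 x1"
  have u1: "u1 > 0" using T N1 by (simp add: u1_def)
  have h0_near: "\<bar>h0 t - w t\<bar> \<le> r / 2" if "t \<in> {0..T}" for t
    using interpolant_near[OF T N1(1), of x1 w 0 "r / 2" t] N1 that by (auto simp: h0_def x1_def u1_def)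
  have h00: "h0 0 = 0" using interpolant_node[OF u1, of 0 N1 x1] N1 w by (simp add: h0_def x1_def)
  have h0T: "h0 T = w T" using interpolant_node[OF u1, of N1 N1 x1] N1 by (simp add: h0_def x1_def u1_def)
  obtain L where L: "L \<ge> 0" "\<And>s t. \<bar>h0 s - h0 t\<bar> \<le> L * \<bar>s - t\<bar>"
    using interpolant_Lipschitz[OF u1, of N1 x1] unfolding h0_def by blast
  have "I_within T r \<rho> w \<le> ennreal (sqrt (real N1 / T * (\<Sum>k<N1. (x1 (Suc k) - x1 k)\<^sup>2)))"
  proof (rule I_within_le_interpolant[OF T N1(1) w(1)])
    show "\<bar>interpolant N1 (T / real N1) x1 t - w t\<bar> \<le> r" if "t \<in> {0..T}" for t
      using h0_near[OF that] r by (simp add: h0_def u1_def)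
  qed (use r w N1 in \<open>auto simp: x1_def u1_def\<close>)
  then show fin: "I_within T r \<rho> w < \<infinity>" by (simp add: order_le_less_trans)
  then have I: "I_within T r \<rho> w = ennreal I" by (simp add: I_def)
  have I0: "I \<ge> 0" by (simp add: I_def)
  have lower: "sqrt (grid_energy T N r \<rho> w) \<le> I" if "N > 0" for N
    using grid_energy_le_I_within[OF T that _ r(2) w, of r] r I I0 by simp
  have upper: "\<exists>N0>0. \<forall>N\<ge>N0. I \<le> (1 - l) * sqrt (grid_energy T N r \<rho> w) + l * (L * sqrt T)" if l: "0 < l" "l < 1" for l
  proof -
    obtain N0 where N0: "N0 > 0" "\<And>N s t. N \<ge> N0 \<Longrightarrow> s \<in> {0..T} \<Longrightarrow> t \<in> {0..T} \<Longrightarrow>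
        \<bar>s - t\<bar> \<le> T / real N \<Longrightarrow> \<bar>w s - w t\<bar> \<le> l * r / 2"
      using uniform_oscillation[OF w(1) T, of "l * r / 2"] r l by auto
    have "I \<le> (1 - l) * sqrt (grid_energy T N r \<rho> w) + l * (L * sqrt T)" if N: "N \<ge> N0" for N
    proof -
      have Np: "N > 0" using N N0 by simp
      define u where "u = T / real N"
      have u: "u > 0" "real N * u = T" using T Np by (auto simp: u_def)
      have kT: "real k * u \<in> {0..T}" if "k \<le> N" for k
        using that u mult_right_mono[of "real k" "real N" u] by auto
      let ?d = "grid_increment T N w"
      have each: "I \<le> (1 - l) * sqrt (real N / T * string_energy N ?d y) + l * (L * sqrt T)"
        if y: "y \<in> tube N r \<rho>" for y
      proof -
        define x where "x k = (1 - l) * (w (real k * u) + y k) + l * h0 (real k * u)" for k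
        have "I_within T r \<rho> w \<le> ennreal (sqrt (real N / T * (\<Sum>k<N. (x (Suc k) - x k)\<^sup>2)))"
        proof (rule I_within_le_interpolant[OF T Np w(1)])
          show "x 0 = 0" using y w h00 by (simp add: x_def tube_def)
          have "x N - w T = (1 - l) * y N" using u h0T by (simp add: x_def algebra_simps)
          then have "\<bar>x N - w T\<bar> = (1 - l) * \<bar>y N\<bar>" using l by (simp add: abs_mult)
          also have "\<dots> \<le> 1 * \<rho>" using y l r by (intro mult_mono) (auto simp: tube_def)
          finally show "\<bar>x N - w T\<bar> \<le> \<rho>" by simp
          fix t assume t: "t \<in> {0..T}"
          have "\<bar>interpolant N (T / real N) x t - w t\<bar> \<le> (r - l * r / 2) + l * r / 2"
          proof (rule interpolant_near[OF T Np _ N0(2)[OF N] t])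
            fix k assume k: "k \<le> N"
            have "x k - w (real k * u) = (1 - l) * y k + l * (h0 (real k * u) - w (real k * u))"
              by (simp add: x_def algebra_simps)
            also have "\<bar>\<dots>\<bar> \<le> (1 - l) * \<bar>y k\<bar> + l * \<bar>h0 (real k * u) - w (real k * u)\<bar>"
              using l by (intro order_trans[OF abs_triangle_ineq]) (simp add: abs_mult)
            also have "\<dots> \<le> (1 - l) * r + l * (r / 2)"
              using l y k h0_near[OF kT[OF k]] by (intro add_mono mult_left_mono) (auto simp: tube_def)
            finally show "\<bar>x k - w (real k * (T / real N))\<bar> \<le> r - l * r / 2"
              by (simp add: u_def[symmetric] algebra_simps)
          qed
          then show "\<bar>interpolant N (T / real N) x t - w t\<bar> \<le> r" by simp
        qed
        then have "I \<le> sqrt (real N / T * (\<Sum>k<N. (x (Suc k) - x k)\<^sup>2))"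
          unfolding I using T
            by (subst (asm) ennreal_le_iff) (auto intro!: divide_nonneg_nonneg mult_nonneg_nonneg sum_nonneg)
        also have "\<dots> = sqrt (real N / T) * L2_set (\<lambda>k. x (Suc k) - x k) {..<N}"
          unfolding L2_set_def by (rule real_sqrt_mult)
        also have "L2_set (\<lambda>k. x (Suc k) - x k) {..<N} =
            L2_set (\<lambda>k. (1 - l) * (?d k + y (Suc k) - y k) + l * (h0 (real (Suc k) * u) - h0 (real k * u))) {..<N}"
          by (intro L2_set_cong) (auto simp: x_def grid_increment_def u_def[symmetric] algebra_simps)
        also have "\<dots> \<le> L2_set (\<lambda>k. (1 - l) * (?d k + y (Suc k) - y k)) {..<N} +
            L2_set (\<lambda>k. l * (h0 (real (Suc k) * u) - h0 (real k * u))) {..<N}"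
          by (rule L2_set_triangle_ineq)
        also have "L2_set (\<lambda>k. (1 - l) * (?d k + y (Suc k) - y k)) {..<N} = (1 - l) * sqrt (string_energy N ?d y)"
          using l by (simp add: L2_set_right_distrib sqrt_string_energy)
        also have "L2_set (\<lambda>k. l * (h0 (real (Suc k) * u) - h0 (real k * u))) {..<N} =
            l * L2_set (\<lambda>k. \<bar>h0 (real (Suc k) * u) - h0 (real k * u)\<bar>) {..<N}"
          using l by (simp add: L2_set_right_distrib[symmetric]) (simp add: L2_set_def power_mult_distrib)
        also have "L2_set (\<lambda>k. \<bar>h0 (real (Suc k) * u) - h0 (real k * u)\<bar>) {..<N} \<le> L2_set (\<lambda>k. L * u) {..<N}"
        proof (rule L2_set_mono)
          fix k
          have "\<bar>real (Suc k) * u - real k * u\<bar> = u" using u by (simp add: algebra_simps)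
          then show "\<bar>h0 (real (Suc k) * u) - h0 (real k * u)\<bar> \<le> L * u"
            using L(2)[of "real (Suc k) * u" "real k * u"] by simp
        qed simp
        also have "L2_set (\<lambda>k. L * u) {..<N} = sqrt (real N) * (L * u)"
          using L u by (simp add: L2_set_constant)
        finally have "I \<le> sqrt (real N / T) * ((1 - l) * sqrt (string_energy N ?d y) + l * (sqrt (real N) * (L * u)))"
          using l T by (simp add: mult_left_mono)
        also have "\<dots> = (1 - l) * sqrt (real N / T * string_energy N ?d y) + l * (L * (sqrt (real N / T) * sqrt (real N) * u))"
          unfolding real_sqrt_mult[of "real N / T"] by (simp add: algebra_simps)
        also have "sqrt (real N / T) * sqrt (real N) * u = sqrt T"
          using T Np by (simp add: u_def real_sqrt_divide field_simps)
        finally show ?thesis .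
      qed
      \<comment> \<open>Solving the bound for the energy of y makes it a lower bound for the infimum over y.\<close>
      define c where "c = (I - l * (L * sqrt T)) / (1 - l)"
      have c: "I = (1 - l) * c + l * (L * sqrt T)" using l by (simp add: c_def)
      have "c \<le> sqrt (grid_energy T N r \<rho> w)"
      proof (cases "c \<le> 0")
        case True
        moreover have "0 \<le> sqrt (grid_energy T N r \<rho> w)" using grid_energy_nonneg[of T r \<rho> N w] T r by simp
        ultimately show ?thesis by linarith
      next
        case False
        have "c\<^sup>2 * T / real N \<le> taut N r \<rho> ?d"
        proof (rule taut_greatest)
          fix y assume "y \<in> tube N r \<rho>"
          from each[OF this] have "(1 - l) * c \<le> (1 - l) * sqrt (real N / T * string_energy N ?d y)"
            unfolding c by simp
          then have "c \<le> sqrt (real N / T * string_energy N ?d y)" using l by simp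
          then have "c\<^sup>2 \<le> real N / T * string_energy N ?d y"
            using False T real_sqrt_pow2[of "real N / T * string_energy N ?d y"]
              power_mono[of c "sqrt (real N / T * string_energy N ?d y)" 2] by simp
          then show "c\<^sup>2 * T / real N \<le> string_energy N ?d y" using T Np by (simp add: field_simps)
        qed (use r in auto)
        then have "c\<^sup>2 \<le> grid_energy T N r \<rho> w" using T Np by (simp add: grid_energy_def field_simps)
        then show ?thesis by (rule real_le_rsqrt)
      qed
      then show ?thesis using c l by (simp add: mult_left_mono)
    qed
    then show ?thesis using N0(1) by blast
  qed
  show "(\<lambda>N. sqrt (grid_energy T N r \<rho> w)) \<longlonglongrightarrow> I"
  proof (rule LIMSEQ_I)
    fix e :: real assume e: "e > 0"
    define l where "l = min (1/2) (e / (2 * (L * sqrt T + 1)))"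
    have LT: "L * sqrt T \<ge> 0" using L T by simp
    have l: "0 < l" "l < 1" using e LT by (auto simp: l_def)
    have "l * (L * sqrt T) \<le> e / (2 * (L * sqrt T + 1)) * (L * sqrt T)"
      using LT by (intro mult_right_mono) (auto simp: l_def)
    also have "\<dots> = e * ((L * sqrt T) / (2 * (L * sqrt T + 1)))" by simp
    also have "\<dots> < e * 1" using e LT by (intro mult_strict_left_mono) (auto simp: pos_divide_less_eq)
    finally have le: "l * (L * sqrt T) < e" by simp
    obtain N0 where N0: "N0 > 0" "\<And>N. N \<ge> N0 \<Longrightarrow> I \<le> (1 - l) * sqrt (grid_energy T N r \<rho> w) + l * (L * sqrt T)"
      using upper[OF l] by blast
    have "norm (sqrt (grid_energy T N r \<rho> w) - I) < e" if "N \<ge> N0" for N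
    proof -
      have "0 \<le> l * sqrt (grid_energy T N r \<rho> w)" using l grid_energy_nonneg[of T r \<rho> N w] T r by simp
      then show ?thesis using N0(2)[OF that] lower[of N] that N0(1) le by (simp add: algebra_simps)
    qed
    then show "\<exists>N0. \<forall>N\<ge>N0. norm (sqrt (grid_energy T N r \<rho> w) - I) < e" by blast
  qed
qed

section \<open>Normalised increments of the Wiener process\<close>

text \<open>
  An infimum of continuous functions is upper semicontinuous, here for the product topology on
  sequences; this gives measurability although the infimum is over an uncountable set.
\<close>

lemma open_taut_less:
  assumes "0 \<le> r" "0 \<le> \<rho>"
  shows "open {d. taut N r \<rho> d < c}"
proof -
  have "continuous_on UNIV (\<lambda>d. string_energy N d y)" for y
    unfolding string_energy_def
    by (intro continuous_intros continuous_on_product_coordinates)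
  then have "open {d. string_energy N d y < c}" for y
    by (rule open_Collect_less) (rule continuous_on_const)
  then have "open (\<Union>y\<in>tube N r \<rho>. {d. string_energy N d y < c})" by blast
  also have "(\<Union>y\<in>tube N r \<rho>. {d. string_energy N d y < c}) = {d. taut N r \<rho> d < c}"
    using taut_less_iff[OF assms] by blast
  finally show ?thesis .
qed

lemma borel_measurable_taut:
  assumes "0 \<le> r" "0 \<le> \<rho>"
  shows "taut N r \<rho> \<in> borel_measurable borel"
  unfolding borel_measurable_iff_less using open_taut_less[OF assms] by (auto intro: borel_open)

lemma borel_measurable_taut_compose:
  assumes "0 \<le> r" "0 \<le> \<rho>" "\<And>k. k < N \<Longrightarrow> f k \<in> borel_measurable M"
  shows "(\<lambda>\<omega>. taut N r \<rho> (\<lambda>k. f k \<omega>)) \<in> borel_measurable M"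
proof -
  define g where "g \<omega> k = (if k < N then f k \<omega> else 0)" for \<omega> k
  have "g \<in> borel_measurable M"
  proof (rule measurable_coordinatewise_then_product)
    fix k show "(\<lambda>\<omega>. g \<omega> k) \<in> borel_measurable M"
      using assms(3) by (cases "k < N") (simp_all add: g_def)
  qed
  from measurable_compose[OF this borel_measurable_taut[OF assms(1,2), of N]]
  have "(\<lambda>\<omega>. taut N r \<rho> (g \<omega>)) \<in> borel_measurable M" .
  also have "(\<lambda>\<omega>. taut N r \<rho> (g \<omega>)) = (\<lambda>\<omega>. taut N r \<rho> (\<lambda>k. f k \<omega>))"
    by (intro ext taut_cong) (simp add: g_def)
  finally show ?thesis .
qed

definition std_normal :: "real measure" where
  "std_normal = density lborel (\<lambda>x. ennreal (std_normal_density x))"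

definition std_normal_vector :: "nat \<Rightarrow> (nat \<Rightarrow> real) measure" where
  "std_normal_vector N = (\<Pi>\<^sub>M k\<in>{..<N}. std_normal)"

lemma sets_std_normal [measurable_cong, simp]: "sets std_normal = sets borel"
  by (simp add: std_normal_def)

context wiener_process
begin

lemma W_measurable [measurable]: "t \<ge> 0 \<Longrightarrow> W t \<in> borel_measurable M"
proof (cases "t = 0")
  case True
  have "(\<lambda>_. 0) \<in> borel_measurable M" by simp
  then show ?thesis
    by (rule measurable_cong[THEN iffD1, rotated]) (use start True in auto)
next
  assume "t \<ge> 0"
  case False
  then have "(\<lambda>\<omega>. W t \<omega> - W 0 \<omega>) \<in> borel_measurable M"
    using gaussian_increments[of 0 t] \<open>t \<ge> 0\<close> by (auto simp: distributed_def)
  then show ?thesis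
    by (rule measurable_cong[THEN iffD1, rotated]) (use start in auto)
qed

definition noise :: "real \<Rightarrow> real \<Rightarrow> nat \<Rightarrow> 'a \<Rightarrow> real" where
  "noise s h k \<omega> = (W (s + real (Suc k) * h) \<omega> - W (s + real k * h) \<omega>) / sqrt h"

lemma noise_shift: "noise (s + real j * h) h k = noise s h (j + k)"
  by (simp add: noise_def[abs_def] algebra_simps)

lemma noise_measurable [measurable]:
  "0 \<le> s \<Longrightarrow> 0 < h \<Longrightarrow> noise s h k \<in> borel_measurable M"
  unfolding noise_def by (intro borel_measurable_divide borel_measurable_diff W_measurable) auto

lemma noise_indep:
  assumes "0 \<le> s" "0 < h"
  shows "indep_vars (\<lambda>_. borel) (noise s h) {..<n}"
proof -
  have "indep_vars (\<lambda>_. borel) (\<lambda>i \<omega>. W (s + real (Suc i) * h) \<omega> - W (s + real i * h) \<omega>) {..<n}"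
    using assms by (intro independent_increments[of "\<lambda>k. s + real k * h"]) (auto simp: algebra_simps)
  from indep_vars_compose2[OF this, of "\<lambda>_ x. x / sqrt h" "\<lambda>_. borel"] show ?thesis
    by (simp add: noise_def[abs_def])
qed

lemma noise_distributed:
  assumes "0 \<le> s" "0 < h"
  shows "distributed M lborel (noise s h k) std_normal_density"
proof -
  have "distributed M lborel (\<lambda>\<omega>. W (s + real (Suc k) * h) \<omega> - W (s + real k * h) \<omega>)
      (normal_density 0 (sqrt ((s + real (Suc k) * h) - (s + real k * h))))"
    using assms by (intro gaussian_increments) (auto simp: algebra_simps)
  also have "(s + real (Suc k) * h) - (s + real k * h) = h" by (simp add: algebra_simps)
  finally show ?thesis
    using normal_standard_normal_convert[of "sqrt h" "\<lambda>\<omega>. W (s + real (Suc k) * h) \<omega> - W (s + real k * h) \<omega>" 0] assms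
    by (simp add: noise_def[abs_def])
qed

lemma distr_noise:
  assumes "0 \<le> s" "0 < h"
  shows "distr M borel (noise s h k) = std_normal"
proof -
  have "distr M borel (noise s h k) = distr M lborel (noise s h k)" by (rule distr_cong) auto
  also have "\<dots> = std_normal"
    using distributed_distr_eq_density[OF noise_distributed[OF assms]] by (simp add: std_normal_def)
  finally show ?thesis .
qed

lemma distr_noise_vector:
  assumes "0 \<le> s" "0 < h" "N > 0"
  shows "distr M (\<Pi>\<^sub>M k\<in>{..<N}. borel) (\<lambda>\<omega>. \<lambda>k\<in>{..<N}. noise s h k \<omega>) = std_normal_vector N"
proof -
  have "distr M (\<Pi>\<^sub>M k\<in>{..<N}. borel) (\<lambda>\<omega>. \<lambda>k\<in>{..<N}. noise s h k \<omega>) =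
      (\<Pi>\<^sub>M k\<in>{..<N}. distr M borel (noise s h k))"
    using assms noise_indep[OF assms(1,2), of N]
    by (intro indep_vars_iff_distr_eq_PiM[THEN iffD1]) auto
  then show ?thesis using distr_noise[OF assms(1,2)] by (simp add: std_normal_vector_def)
qed

lemma nn_integral_taut_noise:
  assumes "0 \<le> s" "0 < h" "N > 0" "0 \<le> r" "0 \<le> \<rho>" and f: "f \<in> borel_measurable borel"
  shows "(\<integral>\<^sup>+\<omega>. f (taut N r \<rho> (\<lambda>k. noise s h k \<omega>)) \<partial>M) =
    (\<integral>\<^sup>+d. f (taut N r \<rho> d) \<partial>std_normal_vector N)"
proof -
  have m: "(\<lambda>d. f (taut N r \<rho> d)) \<in> borel_measurable (\<Pi>\<^sub>M k\<in>{..<N}. borel)"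
    using borel_measurable_taut_compose[OF assms(4,5), of N "\<lambda>k d. d k" "\<Pi>\<^sub>M k\<in>{..<N}. borel"]
    by (intro measurable_compose[OF _ f]) auto
  have "(\<integral>\<^sup>+d. f (taut N r \<rho> d) \<partial>std_normal_vector N) =
    (\<integral>\<^sup>+\<omega>. f (taut N r \<rho> (\<lambda>k\<in>{..<N}. noise s h k \<omega>)) \<partial>M)"
    unfolding distr_noise_vector[OF assms(1-3), symmetric]
    using assms m by (intro nn_integral_distr) (auto intro!: measurable_restrict)
  also have "\<dots> = (\<integral>\<^sup>+\<omega>. f (taut N r \<rho> (\<lambda>k. noise s h k \<omega>)) \<partial>M)"
    by (intro nn_integral_cong arg_cong[where f = f] taut_cong) simp
  finally show ?thesis by simp
qed

end

section \<open>The normalised length of the taut string\<close>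

text \<open>
  For a path on \<open>[0, T]\<close> with \<open>\<epsilon> = r / sqrt T\<close> and \<open>d\<close> the increments over the \<open>N\<close> cells divided by their standard deviation, this is
  the pinned grid energy times \<open>\<epsilon>^2\<close>; by Brownian scaling \<open>T\<close> and \<open>r\<close> enter only through \<open>\<epsilon>\<close>.
\<close>

definition scaled_taut :: "nat \<Rightarrow> real \<Rightarrow> (nat \<Rightarrow> real) \<Rightarrow> real" where
  "scaled_taut N \<epsilon> d = \<epsilon>\<^sup>2 * taut N (\<epsilon> * sqrt (real N)) 0 d"

definition scaled_free :: "nat \<Rightarrow> real \<Rightarrow> (nat \<Rightarrow> real) \<Rightarrow> real" where
  "scaled_free N \<epsilon> d = \<epsilon>\<^sup>2 * taut N (\<epsilon> * sqrt (real N)) (\<epsilon> * sqrt (real N)) d"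

lemma scaled_taut_nonneg: "\<epsilon> > 0 \<Longrightarrow> 0 \<le> scaled_taut N \<epsilon> d"
  by (simp add: scaled_taut_def taut_nonneg)

text \<open>
  The moment of order \<open>2 * p\<close> of the normalised pinned length, see \<open>nn_integral_pinned\<close>. It refers to
  Gaussian vectors only, which makes the limit constant independent of the probability space.
\<close>

definition taut_moment :: "nat \<Rightarrow> real \<Rightarrow> ennreal" where
  "taut_moment p \<epsilon> = (SUP n. \<integral>\<^sup>+d. ennreal (scaled_taut (2 ^ n) \<epsilon> d ^ p) \<partial>std_normal_vector (2 ^ n))"

lemma scaled_taut_mono:
  assumes "0 < \<epsilon>" "\<epsilon> \<le> \<epsilon>'"
  shows "scaled_taut N \<epsilon>' d \<le> (\<epsilon>' / \<epsilon>)\<^sup>2 * scaled_taut N \<epsilon> d"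
proof -
  have "taut N (\<epsilon>' * sqrt (real N)) 0 d \<le> taut N (\<epsilon> * sqrt (real N)) 0 d"
    using assms by (intro taut_mono_tube mult_right_mono) auto
  then have "scaled_taut N \<epsilon>' d \<le> \<epsilon>'\<^sup>2 * taut N (\<epsilon> * sqrt (real N)) 0 d"
    unfolding scaled_taut_def by (intro mult_left_mono) auto
  also have "\<dots> = (\<epsilon>' / \<epsilon>)\<^sup>2 * scaled_taut N \<epsilon> d" using assms by (simp add: scaled_taut_def power_divide)
  finally show ?thesis .
qed

lemma sets_std_normal_vector: "sets (std_normal_vector N) = sets (\<Pi>\<^sub>M k\<in>{..<N}. borel)"
  unfolding std_normal_vector_def by (intro sets_PiM_cong) auto

lemma measurable_scaled_taut:
  assumes "\<epsilon> > 0"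
  shows "scaled_taut N \<epsilon> \<in> borel_measurable (std_normal_vector N)"
proof -
  have "(\<lambda>d. taut N (\<epsilon> * sqrt (real N)) 0 d) \<in> borel_measurable (std_normal_vector N)"
    using borel_measurable_taut_compose[of "\<epsilon> * sqrt (real N)" 0 N "\<lambda>k d. d k" "std_normal_vector N"] assms
    by (simp add: measurable_cong_sets[OF sets_std_normal_vector refl])
  then show ?thesis unfolding scaled_taut_def[abs_def] by simp
qed

text \<open>
  A wider tube admits more strings, so only the normalising factor \<open>\<epsilon>^2\<close> can increase the moment.
\<close>

lemma taut_moment_mono:
  assumes "0 < \<epsilon>" "\<epsilon> \<le> \<epsilon>'"
  shows "taut_moment p \<epsilon>' \<le> ennreal ((\<epsilon>' / \<epsilon>)\<^sup>2 ^ p) * taut_moment p \<epsilon>"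
  unfolding taut_moment_def
proof (rule SUP_least)
  fix n :: nat
  let ?\<gamma> = "std_normal_vector (2 ^ n)"
  have "(\<integral>\<^sup>+d. ennreal (scaled_taut (2 ^ n) \<epsilon>' d ^ p) \<partial>?\<gamma>) \<le>
      (\<integral>\<^sup>+d. ennreal ((\<epsilon>' / \<epsilon>)\<^sup>2 ^ p) * ennreal (scaled_taut (2 ^ n) \<epsilon> d ^ p) \<partial>?\<gamma>)"
  proof (rule nn_integral_mono)
    fix d
    have "scaled_taut (2 ^ n) \<epsilon>' d ^ p \<le> ((\<epsilon>' / \<epsilon>)\<^sup>2 * scaled_taut (2 ^ n) \<epsilon> d) ^ p"
      using assms by (intro power_mono scaled_taut_mono scaled_taut_nonneg) auto
    also have "\<dots> = (\<epsilon>' / \<epsilon>)\<^sup>2 ^ p * scaled_taut (2 ^ n) \<epsilon> d ^ p" by (rule power_mult_distrib)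
    finally show "ennreal (scaled_taut (2 ^ n) \<epsilon>' d ^ p) \<le> ennreal ((\<epsilon>' / \<epsilon>)\<^sup>2 ^ p) * ennreal (scaled_taut (2 ^ n) \<epsilon> d ^ p)"
      using assms by (subst ennreal_mult[symmetric]) (auto intro!: ennreal_leI simp: scaled_taut_nonneg)
  qed
  also have "\<dots> = ennreal ((\<epsilon>' / \<epsilon>)\<^sup>2 ^ p) * (\<integral>\<^sup>+d. ennreal (scaled_taut (2 ^ n) \<epsilon> d ^ p) \<partial>?\<gamma>)"
    using measurable_scaled_taut[OF assms(1), of "2 ^ n"] by (intro nn_integral_cmult) auto
  also have "\<dots> \<le> ennreal ((\<epsilon>' / \<epsilon>)\<^sup>2 ^ p) * (SUP n. \<integral>\<^sup>+d. ennreal (scaled_taut (2 ^ n) \<epsilon> d ^ p) \<partial>std_normal_vector (2 ^ n))"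
    by (intro mult_left_mono SUP_upper) auto
  finally show "(\<integral>\<^sup>+d. ennreal (scaled_taut (2 ^ n) \<epsilon>' d ^ p) \<partial>?\<gamma>) \<le> \<dots>" .
qed

lemma nn_integral_le_of_limit:
  assumes "\<And>n. f n \<in> borel_measurable M"
    and "\<And>x. x \<in> space M \<Longrightarrow> (\<lambda>n. f n x) \<longlonglongrightarrow> g x"
    and "\<And>n. (\<integral>\<^sup>+x. ennreal (f n x) \<partial>M) \<le> B"
  shows "(\<integral>\<^sup>+x. ennreal (g x) \<partial>M) \<le> B"
proof -
  have "(\<integral>\<^sup>+x. ennreal (g x) \<partial>M) = (\<integral>\<^sup>+x. liminf (\<lambda>n. ennreal (f n x)) \<partial>M)"
  proof (rule nn_integral_cong)
    fix x assume "x \<in> space M"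
    then have "(\<lambda>n. ennreal (f n x)) \<longlonglongrightarrow> ennreal (g x)" using assms(2) by (intro tendsto_ennrealI)
    then show "ennreal (g x) = liminf (\<lambda>n. ennreal (f n x))" by (simp add: lim_imp_Liminf)
  qed
  also have "\<dots> \<le> liminf (\<lambda>n. \<integral>\<^sup>+x. ennreal (f n x) \<partial>M)"
    using assms(1) by (intro nn_integral_liminf) auto
  also have "\<dots> \<le> B"
    using assms(3) by (intro Liminf_le) (auto intro!: always_eventually)
  finally show ?thesis .
qed

context wiener_process
begin

definition taut_length :: "real \<Rightarrow> real \<Rightarrow> real \<Rightarrow> 'a \<Rightarrow> real" where
  "taut_length T r \<rho> \<omega> = r / sqrt T * enn2real (I_within T r \<rho> (\<lambda>t. W t \<omega>))"

lemma path_continuous: "\<omega> \<in> space M \<Longrightarrow> continuous_on {0..T} (\<lambda>t. W t \<omega>)"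
  by (rule continuous_on_subset[OF continuous_paths]) auto

lemma taut_length_nonneg: "0 < T \<Longrightarrow> 0 < r \<Longrightarrow> 0 \<le> taut_length T r \<rho> \<omega>"
  by (simp add: taut_length_def)

lemma grid_energy_eq_noise:
  assumes "T > 0" "r > 0" "0 \<le> \<rho>" "N > 0"
  shows "(r / sqrt T)\<^sup>2 * grid_energy T N r \<rho> (\<lambda>t. W t \<omega>) =
    (r / sqrt T)\<^sup>2 * taut N (r / sqrt T * sqrt (real N)) (\<rho> / sqrt T * sqrt (real N)) (\<lambda>k. noise 0 (T / real N) k \<omega>)"
proof -
  define h where "h = T / real N"
  have h: "h > 0" using assms by (simp add: h_def)
  have eq: "a / sqrt h = a / sqrt T * sqrt (real N)" for a
    using assms by (simp add: h_def real_sqrt_divide)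
  have "grid_increment T N (\<lambda>t. W t \<omega>) = (\<lambda>k. sqrt h * noise 0 h k \<omega>)"
    using h by (simp add: grid_increment_def noise_def fun_eq_iff h_def[symmetric] del: of_nat_Suc)
  then have "taut N r \<rho> (grid_increment T N (\<lambda>t. W t \<omega>)) =
      taut N (sqrt h * (r / sqrt h)) (sqrt h * (\<rho> / sqrt h)) (\<lambda>k. sqrt h * noise 0 h k \<omega>)"
    using h by simp
  also have "\<dots> = (sqrt h)\<^sup>2 * taut N (r / sqrt h) (\<rho> / sqrt h) (\<lambda>k. noise 0 h k \<omega>)"
    using assms h by (intro taut_scale) auto
  finally have "grid_energy T N r \<rho> (\<lambda>t. W t \<omega>) = real N / T * (h * taut N (r / sqrt h) (\<rho> / sqrt h) (\<lambda>k. noise 0 h k \<omega>))"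
    using h by (simp add: grid_energy_def)
  also have "\<dots> = taut N (r / sqrt h) (\<rho> / sqrt h) (\<lambda>k. noise 0 h k \<omega>)"
    using assms by (simp add: h_def)
  finally show ?thesis unfolding eq by (simp add: h_def)
qed

lemma taut_length_limit:
  assumes "T > 0" "r > 0" "0 \<le> \<rho>" "\<omega> \<in> space M"
  shows "(\<lambda>N. (r / sqrt T)\<^sup>2 * taut N (r / sqrt T * sqrt (real N)) (\<rho> / sqrt T * sqrt (real N))
    (\<lambda>k. noise 0 (T / real N) k \<omega>)) \<longlonglongrightarrow> (taut_length T r \<rho> \<omega>)\<^sup>2"
proof -
  have "(\<lambda>N. (r / sqrt T)\<^sup>2 * (sqrt (grid_energy T N r \<rho> (\<lambda>t. W t \<omega>)))\<^sup>2) \<longlonglongrightarrow> (r / sqrt T)\<^sup>2 * (enn2real (I_within T r \<rho> (\<lambda>t. W t \<omega>)))\<^sup>2"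
    using assms start path_continuous by (intro tendsto_intros grid_energy_tendsto_I_within) auto
  also have "(r / sqrt T)\<^sup>2 * (enn2real (I_within T r \<rho> (\<lambda>t. W t \<omega>)))\<^sup>2 = (taut_length T r \<rho> \<omega>)\<^sup>2"
    by (simp only: taut_length_def power_mult_distrib)
  finally show ?thesis
  proof (rule Lim_transform_eventually)
    show "\<forall>\<^sub>F N in sequentially. (r / sqrt T)\<^sup>2 * (sqrt (grid_energy T N r \<rho> (\<lambda>t. W t \<omega>)))\<^sup>2 =
      (r / sqrt T)\<^sup>2 * taut N (r / sqrt T * sqrt (real N)) (\<rho> / sqrt T * sqrt (real N))
    (\<lambda>k. noise 0 (T / real N) k \<omega>)"
      using eventually_gt_at_top[of 0]
    proof eventually_elim
      case (elim N)
      then show ?case using grid_energy_eq_noise[OF assms(1-3), of N \<omega>] grid_energy_nonneg[of T r \<rho> N "\<lambda>t. W t \<omega>"] assms by simp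
    qed
  qed
qed

lemma pinned_limit:
  assumes "T > 0" "r > 0" "\<omega> \<in> space M"
  shows "(\<lambda>N. scaled_taut N (r / sqrt T) (\<lambda>k. noise 0 (T / real N) k \<omega>)) \<longlonglongrightarrow> (taut_length T r 0 \<omega>)\<^sup>2"
  using taut_length_limit[OF assms(1,2) _ assms(3), of 0] by (simp add: scaled_taut_def)

lemma free_limit:
  assumes "T > 0" "r > 0" "\<omega> \<in> space M"
  shows "(\<lambda>N. scaled_free N (r / sqrt T) (\<lambda>k. noise 0 (T / real N) k \<omega>)) \<longlonglongrightarrow> (taut_length T r r \<omega>)\<^sup>2"
  using taut_length_limit[OF assms(1,2) _ assms(3), of r] assms by (simp add: scaled_free_def)

lemma scaled_taut_le:
  assumes "T > 0" "r > 0" "\<omega> \<in> space M" "N > 0"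
  shows "scaled_taut N (r / sqrt T) (\<lambda>k. noise 0 (T / real N) k \<omega>) \<le> (taut_length T r 0 \<omega>)\<^sup>2"
proof -
  let ?w = "\<lambda>t. W t \<omega>"
  have w: "continuous_on {0..T} ?w" "?w 0 = 0" using assms start path_continuous by auto
  have "ennreal (sqrt (grid_energy T N r 0 ?w)) \<le> I_within T r 0 ?w"
    using assms w by (intro grid_energy_le_I_within) auto
  also have "\<dots> = ennreal (enn2real (I_within T r 0 ?w))"
    using grid_energy_tendsto_I_within(1)[OF assms(1,2) order_refl w] by simp
  finally have "sqrt (grid_energy T N r 0 ?w) \<le> enn2real (I_within T r 0 ?w)" by simp
  then have "(sqrt (grid_energy T N r 0 ?w))\<^sup>2 \<le> (enn2real (I_within T r 0 ?w))\<^sup>2"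
    using assms by (intro power_mono) (auto simp: grid_energy_nonneg)
  then have "grid_energy T N r 0 ?w \<le> (enn2real (I_within T r 0 ?w))\<^sup>2"
    using assms by (simp add: grid_energy_nonneg)
  then have "(r / sqrt T)\<^sup>2 * grid_energy T N r 0 ?w \<le> (r / sqrt T)\<^sup>2 * (enn2real (I_within T r 0 ?w))\<^sup>2"
    by (intro mult_left_mono) auto
  also have "\<dots> = (taut_length T r 0 \<omega>)\<^sup>2" by (simp only: taut_length_def power_mult_distrib)
  finally show ?thesis
    unfolding grid_energy_eq_noise[OF assms(1,2) order_refl assms(4)] by (simp add: scaled_taut_def)
qed

lemma free_le_pinned:
  assumes "T > 0" "r > 0" "\<omega> \<in> space M"
  shows "taut_length T r r \<omega> \<le> taut_length T r 0 \<omega>"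
proof -
  have "(taut_length T r r \<omega>)\<^sup>2 \<le> (taut_length T r 0 \<omega>)\<^sup>2"
  proof (rule LIMSEQ_le[OF free_limit[OF assms] pinned_limit[OF assms]])
    show "\<exists>N. \<forall>n\<ge>N. scaled_free n (r / sqrt T) (\<lambda>k. noise 0 (T / real n) k \<omega>)
        \<le> scaled_taut n (r / sqrt T) (\<lambda>k. noise 0 (T / real n) k \<omega>)"
      unfolding scaled_free_def scaled_taut_def using assms
      by (intro exI[of _ 0] allI impI mult_left_mono taut_mono_tube) auto
  qed
  then show ?thesis using assms by (simp add: taut_length_nonneg abs_le_square_iff[symmetric])
qed

lemma scaled_taut_noise_measurable [measurable]:
  assumes "\<epsilon> > 0" "s \<ge> 0" "h > 0"
  shows "(\<lambda>\<omega>. scaled_taut N \<epsilon> (\<lambda>k. noise s h k \<omega>)) \<in> borel_measurable M"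
  unfolding scaled_taut_def using assms
  by (intro borel_measurable_times borel_measurable_const borel_measurable_taut_compose noise_measurable) auto

lemma scaled_free_noise_measurable [measurable]:
  assumes "\<epsilon> > 0" "s \<ge> 0" "h > 0"
  shows "(\<lambda>\<omega>. scaled_free N \<epsilon> (\<lambda>k. noise s h k \<omega>)) \<in> borel_measurable M"
  unfolding scaled_free_def using assms
  by (intro borel_measurable_times borel_measurable_const borel_measurable_taut_compose noise_measurable) auto

lemma taut_length_measurable:
  assumes "T > 0" "r > 0"
  shows pinned_measurable [measurable]: "taut_length T r 0 \<in> borel_measurable M"
    and free_measurable [measurable]: "taut_length T r r \<in> borel_measurable M"
proof -
  have h: "0 < T / real (Suc n)" for n using assms by simp
  have \<epsilon>: "0 < r / sqrt T" using assms by simp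
  have eq: "sqrt ((taut_length T r \<rho> \<omega>)\<^sup>2) = taut_length T r \<rho> \<omega>" for \<rho> \<omega>
    using assms by (simp add: taut_length_nonneg)
  have "(\<lambda>\<omega>. (taut_length T r 0 \<omega>)\<^sup>2) \<in> borel_measurable M"
    by (rule borel_measurable_LIMSEQ_real[OF LIMSEQ_Suc[OF pinned_limit[OF assms]]])
      (use h \<epsilon> in \<open>auto intro!: scaled_taut_noise_measurable simp del: of_nat_Suc\<close>)
  then have "(\<lambda>\<omega>. sqrt ((taut_length T r 0 \<omega>)\<^sup>2)) \<in> borel_measurable M" by measurable
  then show "taut_length T r 0 \<in> borel_measurable M" by (simp only: eq)
  have "(\<lambda>\<omega>. (taut_length T r r \<omega>)\<^sup>2) \<in> borel_measurable M"
    by (rule borel_measurable_LIMSEQ_real[OF LIMSEQ_Suc[OF free_limit[OF assms]]])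
      (use h \<epsilon> in \<open>auto intro!: scaled_free_noise_measurable simp del: of_nat_Suc\<close>)
  then have "(\<lambda>\<omega>. sqrt ((taut_length T r r \<omega>)\<^sup>2)) \<in> borel_measurable M" by measurable
  then show "taut_length T r r \<in> borel_measurable M" by (simp only: eq)
qed

lemma nn_integral_scaled_taut_noise:
  assumes "\<epsilon> > 0" "s \<ge> 0" "h > 0" "N > 0" and f: "f \<in> borel_measurable borel"
  shows "(\<integral>\<^sup>+\<omega>. f (scaled_taut N \<epsilon> (\<lambda>k. noise s h k \<omega>)) \<partial>M) = (\<integral>\<^sup>+d. f (scaled_taut N \<epsilon> d) \<partial>std_normal_vector N)"
  unfolding scaled_taut_def
  using nn_integral_taut_noise[OF assms(2-4), of "\<epsilon> * sqrt (real N)" 0 "\<lambda>x. f (\<epsilon>\<^sup>2 * x)"] assms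
  by (simp add: measurable_compose[OF _ f])

lemma nn_integral_scaled_taut_noise_le:
  assumes "\<epsilon> > 0" "s \<ge> 0" "h > 0"
  shows "(\<integral>\<^sup>+\<omega>. ennreal (scaled_taut (2 ^ n) \<epsilon> (\<lambda>k. noise s h k \<omega>) ^ p) \<partial>M) \<le> taut_moment p \<epsilon>"
  unfolding taut_moment_def
  using nn_integral_scaled_taut_noise[OF assms, of "2 ^ n" "\<lambda>x. ennreal (x ^ p)"]
  by (intro SUP_upper2[of n]) auto

lemma nn_integral_pinned:
  assumes "T > 0" "r > 0"
  shows "(\<integral>\<^sup>+\<omega>. ennreal ((taut_length T r 0 \<omega>)\<^sup>2 ^ p) \<partial>M) = taut_moment p (r / sqrt T)"
proof (rule antisym)
  have \<epsilon>: "0 < r / sqrt T" using assms by simp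
  let ?X = "\<lambda>n \<omega>. scaled_taut (2 ^ n) (r / sqrt T) (\<lambda>k. noise 0 (T / real (2 ^ n)) k \<omega>)"
  show "(\<integral>\<^sup>+\<omega>. ennreal ((taut_length T r 0 \<omega>)\<^sup>2 ^ p) \<partial>M) \<le> taut_moment p (r / sqrt T)"
  proof (rule nn_integral_le_of_limit[where f = "\<lambda>n \<omega>. ?X n \<omega> ^ p"])
    show "(\<lambda>\<omega>. ?X n \<omega> ^ p) \<in> borel_measurable M" for n
      using assms \<epsilon> by (intro borel_measurable_power scaled_taut_noise_measurable) auto
    show "(\<integral>\<^sup>+\<omega>. ennreal (?X n \<omega> ^ p) \<partial>M) \<le> taut_moment p (r / sqrt T)" for n
      using assms \<epsilon> by (intro nn_integral_scaled_taut_noise_le) auto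
    show "(\<lambda>n. ?X n \<omega> ^ p) \<longlonglongrightarrow> (taut_length T r 0 \<omega>)\<^sup>2 ^ p" if "\<omega> \<in> space M" for \<omega>
      using LIMSEQ_subseq_LIMSEQ[OF pinned_limit[OF assms that], of "\<lambda>n. 2 ^ n"]
      by (intro tendsto_power) (auto simp: o_def strict_mono_def)
  qed
  show "taut_moment p (r / sqrt T) \<le> (\<integral>\<^sup>+\<omega>. ennreal ((taut_length T r 0 \<omega>)\<^sup>2 ^ p) \<partial>M)"
    unfolding taut_moment_def
  proof (rule SUP_least)
    fix n :: nat
    have "(\<integral>\<^sup>+d. ennreal (scaled_taut (2 ^ n) (r / sqrt T) d ^ p) \<partial>std_normal_vector (2 ^ n)) =
        (\<integral>\<^sup>+\<omega>. ennreal (?X n \<omega> ^ p) \<partial>M)"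
      using assms \<epsilon> nn_integral_scaled_taut_noise[of "r / sqrt T" 0 "T / real (2 ^ n)" "2 ^ n" "\<lambda>x. ennreal (x ^ p)"] by simp
    also have "\<dots> \<le> (\<integral>\<^sup>+\<omega>. ennreal ((taut_length T r 0 \<omega>)\<^sup>2 ^ p) \<partial>M)"
      using assms \<epsilon> by (intro nn_integral_mono ennreal_leI power_mono scaled_taut_le scaled_taut_nonneg) auto
    finally show "(\<integral>\<^sup>+d. ennreal (scaled_taut (2 ^ n) (r / sqrt T) d ^ p) \<partial>std_normal_vector (2 ^ n)) \<le>
      (\<integral>\<^sup>+\<omega>. ennreal ((taut_length T r 0 \<omega>)\<^sup>2 ^ p) \<partial>M)" .
  qed
qed

end

section \<open>Finiteness of the moments\<close>

lemma convex_on_nonneg_power: "convex_on {0::real..} (\<lambda>x. x ^ p)"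
  by (cases "even p") (auto intro: convex_power_odd convex_on_subset[OF convex_power_even])

lemma power_mean_le:
  fixes a x :: "'i \<Rightarrow> real"
  assumes I: "finite I" and a: "\<And>i. i \<in> I \<Longrightarrow> 0 \<le> a i" "(\<Sum>i\<in>I. a i) \<le> 1"
    and x: "\<And>i. i \<in> I \<Longrightarrow> 0 \<le> x i" and p: "p \<ge> 1"
  shows "(\<Sum>i\<in>I. a i * x i) ^ p \<le> (\<Sum>i\<in>I. a i * x i ^ p)"
proof -
  define s where "s = (\<Sum>i\<in>I. a i)"
  have s0: "0 \<le> s" unfolding s_def using a by (intro sum_nonneg) auto
  show ?thesis
  proof (cases "s = 0")
    case True
    then have "\<And>i. i \<in> I \<Longrightarrow> a i = 0" using I a sum_nonneg_eq_0_iff[of I a] by (auto simp: s_def)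
    then show ?thesis using p by (simp add: power_0_left)
  next
    case False
    then have s: "s > 0" using s0 by simp
    then have Ine: "I \<noteq> {}" by (auto simp: s_def)
    have "(\<Sum>i\<in>I. (a i / s) *\<^sub>R x i) ^ p \<le> (\<Sum>i\<in>I. (a i / s) * x i ^ p)"
    proof (rule convex_on_sum[OF I Ine convex_on_nonneg_power])
      show "(\<Sum>i\<in>I. a i / s) = 1" using s by (simp add: s_def flip: sum_divide_distrib)
    qed (use a x s in auto)
    also have "(\<Sum>i\<in>I. (a i / s) *\<^sub>R x i) = (\<Sum>i\<in>I. a i * x i) / s" by (simp add: sum_divide_distrib)
    also have "(\<Sum>i\<in>I. (a i / s) * x i ^ p) = (\<Sum>i\<in>I. a i * x i ^ p) / s" by (simp add: sum_divide_distrib)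
    finally have "(\<Sum>i\<in>I. a i * x i) ^ p / s ^ p \<le> (\<Sum>i\<in>I. a i * x i ^ p) / s" by (simp only: power_divide)
    then have "(\<Sum>i\<in>I. a i * x i) ^ p \<le> s ^ p / s * (\<Sum>i\<in>I. a i * x i ^ p)"
      using s by (simp add: field_simps)
    also have "s ^ p / s = s ^ (p - 1)" using s p by (cases p) auto
    also have "s ^ (p - 1) * (\<Sum>i\<in>I. a i * x i ^ p) \<le> 1 * (\<Sum>i\<in>I. a i * x i ^ p)"
      using a x s by (intro mult_right_mono power_le_one sum_nonneg) (auto simp: s_def)
    finally show ?thesis by simp
  qed
qed

text \<open>
  Starting from the chord of the path, \<open>n\<close> successive refinements, the one at level \<open>j\<close> with tolerance
  \<open>c j\<close>.
\<close>

lemma taut_dyadic_bound: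
  assumes g: "\<And>n k. g n k = g (Suc n) (2 * k) + g (Suc n) (Suc (2 * k))" and c: "\<And>j. 0 \<le> c j"
  shows "2 ^ n * taut (2 ^ n) (\<Sum>j<n. c j) 0 (g n) \<le>
    (g 0 0)\<^sup>2 + (\<Sum>j<n. 4 * 2 ^ j * (\<Sum>k<2 ^ Suc j. (max 0 (\<bar>g (Suc j) k\<bar> - c j))\<^sup>2))"
proof (induction n)
  case 0
  then show ?case using taut_one[of 0 "g 0"] by simp
next
  case (Suc n)
  let ?S = "\<Sum>k<2 ^ Suc n. (max 0 (\<bar>g (Suc n) k\<bar> - c n))\<^sup>2"
  let ?t = "taut (2 ^ n) (\<Sum>j<n. c j) 0 (g n)"
  have gn: "(\<lambda>k. g (Suc n) (2 * k) + g (Suc n) (Suc (2 * k))) = g n"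
    by (intro ext) (rule g[symmetric])
  have "taut (2 ^ Suc n) (\<Sum>j<Suc n. c j) 0 (g (Suc n)) \<le> ?t / 2 + 2 * ?S"
    unfolding power_Suc[of _ n] sum.lessThan_Suc[of _ n] gn[symmetric] using c by (intro taut_refine sum_nonneg)
  then have "2 ^ Suc n * taut (2 ^ Suc n) (\<Sum>j<Suc n. c j) 0 (g (Suc n)) \<le> 2 ^ Suc n * (?t / 2 + 2 * ?S)"
    by (rule mult_left_mono) simp
  also have "\<dots> = 2 ^ n * ?t + 4 * 2 ^ n * ?S"
    unfolding power_Suc[of "2 :: real" n] distrib_left by (simp only: mult.assoc)
  finally show ?case using Suc.IH unfolding sum.lessThan_Suc[of _ n] by linarith
qed

lemma excess_le_power:
  fixes x c :: real
  assumes "c > 0"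
  shows "(max 0 (\<bar>x\<bar> - c))\<^sup>2 \<le> x ^ 6 / c ^ 4"
proof (cases "\<bar>x\<bar> \<le> c")
  case True
  then show ?thesis using assms by (simp add: max_absorb1)
next
  case False
  have "(max 0 (\<bar>x\<bar> - c))\<^sup>2 \<le> \<bar>x\<bar>\<^sup>2" using False assms by (intro power_mono) auto
  also have "\<dots> = \<bar>x\<bar>\<^sup>2 * 1" by simp
  also have "\<dots> \<le> \<bar>x\<bar>\<^sup>2 * (\<bar>x\<bar> / c) ^ 4" using False assms by (intro mult_left_mono one_le_power) auto
  also have "\<dots> = \<bar>x\<bar> ^ 6 / c ^ 4" by (simp add: power_divide flip: power_add)
  also have "\<dots> = x ^ 6 / c ^ 4" by (simp add: power_even_abs)
  finally show ?thesis .
qed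

definition std_normal_moment :: "nat \<Rightarrow> real" where
  "std_normal_moment k = (\<integral>x. std_normal_density x * \<bar>x\<bar> ^ k \<partial>lborel)"

lemma nn_integral_std_normal_moment:
  "(\<integral>\<^sup>+x. ennreal (\<bar>x\<bar> ^ k) \<partial>std_normal) = ennreal (std_normal_moment k)"
proof -
  have i: "integrable lborel (\<lambda>x. std_normal_density x * \<bar>x\<bar> ^ k)"
    using integrable_normal_moment_abs[of 1 0 k] by simp
  have "(\<integral>\<^sup>+x. ennreal (\<bar>x\<bar> ^ k) \<partial>std_normal) = (\<integral>\<^sup>+x. ennreal (std_normal_density x) * ennreal (\<bar>x\<bar> ^ k) \<partial>lborel)"
    unfolding std_normal_def by (intro nn_integral_density) auto
  also have "\<dots> = (\<integral>\<^sup>+x. ennreal (std_normal_density x * \<bar>x\<bar> ^ k) \<partial>lborel)"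
    by (intro nn_integral_cong) (simp add: ennreal_mult)
  also have "\<dots> = ennreal (std_normal_moment k)"
    unfolding std_normal_moment_def by (intro nn_integral_eq_integral i) auto
  finally show ?thesis .
qed

lemma sum_le_geometric:
  fixes q :: real
  assumes "0 < q" "q < 1"
  shows "(\<Sum>j<n. q ^ j) \<le> 1 / (1 - q)"
proof -
  have "(\<Sum>j<n. q ^ j) = (1 - q ^ n) / (1 - q)"
    using assms sum_gp_strict[of q n] by simp
  also have "\<dots> \<le> 1 / (1 - q)" using assms by (intro divide_right_mono) auto
  finally show ?thesis .
qed

context wiener_process
begin

lemma nn_integral_noise:
  assumes "0 \<le> s" "0 < h" "f \<in> borel_measurable borel"
  shows "(\<integral>\<^sup>+\<omega>. f (noise s h k \<omega>) \<partial>M) = (\<integral>\<^sup>+x. f x \<partial>std_normal)"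
  unfolding distr_noise[OF assms(1,2), of k, symmetric]
  using assms by (intro nn_integral_distr[symmetric]) auto

lemma nn_integral_noise_moment:
  assumes "0 \<le> s" "0 < h"
  shows "(\<integral>\<^sup>+\<omega>. ennreal (\<bar>noise s h k \<omega>\<bar> ^ i) \<partial>M) = ennreal (std_normal_moment i)"
  using nn_integral_noise[OF assms, of "\<lambda>x. ennreal (\<bar>x\<bar> ^ i)" k] nn_integral_std_normal_moment by simp

text \<open>
  The tolerances \<open>c j = \<epsilon> / 8 * (7 / 8)^j\<close> add up to at most \<open>\<epsilon>\<close>. The ratio \<open>7 / 8\<close> exceeds \<open>1 / sqrt 2\<close>, the ratio of the
  standard deviations of the increments at successive levels, by so much that sixth powers suffice
  (\<open>excess_le_power\<close>): from one level to the next the factor of the energy doubles, so does the number of cells, the sixth power of an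
  increment shrinks by \<open>1 / 8\<close>, and dividing by \<open>c j ^ 4\<close> costs \<open>(8 / 7)^4\<close>. Hence level \<open>j\<close> contributes a multiple of \<open>q^j\<close> times an
  average of sixth powers of standard normal variables, with \<open>q = 2 * 2 * (1 / 8) * (8 / 7)^4 = 2048 / 2401 < 1\<close>.
\<close>

lemma scaled_taut_dyadic_bound:
  assumes "\<epsilon> > 0"
  defines "q \<equiv> 2048 / 2401 :: real"
  shows "scaled_taut (2 ^ n) \<epsilon> (\<lambda>k. noise 0 (1 / 2 ^ n) k \<omega>) \<le> \<epsilon>\<^sup>2 * (\<bar>noise 0 1 0 \<omega>\<bar>\<^sup>2 +
    (8 / \<epsilon>) ^ 4 * (\<Sum>j<n. \<Sum>k<2 ^ Suc j. q ^ j / 2 ^ Suc j * \<bar>noise 0 (1 / 2 ^ Suc j) k \<omega>\<bar> ^ 6))"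
proof -
  define g where "g n k = W (real (Suc k) / 2 ^ n) \<omega> - W (real k / 2 ^ n) \<omega>" for n k
  define c where "c j = \<epsilon> / 8 * (7 / 8) ^ j" for j :: nat
  have c: "c j > 0" for j using assms by (simp add: c_def)
  have csum: "(\<Sum>j<n. c j) \<le> \<epsilon>"
  proof -
    have "(\<Sum>j<n. c j) = \<epsilon> / 8 * (\<Sum>j<n. (7 / 8) ^ j)" by (simp add: c_def sum_distrib_left)
    also have "\<dots> \<le> \<epsilon> / 8 * (1 / (1 - 7 / 8))" using assms by (intro mult_left_mono sum_le_geometric) auto
    finally show ?thesis by simp
  qed
  have gn: "g n k = sqrt (1 / 2 ^ n) * noise 0 (1 / 2 ^ n) k \<omega>" for n k
    by (simp add: g_def noise_def field_simps)
  have g: "g n k = g (Suc n) (2 * k) + g (Suc n) (Suc (2 * k))" for n k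
  proof -
    have "real (Suc (Suc (2 * k))) / 2 ^ Suc n = real (Suc k) / 2 ^ n" "real (2 * k) / 2 ^ Suc n = real k / 2 ^ n"
      by (simp_all add: field_simps)
    then show ?thesis unfolding g_def by simp
  qed
  have "noise 0 (1 / 2 ^ n) k \<omega> = sqrt (2 ^ n) * g n k" for k
    unfolding gn by (simp add: real_sqrt_divide)
  then have "scaled_taut (2 ^ n) \<epsilon> (\<lambda>k. noise 0 (1 / 2 ^ n) k \<omega>) =
      \<epsilon>\<^sup>2 * taut (2 ^ n) (sqrt (2 ^ n) * \<epsilon>) (sqrt (2 ^ n) * 0) (\<lambda>k. sqrt (2 ^ n) * g n k)"
    by (simp add: scaled_taut_def mult.commute)
  also have "\<dots> = \<epsilon>\<^sup>2 * (2 ^ n * taut (2 ^ n) \<epsilon> 0 (g n))"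
    using assms by (subst taut_scale) auto
  also have "\<dots> \<le> \<epsilon>\<^sup>2 * (2 ^ n * taut (2 ^ n) (\<Sum>j<n. c j) 0 (g n))"
    using csum c assms by (intro mult_left_mono taut_mono_tube sum_nonneg) (auto intro: less_imp_le)
  also have "\<dots> \<le> \<epsilon>\<^sup>2 * ((g 0 0)\<^sup>2 + (\<Sum>j<n. 4 * 2 ^ j * (\<Sum>k<2 ^ Suc j. (max 0 (\<bar>g (Suc j) k\<bar> - c j))\<^sup>2)))"
    using c by (intro mult_left_mono taut_dyadic_bound[where g = g] g) (auto intro: less_imp_le)
  also have "\<dots> \<le> \<epsilon>\<^sup>2 * (\<bar>noise 0 1 0 \<omega>\<bar>\<^sup>2 + (\<Sum>j<n. (8 / \<epsilon>) ^ 4 * (\<Sum>k<2 ^ Suc j. q ^ j / 2 ^ Suc j * \<bar>noise 0 (1 / 2 ^ Suc j) k \<omega>\<bar> ^ 6)))"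
  proof (intro mult_left_mono add_mono sum_mono)
    show "(g 0 0)\<^sup>2 \<le> \<bar>noise 0 1 0 \<omega>\<bar>\<^sup>2" using gn[of 0 0] by simp
    fix j
    have "4 * 2 ^ j * (\<Sum>k<2 ^ Suc j. (max 0 (\<bar>g (Suc j) k\<bar> - c j))\<^sup>2) \<le>
        4 * 2 ^ j * (\<Sum>k<2 ^ Suc j. (g (Suc j) k) ^ 6 / c j ^ 4)"
      using c by (intro mult_left_mono sum_mono excess_le_power) auto
    also have "\<dots> = (\<Sum>k<2 ^ Suc j. (8 / \<epsilon>) ^ 4 * (q ^ j / 2 ^ Suc j * \<bar>noise 0 (1 / 2 ^ Suc j) k \<omega>\<bar> ^ 6))"
      unfolding sum_distrib_left
    proof (intro sum.cong refl)
      fix k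
      define x where "x = noise 0 (1 / 2 ^ Suc j) k \<omega>"
      have "sqrt v ^ 6 = v ^ 3" if "v \<ge> 0" for v :: real
      proof -
        have "sqrt v ^ 6 = (sqrt v ^ 2) ^ 3" by (simp flip: power_mult)
        then show ?thesis using that by simp
      qed
      from this[of "1 / 2 ^ Suc j"] have "sqrt (1 / 2 ^ Suc j) ^ 6 = (1 / 2 ^ Suc j) ^ 3" by (simp only: zero_le_divide_1_iff zero_le_power zero_le_numeral)
      then have 1: "(g (Suc j) k) ^ 6 = (1 / 2 ^ Suc j) ^ 3 * x ^ 6"
        unfolding gn x_def[symmetric] power_mult_distrib by (simp only:)
      have 2: "c j ^ 4 = (\<epsilon> / 8) ^ 4 * (2401 / 4096) ^ j"
      proof -
        have "((7 / 8 :: real) ^ j) ^ 4 = ((7 / 8) ^ 4) ^ j" by (simp only: power_mult[symmetric] mult.commute)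
        also have "(7 / 8 :: real) ^ 4 = 2401 / 4096" by (simp add: power_divide)
        finally show ?thesis unfolding c_def power_mult_distrib by (simp only:)
      qed
      have 3: "4 * 2 ^ j * (1 / 2 ^ Suc j) ^ 3 / (2401 / 4096) ^ j = q ^ j / 2 ^ Suc j"
      proof -
        define a where "a = (2 :: real) ^ j"
        define b where "b = (2401 :: real) ^ j"
        have ab: "a > 0" "b > 0" by (simp_all add: a_def b_def)
        have "(2048 :: real) ^ j = a ^ 11" "(4096 :: real) ^ j = a ^ 12"
          unfolding a_def power_mult[symmetric] by (simp_all add: mult.commute[of j] power_mult)
        then have e: "q ^ j = a ^ 11 / b" "(2401 / 4096 :: real) ^ j = b / a ^ 12"
          by (simp_all add: q_def power_divide b_def)
        have "4 * a * (1 / (2 * a)) ^ 3 / (b / a ^ 12) = a ^ 11 / b / (2 * a)"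
          using ab by (simp add: field_simps eval_nat_numeral)
        then show ?thesis unfolding e power_Suc a_def[symmetric] .
      qed
      have "4 * 2 ^ j * ((g (Suc j) k) ^ 6 / c j ^ 4) =
          (4 * 2 ^ j * (1 / 2 ^ Suc j) ^ 3 / (2401 / 4096) ^ j) * x ^ 6 * (8 / \<epsilon>) ^ 4"
        unfolding 1 2 using assms by (simp add: power_divide)
      also have "\<dots> = (8 / \<epsilon>) ^ 4 * (q ^ j / 2 ^ Suc j * \<bar>x\<bar> ^ 6)"
        unfolding 3 by (simp add: power_even_abs)
      finally show "4 * 2 ^ j * ((g (Suc j) k) ^ 6 / c j ^ 4) =
          (8 / \<epsilon>) ^ 4 * (q ^ j / 2 ^ Suc j * \<bar>noise 0 (1 / 2 ^ Suc j) k \<omega>\<bar> ^ 6)" by (simp add: x_def)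
    qed
    finally show "4 * 2 ^ j * (\<Sum>k<2 ^ Suc j. (max 0 (\<bar>g (Suc j) k\<bar> - c j))\<^sup>2) \<le>
      (8 / \<epsilon>) ^ 4 * (\<Sum>k<2 ^ Suc j. q ^ j / 2 ^ Suc j * \<bar>noise 0 (1 / 2 ^ Suc j) k \<omega>\<bar> ^ 6)"
      by (simp add: sum_distrib_left)
  qed simp
  finally show ?thesis by (simp add: sum_distrib_left)
qed

lemma taut_moment_finite:
  assumes \<epsilon>: "\<epsilon> > 0" and p: "p \<ge> 1"
  shows "taut_moment p \<epsilon> < \<infinity>"
proof -
  define q where "q = (2048 / 2401 :: real)"
  \<comment> \<open>Dividing by A turns the weights of the dyadic bound into weights of total mass at most 1,
    as required for the power mean inequality.\<close>
  define A where "A = 1 / (1 - q)"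
  have A: "A > 0" by (simp add: A_def q_def)
  define K where "K = (8 / \<epsilon>) ^ 4 * A"
  have K: "K > 0" using \<epsilon> A by (simp add: K_def)
  define I where "I n = Sigma {..<n} (\<lambda>j. {..<2 ^ Suc j :: nat})" for n :: nat
  define a where "a i = (case i of (j, k) \<Rightarrow> q ^ j / 2 ^ Suc j / A)" for i :: "nat \<times> nat"
  define X where "X i \<omega> = (case i of (j, k) \<Rightarrow> \<bar>noise 0 (1 / 2 ^ Suc j) k \<omega>\<bar>)" for i \<omega>
  have a0: "a i \<ge> 0" for i using A by (auto simp: a_def q_def split: prod.split)
  have asum: "(\<Sum>i\<in>I n. a i) \<le> 1" for n
  proof -
    have "(\<Sum>i\<in>I n. a i) = (\<Sum>j<n. \<Sum>k<2 ^ Suc j :: nat. q ^ j / 2 ^ Suc j / A)"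
      unfolding I_def a_def by (subst sum.Sigma) auto
    also have "\<dots> = (\<Sum>j<n. q ^ j) / A" by (simp add: sum_divide_distrib)
    also have "\<dots> \<le> A / A" using A sum_le_geometric[of q n] by (intro divide_right_mono) (auto simp: A_def q_def)
    finally show ?thesis using A by simp
  qed
  have X0: "X i \<omega> \<ge> 0" for i \<omega> by (auto simp: X_def split: prod.split)
  have Xm [measurable]: "X i \<in> borel_measurable M" for i
  proof -
    obtain j k where i: "i = (j, k)" by (cases i)
    have "(\<lambda>\<omega>. \<bar>noise 0 (1 / 2 ^ Suc j) k \<omega>\<bar>) \<in> borel_measurable M"
      by (intro borel_measurable_abs noise_measurable) auto
    then show ?thesis by (simp add: X_def[abs_def] i)
  qed
  have XE: "(\<integral>\<^sup>+\<omega>. ennreal (X i \<omega> ^ l) \<partial>M) = ennreal (std_normal_moment l)" for i l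
    using nn_integral_noise_moment[of 0 "1 / 2 ^ Suc (fst i)" "snd i" l] by (cases i) (simp add: X_def)
  define B where "B = ennreal (2 ^ p * (\<epsilon>\<^sup>2 ^ p)) * (ennreal (std_normal_moment (2 * p)) + ennreal (K ^ p) * ennreal (std_normal_moment (6 * p)))"
  have "(\<integral>\<^sup>+d. ennreal (scaled_taut (2 ^ n) \<epsilon> d ^ p) \<partial>std_normal_vector (2 ^ n)) \<le> B" for n
  proof -
    have bound: "scaled_taut (2 ^ n) \<epsilon> (\<lambda>k. noise 0 (1 / 2 ^ n) k \<omega>) ^ p \<le>
      2 ^ p * \<epsilon>\<^sup>2 ^ p * (\<bar>noise 0 1 0 \<omega>\<bar> ^ (2 * p) + K ^ p * (\<Sum>i\<in>I n. a i * X i \<omega> ^ (6 * p)))" for \<omega>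
    proof -
      let ?S = "\<Sum>i\<in>I n. a i * X i \<omega> ^ 6"
      have S0: "0 \<le> ?S" using a0 X0 by (intro sum_nonneg) auto
      have "(8 / \<epsilon>) ^ 4 * (\<Sum>j<n. \<Sum>k<2 ^ Suc j. q ^ j / 2 ^ Suc j * \<bar>noise 0 (1 / 2 ^ Suc j) k \<omega>\<bar> ^ 6) = K * ?S"
      proof -
        have "?S = (\<Sum>j<n. \<Sum>k<2 ^ Suc j. q ^ j / 2 ^ Suc j / A * \<bar>noise 0 (1 / 2 ^ Suc j) k \<omega>\<bar> ^ 6)"
          unfolding I_def by (subst sum.Sigma) (auto simp: a_def X_def intro!: sum.cong split: prod.split)
        also have "\<dots> = (\<Sum>j<n. \<Sum>k<2 ^ Suc j. q ^ j / 2 ^ Suc j * \<bar>noise 0 (1 / 2 ^ Suc j) k \<omega>\<bar> ^ 6) / A"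
          by (simp add: sum_divide_distrib)
        finally show ?thesis using A by (simp add: K_def)
      qed
      then have "scaled_taut (2 ^ n) \<epsilon> (\<lambda>k. noise 0 (1 / 2 ^ n) k \<omega>) \<le> \<epsilon>\<^sup>2 * (\<bar>noise 0 1 0 \<omega>\<bar>\<^sup>2 + K * ?S)"
        using scaled_taut_dyadic_bound[OF \<epsilon>, of n \<omega>] by (simp only: q_def)
      then have "scaled_taut (2 ^ n) \<epsilon> (\<lambda>k. noise 0 (1 / 2 ^ n) k \<omega>) ^ p \<le> (\<epsilon>\<^sup>2 * (\<bar>noise 0 1 0 \<omega>\<bar>\<^sup>2 + K * ?S)) ^ p"
        using \<epsilon> by (intro power_mono scaled_taut_nonneg) auto
      also have "\<dots> = \<epsilon>\<^sup>2 ^ p * (\<bar>noise 0 1 0 \<omega>\<bar>\<^sup>2 + K * ?S) ^ p" by (rule power_mult_distrib)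
      also have "(\<bar>noise 0 1 0 \<omega>\<bar>\<^sup>2 + K * ?S) ^ p \<le> 2 ^ p * ((\<bar>noise 0 1 0 \<omega>\<bar>\<^sup>2) ^ p + (K * ?S) ^ p)"
      proof -
        have two: "(x + y) ^ p \<le> 2 ^ p * (x ^ p + y ^ p)" if "0 \<le> x" "0 \<le> y" for x y :: real
        proof -
          have "(x + y) ^ p \<le> (2 * max x y) ^ p" using that by (intro power_mono) auto
          also have "\<dots> = 2 ^ p * (max x y) ^ p" by (rule power_mult_distrib)
          also have "(max x y) ^ p \<le> x ^ p + y ^ p" using that by (auto simp: max_def)
          finally show ?thesis by simp
        qed
        show ?thesis using S0 K by (intro two) auto
      qed
      also have "(K * ?S) ^ p = K ^ p * ?S ^ p" by (rule power_mult_distrib)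
      also have "?S ^ p \<le> (\<Sum>i\<in>I n. a i * (X i \<omega> ^ 6) ^ p)"
        using a0 asum X0 p by (intro power_mean_le) (auto simp: I_def)
      finally show ?thesis using K \<epsilon> by (simp add: power_mult mult.assoc mult.left_commute[of "2 ^ p"])
    qed
    have "(\<integral>\<^sup>+d. ennreal (scaled_taut (2 ^ n) \<epsilon> d ^ p) \<partial>std_normal_vector (2 ^ n)) =
        (\<integral>\<^sup>+\<omega>. ennreal (scaled_taut (2 ^ n) \<epsilon> (\<lambda>k. noise 0 (1 / 2 ^ n) k \<omega>) ^ p) \<partial>M)"
      using \<epsilon> nn_integral_scaled_taut_noise[of \<epsilon> 0 "1 / 2 ^ n" "2 ^ n" "\<lambda>x. ennreal (x ^ p)"] by simp
    also have "\<dots> \<le> (\<integral>\<^sup>+\<omega>. ennreal (2 ^ p * \<epsilon>\<^sup>2 ^ p) * (ennreal (\<bar>noise 0 1 0 \<omega>\<bar> ^ (2 * p)) +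
        ennreal (K ^ p) * (\<Sum>i\<in>I n. ennreal (a i) * ennreal (X i \<omega> ^ (6 * p)))) \<partial>M)"
    proof (rule nn_integral_mono)
      fix \<omega>
      let ?S = "\<Sum>i\<in>I n. a i * X i \<omega> ^ (6 * p)"
      have S: "(\<Sum>i\<in>I n. ennreal (a i) * ennreal (X i \<omega> ^ (6 * p))) = ennreal ?S"
        using a0 X0 by (subst sum_ennreal[symmetric]) (auto simp: ennreal_mult)
      have S0: "0 \<le> ?S" using a0 X0 by (intro sum_nonneg) auto
      have mult: "ennreal (x * y) = ennreal x * ennreal y" if "0 \<le> x" "0 \<le> y" for x y
        using that by (rule ennreal_mult)
      have "ennreal (2 ^ p * \<epsilon>\<^sup>2 ^ p * (\<bar>noise 0 1 0 \<omega>\<bar> ^ (2 * p) + K ^ p * ?S)) =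
        ennreal (2 ^ p * \<epsilon>\<^sup>2 ^ p) * ennreal (\<bar>noise 0 1 0 \<omega>\<bar> ^ (2 * p) + K ^ p * ?S)"
        using K S0 by (intro mult) auto
      also have "ennreal (\<bar>noise 0 1 0 \<omega>\<bar> ^ (2 * p) + K ^ p * ?S) =
          ennreal (\<bar>noise 0 1 0 \<omega>\<bar> ^ (2 * p)) + ennreal (K ^ p * ?S)"
        using K S0 by (intro ennreal_plus) auto
      also have "ennreal (K ^ p * ?S) = ennreal (K ^ p) * ennreal ?S" using K S0 by (intro mult) auto
      finally have "ennreal (2 ^ p * \<epsilon>\<^sup>2 ^ p * (\<bar>noise 0 1 0 \<omega>\<bar> ^ (2 * p) + K ^ p * ?S)) =
        ennreal (2 ^ p * \<epsilon>\<^sup>2 ^ p) * (ennreal (\<bar>noise 0 1 0 \<omega>\<bar> ^ (2 * p)) +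
        ennreal (K ^ p) * (\<Sum>i\<in>I n. ennreal (a i) * ennreal (X i \<omega> ^ (6 * p))))" unfolding S .
      then show "ennreal (scaled_taut (2 ^ n) \<epsilon> (\<lambda>k. noise 0 (1 / 2 ^ n) k \<omega>) ^ p) \<le>
        ennreal (2 ^ p * \<epsilon>\<^sup>2 ^ p) * (ennreal (\<bar>noise 0 1 0 \<omega>\<bar> ^ (2 * p)) +
        ennreal (K ^ p) * (\<Sum>i\<in>I n. ennreal (a i) * ennreal (X i \<omega> ^ (6 * p))))"
        using ennreal_leI[OF bound[of \<omega>]] by (simp only:)
    qed
    also have "\<dots> = ennreal (2 ^ p * \<epsilon>\<^sup>2 ^ p) * (ennreal (std_normal_moment (2 * p)) +
        ennreal (K ^ p) * (\<Sum>i\<in>I n. ennreal (a i) * ennreal (std_normal_moment (6 * p))))"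
    proof -
      have [measurable]: "noise 0 1 0 \<in> borel_measurable M" by (rule noise_measurable) auto
      have "(\<integral>\<^sup>+\<omega>. (\<Sum>i\<in>I n. ennreal (a i) * ennreal (X i \<omega> ^ (6 * p))) \<partial>M) =
          (\<Sum>i\<in>I n. ennreal (a i) * ennreal (std_normal_moment (6 * p)))"
        by (subst nn_integral_sum) (auto simp: nn_integral_cmult XE)
      moreover have "(\<integral>\<^sup>+\<omega>. ennreal (\<bar>noise 0 1 0 \<omega>\<bar> ^ (2 * p)) \<partial>M) = ennreal (std_normal_moment (2 * p))"
        by (rule nn_integral_noise_moment) auto
      ultimately show ?thesis by (simp add: nn_integral_cmult nn_integral_add)
    qed
    also have "(\<Sum>i\<in>I n. ennreal (a i) * ennreal (std_normal_moment (6 * p))) =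
        ennreal (\<Sum>i\<in>I n. a i) * ennreal (std_normal_moment (6 * p))"
      using a0 by (simp add: sum_distrib_right[symmetric] sum_ennreal)
    also have "\<dots> \<le> 1 * ennreal (std_normal_moment (6 * p))"
      using asum by (intro mult_right_mono) auto
    finally show ?thesis by (simp add: B_def mult_left_mono add_left_mono)
  qed
  then have "taut_moment p \<epsilon> \<le> B" unfolding taut_moment_def by (rule SUP_least)
  also have "B < \<infinity>" by (simp add: B_def ennreal_mult_less_top)
  finally show ?thesis .
qed

end

section \<open>Blocks of the Wiener process\<close>

lemma (in prob_space) nn_integral_affine_le:
  fixes f g :: "'a \<Rightarrow> real"
  assumes [measurable]: "g \<in> borel_measurable M" and g: "\<And>\<omega>. 0 \<le> g \<omega>"
    "(\<integral>\<^sup>+\<omega>. ennreal (g \<omega>) \<partial>M) \<le> ennreal B" "0 \<le> B"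
    and ab: "0 \<le> a" "0 \<le> b" and le: "\<And>\<omega>. \<omega> \<in> space M \<Longrightarrow> f \<omega> \<le> a + b * g \<omega>"
  shows "(\<integral>\<^sup>+\<omega>. ennreal (f \<omega>) \<partial>M) \<le> ennreal (a + b * B)"
proof -
  have affine: "ennreal (a + b * x) = ennreal a + ennreal b * ennreal x" if "0 \<le> x" for x
    using ab that by (simp add: ennreal_plus ennreal_mult)
  have "(\<integral>\<^sup>+\<omega>. ennreal (f \<omega>) \<partial>M) \<le> (\<integral>\<^sup>+\<omega>. ennreal a + ennreal b * ennreal (g \<omega>) \<partial>M)"
    using le g(1) by (intro nn_integral_mono) (simp add: affine[symmetric] ennreal_leI)
  also have "\<dots> = ennreal a + ennreal b * (\<integral>\<^sup>+\<omega>. ennreal (g \<omega>) \<partial>M)"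
    by (simp add: nn_integral_add nn_integral_cmult emeasure_space_1)
  also have "\<dots> \<le> ennreal a + ennreal b * ennreal B" using g(2) by (intro add_left_mono mult_left_mono) auto
  finally show ?thesis using affine[OF g(3)] by simp
qed

lemma (in prob_space) nn_integral_affine2_le:
  fixes f g h :: "'a \<Rightarrow> real"
  assumes [measurable]: "g \<in> borel_measurable M" "h \<in> borel_measurable M"
    and g: "\<And>\<omega>. 0 \<le> g \<omega>" "(\<integral>\<^sup>+\<omega>. ennreal (g \<omega>) \<partial>M) \<le> ennreal B" "0 \<le> B"
    and h: "\<And>\<omega>. 0 \<le> h \<omega>" "(\<integral>\<^sup>+\<omega>. ennreal (h \<omega>) \<partial>M) \<le> ennreal D" "0 \<le> D"
    and abc: "0 \<le> a" "0 \<le> b" "0 \<le> c" and le: "\<And>\<omega>. \<omega> \<in> space M \<Longrightarrow> f \<omega> \<le> a + b * g \<omega> + c * h \<omega>"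
  shows "(\<integral>\<^sup>+\<omega>. ennreal (f \<omega>) \<partial>M) \<le> ennreal (a + b * B + c * D)"
proof -
  have "(\<integral>\<^sup>+\<omega>. ennreal (b * g \<omega> + c * h \<omega>) \<partial>M) = ennreal b * (\<integral>\<^sup>+\<omega>. ennreal (g \<omega>) \<partial>M) + ennreal c * (\<integral>\<^sup>+\<omega>. ennreal (h \<omega>) \<partial>M)"
    using g(1) h(1) abc by (simp add: ennreal_plus ennreal_mult nn_integral_add nn_integral_cmult)
  also have "\<dots> \<le> ennreal b * ennreal B + ennreal c * ennreal D"
    using g h by (intro add_mono mult_left_mono) auto
  also have "\<dots> = ennreal (b * B + c * D)" using g h abc by (simp add: ennreal_plus ennreal_mult)
  finally have bc: "(\<integral>\<^sup>+\<omega>. ennreal (b * g \<omega> + c * h \<omega>) \<partial>M) \<le> ennreal (b * B + c * D)" .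
  have "(\<integral>\<^sup>+\<omega>. ennreal (f \<omega>) \<partial>M) \<le> ennreal (a + 1 * (b * B + c * D))"
    by (rule nn_integral_affine_le[OF _ _ bc]) (use g h abc le in \<open>auto simp: add.assoc\<close>)
  then show ?thesis by (simp add: add.assoc)
qed

text \<open>
  The weak law of large numbers in mean: the variance of the average is at most \<open>s / m\<close>.
\<close>

lemma (in prob_space) average_deviation_le:
  fixes X :: "nat \<Rightarrow> 'a \<Rightarrow> real"
  assumes m: "m > 0" and indep: "indep_vars (\<lambda>_. borel) X {..<m}"
    and X2: "\<And>j. j < m \<Longrightarrow> integrable M (\<lambda>\<omega>. (X j \<omega>)\<^sup>2)"
    and mean: "\<And>j. j < m \<Longrightarrow> expectation (X j) = \<mu>"
    and s: "\<And>j. j < m \<Longrightarrow> expectation (\<lambda>\<omega>. (X j \<omega>)\<^sup>2) \<le> s"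
  shows "(\<integral>\<^sup>+\<omega>. ennreal \<bar>(\<Sum>j<m. X j \<omega>) / real m - \<mu>\<bar> \<partial>M) \<le> ennreal (sqrt (s / real m))"
proof -
  have Xm [measurable]: "X j \<in> borel_measurable M" if "j < m" for j
    using indep that by (auto simp: indep_vars_def)
  have X1: "integrable M (X j)" if "j < m" for j
    using square_integrable_imp_integrable[OF Xm X2] that by blast
  define Z where "Z = (\<lambda>j \<omega>. X j \<omega> - \<mu>)"
  have Z_indep: "indep_vars (\<lambda>_. borel) Z {..<m}"
    unfolding Z_def by (rule indep_vars_compose2[OF indep]) auto
  have Zm [measurable]: "Z j \<in> borel_measurable M" if "j < m" for j
    using that unfolding Z_def by measurable
  have Z1: "integrable M (Z j)" "expectation (Z j) = 0" if "j < m" for j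
    using X1[OF that] mean[OF that] by (auto simp: Z_def prob_space)
  have Zsq: "(Z j \<omega>)\<^sup>2 = (X j \<omega>)\<^sup>2 - 2 * \<mu> * X j \<omega> + \<mu>\<^sup>2" for j \<omega>
    by (simp add: Z_def power2_eq_square algebra_simps)
  have Z2: "integrable M (\<lambda>\<omega>. (Z j \<omega>)\<^sup>2)" "expectation (\<lambda>\<omega>. (Z j \<omega>)\<^sup>2) \<le> s" if "j < m" for j
  proof -
    show "integrable M (\<lambda>\<omega>. (Z j \<omega>)\<^sup>2)" unfolding Zsq using X1[OF that] X2[OF that] by auto
    have "expectation (\<lambda>\<omega>. (Z j \<omega>)\<^sup>2) = expectation (\<lambda>\<omega>. (X j \<omega>)\<^sup>2) - \<mu>\<^sup>2"
      unfolding Zsq using X1[OF that] X2[OF that] mean[OF that] by (simp add: prob_space power2_eq_square)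
    then show "expectation (\<lambda>\<omega>. (Z j \<omega>)\<^sup>2) \<le> s" using s[OF that] zero_le_power2[of \<mu>] by linarith
  qed
  have ZZ: "integrable M (\<lambda>\<omega>. Z i \<omega> * Z j \<omega>) \<and> expectation (\<lambda>\<omega>. Z i \<omega> * Z j \<omega>) = 0"
    if ij: "i < m" "j < m" "i \<noteq> j" for i j
  proof -
    have ind: "indep_vars (\<lambda>_. borel) Z {i, j}"
      using ij by (intro indep_vars_subset[OF Z_indep]) auto
    have "expectation (\<lambda>\<omega>. \<Prod>k\<in>{i, j}. Z k \<omega>) = (\<Prod>k\<in>{i, j}. expectation (Z k))"
      by (rule indep_vars_lebesgue_integral[OF _ ind]) (use Z1 ij in auto)
    moreover have "integrable M (\<lambda>\<omega>. \<Prod>k\<in>{i, j}. Z k \<omega>)"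
      by (rule indep_vars_integrable[OF _ ind]) (use Z1 ij in auto)
    ultimately show ?thesis using ij Z1 by simp
  qed
  have int: "integrable M (\<lambda>\<omega>. Z i \<omega> * Z j \<omega>)" if "i < m" "j < m" for i j
    using ZZ[OF that] Z2(1)[OF that(1)] by (cases "i = j") (auto simp: power2_eq_square)
  define S where "S \<omega> = (\<Sum>j<m. Z j \<omega>)" for \<omega>
  have S2: "(S \<omega>)\<^sup>2 = (\<Sum>i<m. \<Sum>j<m. Z i \<omega> * Z j \<omega>)" for \<omega>
    by (simp add: S_def power2_eq_square sum_product)
  have S2i: "integrable M (\<lambda>\<omega>. (S \<omega>)\<^sup>2)" unfolding S2 by (intro Bochner_Integration.integrable_sum int) auto
  have Sm [measurable]: "S \<in> borel_measurable M" unfolding S_def by measurable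
  have Si: "integrable M S" using square_integrable_imp_integrable[OF Sm S2i] .
  have "expectation (\<lambda>\<omega>. (S \<omega>)\<^sup>2) = (\<Sum>i<m. \<Sum>j<m. expectation (\<lambda>\<omega>. Z i \<omega> * Z j \<omega>))"
    unfolding S2 using int
    by (subst Bochner_Integration.integral_sum)
      (auto intro!: sum.cong Bochner_Integration.integral_sum Bochner_Integration.integrable_sum)
  also have "\<dots> = (\<Sum>i<m. expectation (\<lambda>\<omega>. (Z i \<omega>)\<^sup>2))"
  proof (intro sum.cong refl)
    fix i assume i: "i \<in> {..<m}"
    have "(\<Sum>j<m. expectation (\<lambda>\<omega>. Z i \<omega> * Z j \<omega>)) = (\<Sum>j\<in>{i}. expectation (\<lambda>\<omega>. Z i \<omega> * Z j \<omega>))"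
      using i ZZ by (intro sum.mono_neutral_right) auto
    then show "(\<Sum>j<m. expectation (\<lambda>\<omega>. Z i \<omega> * Z j \<omega>)) = expectation (\<lambda>\<omega>. (Z i \<omega>)\<^sup>2)"
      by (simp add: power2_eq_square)
  qed
  also have "\<dots> \<le> real m * s" using sum_mono[of "{..<m}" "\<lambda>i. expectation (\<lambda>\<omega>. (Z i \<omega>)\<^sup>2)" "\<lambda>_. s"] Z2(2) by simp
  finally have ES2: "expectation (\<lambda>\<omega>. (S \<omega>)\<^sup>2) \<le> real m * s" .
  have "(expectation (\<lambda>\<omega>. \<bar>S \<omega>\<bar>))\<^sup>2 \<le> expectation (\<lambda>\<omega>. (S \<omega>)\<^sup>2)"
    using variance_positive[of "\<lambda>\<omega>. \<bar>S \<omega>\<bar>"] variance_eq[of "\<lambda>\<omega>. \<bar>S \<omega>\<bar>"] Si S2i by simp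
  then have "(expectation (\<lambda>\<omega>. \<bar>S \<omega>\<bar>))\<^sup>2 \<le> real m * s" using ES2 by linarith
  then have ES: "expectation (\<lambda>\<omega>. \<bar>S \<omega>\<bar>) \<le> sqrt (real m * s)" by (rule real_le_rsqrt)
  have eq: "\<bar>(\<Sum>j<m. X j \<omega>) / real m - \<mu>\<bar> = \<bar>S \<omega>\<bar> / real m" for \<omega>
  proof -
    have "S \<omega> = (\<Sum>j<m. X j \<omega>) - real m * \<mu>" by (simp add: S_def Z_def sum_subtractf)
    then have "(\<Sum>j<m. X j \<omega>) / real m - \<mu> = S \<omega> / real m" using m by (simp add: field_simps)
    then show ?thesis by (simp add: abs_divide)
  qed
  have "(\<integral>\<^sup>+\<omega>. ennreal \<bar>(\<Sum>j<m. X j \<omega>) / real m - \<mu>\<bar> \<partial>M) = ennreal (expectation (\<lambda>\<omega>. \<bar>S \<omega>\<bar> / real m))"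
    unfolding eq using Si by (intro nn_integral_eq_integral) auto
  also have "\<dots> \<le> ennreal (sqrt (real m * s) / real m)"
    using ES m by (intro ennreal_leI) (simp add: divide_right_mono)
  also have "sqrt (real m * s) / real m = sqrt (s / real m)"
    using m by (simp add: real_sqrt_mult real_sqrt_divide field_simps)
  finally show ?thesis .
qed

lemma sum_squares_two: "(x + y)\<^sup>2 \<le> 2 * x\<^sup>2 + 2 * y\<^sup>2" for x y :: real
  using zero_le_power2[of "x - y"] by (simp add: power2_eq_square algebra_simps)

lemma scaled_taut_blocks:
  assumes "\<epsilon> > 0" "m > 0" "n > 0"
  shows "scaled_taut (m * n) \<epsilon> d \<le>
    (\<Sum>j<m. scaled_taut n (\<epsilon> * sqrt (real m)) (\<lambda>k. d (j * n + k))) / real m"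
proof -
  have "scaled_taut (m * n) \<epsilon> d \<le> \<epsilon>\<^sup>2 * (\<Sum>j<m. taut n (\<epsilon> * sqrt (real (m * n))) 0 (\<lambda>k. d (j * n + k)))"
    unfolding scaled_taut_def using assms by (intro mult_left_mono taut_blocks) auto
  also have "\<dots> = (\<Sum>j<m. scaled_taut n (\<epsilon> * sqrt (real m)) (\<lambda>k. d (j * n + k))) / real m"
    using assms by (simp add: scaled_taut_def sum_distrib_left sum_divide_distrib real_sqrt_mult power_mult_distrib mult_ac)
  finally show ?thesis .
qed

lemma sqrt_scaled_taut_le_free:
  assumes "\<epsilon> > 0" "m > 0" "n > 0"
  shows "sqrt (scaled_taut (m * n) \<epsilon> d) \<le> sqrt (scaled_free (m * n) \<epsilon> d) +
    sqrt (scaled_taut n (\<epsilon> * sqrt (real m)) (\<lambda>k. d ((m - 1) * n + k)) / real m) + 2 * \<epsilon>\<^sup>2 * sqrt (real m)"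
proof -
  define r where "r = \<epsilon> * sqrt (real (m * n))"
  have mn: "(m - 1) * n + n = m * n" using assms by (cases m) auto
  have sq: "sqrt (\<epsilon>\<^sup>2 * x) = \<epsilon> * sqrt x" for x using assms by (simp add: real_sqrt_mult)
  have r: "0 \<le> r" using assms by (simp add: r_def)
  have "\<epsilon> * sqrt (taut (m * n) r 0 d) \<le> \<epsilon> * (sqrt (taut (m * n) r r d) +
      sqrt (taut n r 0 (\<lambda>k. d ((m - 1) * n + k))) + 2 * r / sqrt (real n))"
    using taut_pinned_le_free[OF r assms(3), of "(m - 1) * n" d] assms unfolding mn by (intro mult_left_mono) auto
  also have "\<dots> = \<epsilon> * sqrt (taut (m * n) r r d) + \<epsilon> * sqrt (taut n r 0 (\<lambda>k. d ((m - 1) * n + k))) +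
      \<epsilon> * (2 * r / sqrt (real n))" by (simp add: distrib_left)
  also have "\<epsilon> * (2 * r / sqrt (real n)) = 2 * \<epsilon>\<^sup>2 * sqrt (real m)"
    using assms by (simp add: r_def real_sqrt_mult power2_eq_square)
  also have "\<epsilon> * sqrt (taut n r 0 (\<lambda>k. d ((m - 1) * n + k))) =
      sqrt (scaled_taut n (\<epsilon> * sqrt (real m)) (\<lambda>k. d ((m - 1) * n + k)) / real m)"
    using assms unfolding sq[symmetric] by (simp add: scaled_taut_def r_def real_sqrt_mult power_mult_distrib mult_ac)
  finally show ?thesis unfolding scaled_taut_def scaled_free_def sq r_def[symmetric] .
qed

definition excess_constant :: ennreal where
  "excess_constant = (\<integral>\<^sup>+x. ennreal ((max 0 (\<bar>x\<bar> - 3))\<^sup>2) \<partial>std_normal)"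

lemma excess_constant_pos: "excess_constant > 0"
proof (rule ccontr)
  assume "\<not> excess_constant > 0"
  then have "(\<integral>\<^sup>+x. ennreal ((max 0 (\<bar>x\<bar> - 3))\<^sup>2) \<partial>std_normal) = 0"
    by (simp add: excess_constant_def)
  then have "AE x in std_normal. ennreal ((max 0 (\<bar>x\<bar> - 3))\<^sup>2) = 0"
    by (subst (asm) nn_integral_0_iff_AE) (auto simp: std_normal_def)
  then have "AE x in lborel. (max 0 (\<bar>x\<bar> - 3 :: real))\<^sup>2 = 0"
    unfolding std_normal_def by (subst (asm) AE_density) (auto simp: normal_density_pos)
  then have "AE x in lborel. \<bar>x :: real\<bar> \<le> 3" by eventually_elim (auto simp: max_def split: if_splits)
  then have "AE x in lborel. x \<notin> {4..5::real}" by eventually_elim auto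
  then have "{4..5::real} \<in> null_sets lborel" by (subst AE_iff_null_sets) auto
  then show False by (simp add: null_sets_def)
qed

context wiener_process
begin

text \<open>
  Choose the level \<open>n\<close> such that \<open>1 \<le> \<epsilon>^2 * 2^n < 2\<close>, or \<open>n = 0\<close> if \<open>\<epsilon> \<ge> 1\<close>. In the first case the
  tube absorbs at most \<open>2 * sqrt 2 < 3\<close> standard deviations of the increment over a cell; in the second the
  string is pinned at both ends of the only cell.
\<close>

lemma excess_constant_le_moment:
  assumes \<epsilon>: "\<epsilon> > 0"
  shows "excess_constant \<le> taut_moment 1 \<epsilon>"
proof -
  define n where "n = (LEAST n. 1 \<le> \<epsilon>\<^sup>2 * 2 ^ n)"
  have "\<exists>n. 1 \<le> \<epsilon>\<^sup>2 * 2 ^ n"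
  proof -
    obtain n where "1 / \<epsilon>\<^sup>2 < 2 ^ n" using real_arch_pow[of 2 "1 / \<epsilon>\<^sup>2"] by auto
    then show ?thesis using \<epsilon> by (intro exI[of _ n]) (simp add: field_simps)
  qed
  then have n1: "1 \<le> \<epsilon>\<^sup>2 * 2 ^ n" unfolding n_def by (rule LeastI_ex)
  have n0: "n = 0 \<or> \<epsilon>\<^sup>2 * 2 ^ n < 2"
  proof (cases n)
    case (Suc k)
    then have "\<not> 1 \<le> \<epsilon>\<^sup>2 * 2 ^ k" using not_less_Least[of k "\<lambda>n. 1 \<le> \<epsilon>\<^sup>2 * 2 ^ n"] by (simp add: n_def)
    then show ?thesis using Suc by simp
  qed simp
  define h where "h = (1 / 2 ^ n :: real)"
  have h: "h > 0" by (simp add: h_def)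
  have low: "\<epsilon>\<^sup>2 * (\<Sum>k<2 ^ n. (max 0 (\<bar>d k\<bar> - 3))\<^sup>2) \<le> scaled_taut (2 ^ n) \<epsilon> d" for d
    unfolding scaled_taut_def
  proof (intro mult_left_mono)
    show "(\<Sum>k<2 ^ n. (max 0 (\<bar>d k\<bar> - 3))\<^sup>2) \<le> taut (2 ^ n) (\<epsilon> * sqrt (real (2 ^ n))) 0 d"
    proof (cases "n = 0")
      case True
      have "(max 0 (\<bar>d 0\<bar> - 3))\<^sup>2 \<le> \<bar>d 0\<bar>\<^sup>2" by (intro power_mono) auto
      then show ?thesis using True taut_one[of "\<epsilon> * sqrt (real (2 ^ n))" d] \<epsilon> by simp
    next
      case False
      have "(\<epsilon> * sqrt (real (2 ^ n)))\<^sup>2 = \<epsilon>\<^sup>2 * 2 ^ n" by (simp add: power_mult_distrib)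
      also have "\<dots> \<le> (3 / 2)\<^sup>2" using n0 False by (simp add: power2_eq_square)
      finally have "(\<epsilon> * sqrt (real (2 ^ n)))\<^sup>2 \<le> (3 / 2)\<^sup>2" .
      then have "\<epsilon> * sqrt (real (2 ^ n)) \<le> 3 / 2" by (rule power2_le_imp_le) simp
      then have "(\<Sum>k<2 ^ n. (max 0 (\<bar>d k\<bar> - 3))\<^sup>2) \<le> (\<Sum>k<2 ^ n. (max 0 (\<bar>d k\<bar> - 2 * (\<epsilon> * sqrt (real (2 ^ n)))))\<^sup>2)"
        by (intro sum_mono power_mono) auto
      also have "\<dots> \<le> taut (2 ^ n) (\<epsilon> * sqrt (real (2 ^ n))) 0 d"
        using \<epsilon> by (intro taut_lower_bound) auto
      finally show ?thesis .
    qed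
  qed auto
  have meas: "(\<lambda>\<omega>. ennreal ((max 0 (\<bar>noise 0 h k \<omega>\<bar> - 3))\<^sup>2)) \<in> borel_measurable M" for k
    using noise_measurable[of 0 h k] h by simp
  have E: "(\<integral>\<^sup>+\<omega>. ennreal ((max 0 (\<bar>noise 0 h k \<omega>\<bar> - 3))\<^sup>2) \<partial>M) = excess_constant" for k
    unfolding excess_constant_def using h
    by (intro nn_integral_noise[of 0 h "\<lambda>x. ennreal ((max 0 (\<bar>x\<bar> - 3))\<^sup>2)"]) auto
  have "excess_constant = 1 * excess_constant" by simp
  also have "\<dots> \<le> ennreal (\<epsilon>\<^sup>2 * 2 ^ n) * excess_constant" using n1 by (intro mult_right_mono) auto
  also have "\<dots> = ennreal (\<epsilon>\<^sup>2) * (\<Sum>k<(2 ^ n :: nat). excess_constant)"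
    by (simp add: ennreal_mult mult.assoc ennreal_of_nat_eq_real_of_nat)
  also have "\<dots> = (\<integral>\<^sup>+\<omega>. ennreal (\<epsilon>\<^sup>2) * (\<Sum>k<(2 ^ n :: nat). ennreal ((max 0 (\<bar>noise 0 h k \<omega>\<bar> - 3))\<^sup>2)) \<partial>M)"
  proof -
    have "(\<integral>\<^sup>+\<omega>. (\<Sum>k<(2 ^ n :: nat). ennreal ((max 0 (\<bar>noise 0 h k \<omega>\<bar> - 3))\<^sup>2)) \<partial>M) = (\<Sum>k<(2 ^ n :: nat). excess_constant)"
      by (subst nn_integral_sum[OF meas]) (simp only: E)
    then show ?thesis by (subst nn_integral_cmult[OF borel_measurable_sum[OF meas]]) (simp only:)
  qed
  also have "\<dots> \<le> (\<integral>\<^sup>+\<omega>. ennreal (scaled_taut (2 ^ n) \<epsilon> (\<lambda>k. noise 0 h k \<omega>) ^ 1) \<partial>M)"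
  proof (rule nn_integral_mono)
    fix \<omega>
    have "ennreal (\<epsilon>\<^sup>2) * (\<Sum>k<(2 ^ n :: nat). ennreal ((max 0 (\<bar>noise 0 h k \<omega>\<bar> - 3))\<^sup>2)) =
        ennreal (\<epsilon>\<^sup>2 * (\<Sum>k<2 ^ n. (max 0 (\<bar>noise 0 h k \<omega>\<bar> - 3))\<^sup>2))"
      by (simp add: ennreal_mult sum_nonneg sum_ennreal)
    also have "\<dots> \<le> ennreal (scaled_taut (2 ^ n) \<epsilon> (\<lambda>k. noise 0 h k \<omega>) ^ 1)"
      using low[of "\<lambda>k. noise 0 h k \<omega>"] by (intro ennreal_leI) simp
    finally show "ennreal (\<epsilon>\<^sup>2) * (\<Sum>k<(2 ^ n :: nat). ennreal ((max 0 (\<bar>noise 0 h k \<omega>\<bar> - 3))\<^sup>2)) \<le>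
        ennreal (scaled_taut (2 ^ n) \<epsilon> (\<lambda>k. noise 0 h k \<omega>) ^ 1)" .
  qed
  also have "\<dots> \<le> taut_moment 1 \<epsilon>" using \<epsilon> h by (intro nn_integral_scaled_taut_noise_le) auto
  finally show ?thesis .
qed

text \<open>
  The pinned energy of the \<open>j\<close>-th block of \<open>n\<close> cells of length \<open>h\<close>, normalised for the ratio \<open>\<epsilon>\<close> of a
  single block.
\<close>

definition block_energy :: "real \<Rightarrow> real \<Rightarrow> nat \<Rightarrow> nat \<Rightarrow> 'a \<Rightarrow> real" where
  "block_energy \<epsilon> h n j \<omega> = scaled_taut n \<epsilon> (\<lambda>k. noise 0 h (j * n + k) \<omega>)"

lemma block_energy_nonneg: "\<epsilon> > 0 \<Longrightarrow> 0 \<le> block_energy \<epsilon> h n j \<omega>"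
  by (simp add: block_energy_def scaled_taut_nonneg)

lemma block_energy_eq: "block_energy \<epsilon> h n j \<omega> = scaled_taut n \<epsilon> (\<lambda>k. noise (real (j * n) * h) h k \<omega>)"
  using noise_shift[of 0 "j * n" h] by (simp add: block_energy_def)

lemma block_energy_measurable [measurable]:
  assumes "\<epsilon> > 0" "h > 0"
  shows "block_energy \<epsilon> h n j \<in> borel_measurable M"
  unfolding block_energy_eq[abs_def] using assms by (intro scaled_taut_noise_measurable) auto

lemma nn_integral_block_energy:
  assumes "\<epsilon> > 0" "h > 0" "n > 0" "f \<in> borel_measurable borel"
  shows "(\<integral>\<^sup>+\<omega>. f (block_energy \<epsilon> h n j \<omega>) \<partial>M) = (\<integral>\<^sup>+d. f (scaled_taut n \<epsilon> d) \<partial>std_normal_vector n)"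
  unfolding block_energy_eq using assms by (intro nn_integral_scaled_taut_noise) auto

lemma nn_integral_block_energy_le:
  assumes "\<epsilon> > 0" "h > 0"
  shows "(\<integral>\<^sup>+\<omega>. ennreal (block_energy \<epsilon> h (2 ^ n) j \<omega> ^ p) \<partial>M) \<le> taut_moment p \<epsilon>"
  unfolding block_energy_eq using assms by (intro nn_integral_scaled_taut_noise_le) auto

lemma block_energy_indep:
  assumes "\<epsilon> > 0" "h > 0" "n > 0"
  shows "indep_vars (\<lambda>_. borel) (block_energy \<epsilon> h n) {..<m}"
proof -
  define K where "K j = {j * n..<j * n + n}" for j
  have ind: "indep_vars (\<lambda>j. \<Pi>\<^sub>M i\<in>K j. borel) (\<lambda>j \<omega>. restrict (\<lambda>i. noise 0 h i \<omega>) (K j)) {..<m}"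
  proof (rule indep_vars_restrict)
    show "indep_vars (\<lambda>_. borel) (noise 0 h) {..<m * n}" using assms by (intro noise_indep) auto
    show "K j \<subseteq> {..<m * n}" if "j \<in> {..<m}" for j
    proof -
      have "Suc j * n \<le> m * n" using that by (intro mult_right_mono) auto
      then show ?thesis by (auto simp: K_def)
    qed
    have "K i \<inter> K j = {}" if "i < j" for i j
    proof -
      have "Suc i * n \<le> j * n" using that by (intro mult_right_mono) auto
      then show ?thesis by (auto simp: K_def)
    qed
    then show "disjoint_family_on K {..<m}"
      unfolding disjoint_family_on_def by (metis inf_commute nat_neq_iff)
  qed
  have "indep_vars (\<lambda>_. borel)
     (\<lambda>j \<omega>. scaled_taut n \<epsilon> (\<lambda>k. restrict (\<lambda>i. noise 0 h i \<omega>) (K j) (j * n + k))) {..<m}"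
  proof (rule indep_vars_compose2[OF ind, of "\<lambda>j d. scaled_taut n \<epsilon> (\<lambda>k. d (j * n + k))"])
    fix j
    have "(\<lambda>d. taut n (\<epsilon> * sqrt (real n)) 0 (\<lambda>k. d (j * n + k))) \<in> borel_measurable (\<Pi>\<^sub>M i\<in>K j. borel)"
      using assms by (intro borel_measurable_taut_compose measurable_component_singleton) (auto simp: K_def)
    then show "(\<lambda>d. scaled_taut n \<epsilon> (\<lambda>k. d (j * n + k))) \<in> borel_measurable (\<Pi>\<^sub>M i\<in>K j. borel)"
      unfolding scaled_taut_def by simp
  qed
  moreover have "(\<lambda>j \<omega>. scaled_taut n \<epsilon> (\<lambda>k. restrict (\<lambda>i. noise 0 h i \<omega>) (K j) (j * n + k))) = block_energy \<epsilon> h n"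
    unfolding block_energy_def[abs_def] scaled_taut_def
    by (intro ext arg_cong2[where f = "(*)"] refl taut_cong) (simp add: K_def)
  ultimately show ?thesis by simp
qed

lemma pinned_limit_blocks:
  assumes "T > 0" "r > 0" "m > 0" "\<omega> \<in> space M"
  shows "(\<lambda>i. scaled_taut (m * 2 ^ i) (r / sqrt T) (\<lambda>k. noise 0 (T / real (m * 2 ^ i)) k \<omega>)) \<longlonglongrightarrow> (taut_length T r 0 \<omega>)\<^sup>2"
    and "(\<lambda>i. scaled_free (m * 2 ^ i) (r / sqrt T) (\<lambda>k. noise 0 (T / real (m * 2 ^ i)) k \<omega>)) \<longlonglongrightarrow> (taut_length T r r \<omega>)\<^sup>2"
proof -
  have "strict_mono (\<lambda>i. m * 2 ^ i)" using assms by (auto simp: strict_mono_def)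
  from LIMSEQ_subseq_LIMSEQ[OF pinned_limit[OF assms(1,2,4)] this]
    LIMSEQ_subseq_LIMSEQ[OF free_limit[OF assms(1,2,4)] this]
  show "(\<lambda>i. scaled_taut (m * 2 ^ i) (r / sqrt T) (\<lambda>k. noise 0 (T / real (m * 2 ^ i)) k \<omega>)) \<longlonglongrightarrow> (taut_length T r 0 \<omega>)\<^sup>2"
    "(\<lambda>i. scaled_free (m * 2 ^ i) (r / sqrt T) (\<lambda>k. noise 0 (T / real (m * 2 ^ i)) k \<omega>)) \<longlonglongrightarrow> (taut_length T r r \<omega>)\<^sup>2"
    by (simp_all only: o_def)
qed

lemma pinned_moment_le_block:
  assumes "T > 0" "r > 0" "m > 0" "p \<ge> 1"
  shows "(\<integral>\<^sup>+\<omega>. ennreal ((taut_length T r 0 \<omega>)\<^sup>2 ^ p) \<partial>M) \<le> taut_moment p (r / sqrt T * sqrt (real m))"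
proof (rule nn_integral_le_of_limit)
  let ?\<epsilon> = "r / sqrt T"
  have \<epsilon>: "?\<epsilon> > 0" using assms by simp
  let ?X = "\<lambda>i \<omega>. scaled_taut (m * 2 ^ i) ?\<epsilon> (\<lambda>k. noise 0 (T / real (m * 2 ^ i)) k \<omega>)"
  show "(\<lambda>i. ?X i \<omega> ^ p) \<longlonglongrightarrow> (taut_length T r 0 \<omega>)\<^sup>2 ^ p" if "\<omega> \<in> space M" for \<omega>
    by (intro tendsto_power pinned_limit_blocks assms that)
  fix i
  define h where "h = T / real (m * 2 ^ i)"
  have h: "h > 0" using assms by (simp add: h_def)
  show "(\<lambda>\<omega>. ?X i \<omega> ^ p) \<in> borel_measurable M"
    unfolding h_def[symmetric] using \<epsilon> h by (intro borel_measurable_power scaled_taut_noise_measurable) auto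
  let ?Y = "block_energy (?\<epsilon> * sqrt (real m)) h (2 ^ i)"
  have \<epsilon>': "?\<epsilon> * sqrt (real m) > 0" using \<epsilon> assms by simp
  have "(\<integral>\<^sup>+\<omega>. ennreal (?X i \<omega> ^ p) \<partial>M) \<le> (\<integral>\<^sup>+\<omega>. (\<Sum>j<m. ennreal (1 / real m) * ennreal (?Y j \<omega> ^ p)) \<partial>M)"
  proof (rule nn_integral_mono)
    fix \<omega>
    have "?X i \<omega> ^ p \<le> ((\<Sum>j<m. ?Y j \<omega>) / real m) ^ p"
      using scaled_taut_blocks[OF \<epsilon> assms(3), of "2 ^ i" "\<lambda>k. noise 0 h k \<omega>"] \<epsilon>
      by (intro power_mono scaled_taut_nonneg) (auto simp: block_energy_def h_def)
    also have "\<dots> = (\<Sum>j<m. 1 / real m * ?Y j \<omega>) ^ p" by (simp add: sum_divide_distrib)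
    also have "\<dots> \<le> (\<Sum>j<m. 1 / real m * ?Y j \<omega> ^ p)"
      using assms \<epsilon>' by (intro power_mean_le) (auto simp: block_energy_nonneg)
    finally have "ennreal (?X i \<omega> ^ p) \<le> ennreal (\<Sum>j<m. 1 / real m * ?Y j \<omega> ^ p)" by (rule ennreal_leI)
    also have "\<dots> = (\<Sum>j<m. ennreal (1 / real m * ?Y j \<omega> ^ p))"
      using \<epsilon>' by (intro sum_ennreal[symmetric]) (auto simp: block_energy_nonneg)
    also have "\<dots> = (\<Sum>j<m. ennreal (1 / real m) * ennreal (?Y j \<omega> ^ p))"
      using \<epsilon>' by (intro sum.cong refl ennreal_mult) (auto simp: block_energy_nonneg)
    finally show "ennreal (?X i \<omega> ^ p) \<le> (\<Sum>j<m. ennreal (1 / real m) * ennreal (?Y j \<omega> ^ p))" .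
  qed
  also have "\<dots> = (\<Sum>j<m. ennreal (1 / real m) * (\<integral>\<^sup>+\<omega>. ennreal (?Y j \<omega> ^ p) \<partial>M))"
    using \<epsilon>' h by (subst nn_integral_sum) (auto intro!: sum.cong nn_integral_cmult)
  also have "\<dots> \<le> (\<Sum>j<m. ennreal (1 / real m) * taut_moment p (?\<epsilon> * sqrt (real m)))"
    using \<epsilon>' h by (intro sum_mono mult_left_mono nn_integral_block_energy_le) auto
  also have "\<dots> = ennreal (real m * (1 / real m)) * taut_moment p (?\<epsilon> * sqrt (real m))"
    by (subst ennreal_mult) (auto simp: mult.assoc ennreal_of_nat_eq_real_of_nat)
  also have "\<dots> = taut_moment p (?\<epsilon> * sqrt (real m))" using assms by simp
  finally show "(\<integral>\<^sup>+\<omega>. ennreal (?X i \<omega> ^ p) \<partial>M) \<le> taut_moment p (?\<epsilon> * sqrt (real m))" .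
qed

text \<open>
  The squared normalised length is at most the average of \<open>m\<close> independent block energies, whose common
  mean is at most \<open>a\<close>.
\<close>

lemma pinned_upper_deviation:
  assumes "T > 0" "r > 0" "m > 0"
    and a: "0 \<le> a" "taut_moment 1 (r / sqrt T * sqrt (real m)) \<le> ennreal a"
    and s: "0 \<le> s" "taut_moment 2 (r / sqrt T * sqrt (real m)) \<le> ennreal s"
  shows "(\<integral>\<^sup>+\<omega>. ennreal (max 0 ((taut_length T r 0 \<omega>)\<^sup>2 - a)) \<partial>M) \<le> ennreal (sqrt (s / real m))"
proof (rule nn_integral_le_of_limit)
  let ?\<epsilon> = "r / sqrt T"
  have \<epsilon>: "?\<epsilon> > 0" using assms by simp
  let ?X = "\<lambda>i \<omega>. scaled_taut (m * 2 ^ i) ?\<epsilon> (\<lambda>k. noise 0 (T / real (m * 2 ^ i)) k \<omega>)"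
  show "(\<lambda>i. max 0 (?X i \<omega> - a)) \<longlonglongrightarrow> max 0 ((taut_length T r 0 \<omega>)\<^sup>2 - a)" if "\<omega> \<in> space M" for \<omega>
    by (intro tendsto_max tendsto_const tendsto_diff pinned_limit_blocks assms that)
  fix i
  define h where "h = T / real (m * 2 ^ i)"
  have h: "h > 0" using assms by (simp add: h_def)
  have [measurable]: "?X i \<in> borel_measurable M"
    unfolding h_def[symmetric] using \<epsilon> h by (intro scaled_taut_noise_measurable) auto
  show "(\<lambda>\<omega>. max 0 (?X i \<omega> - a)) \<in> borel_measurable M" by measurable
  define Y where "Y = block_energy (?\<epsilon> * sqrt (real m)) h (2 ^ i)"
  have \<epsilon>': "?\<epsilon> * sqrt (real m) > 0" using \<epsilon> assms by simp
  have Y0: "0 \<le> Y j \<omega>" for j \<omega> using \<epsilon>' by (simp add: Y_def block_energy_nonneg)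
  have Ym [measurable]: "Y j \<in> borel_measurable M" for j unfolding Y_def using \<epsilon>' h by (intro block_energy_measurable)
  have Yn: "(\<integral>\<^sup>+\<omega>. ennreal (Y j \<omega> ^ p) \<partial>M) \<le> taut_moment p (?\<epsilon> * sqrt (real m))" for j p
    unfolding Y_def using \<epsilon>' h by (intro nn_integral_block_energy_le)
  have Y1: "integrable M (Y j)" for j
  proof (rule integrableI_nonneg)
    show "(\<integral>\<^sup>+\<omega>. ennreal (Y j \<omega>) \<partial>M) < \<infinity>" using order_trans[OF Yn[of j 1] a(2)] by (auto simp: order_le_less_trans)
  qed (use Y0 in auto)
  have Y2: "integrable M (\<lambda>\<omega>. (Y j \<omega>)\<^sup>2)" for j
  proof (rule integrableI_nonneg)
    show "(\<integral>\<^sup>+\<omega>. ennreal ((Y j \<omega>)\<^sup>2) \<partial>M) < \<infinity>" using order_trans[OF Yn[of j 2] s(2)] by (auto simp: order_le_less_trans)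
  qed auto
  define \<mu> where "\<mu> = expectation (Y 0)"
  have mean: "expectation (Y j) = \<mu>" for j
  proof -
    have "expectation (Y j) = enn2real (\<integral>\<^sup>+\<omega>. ennreal (Y j \<omega>) \<partial>M)" for j
      using Y0 by (intro integral_eq_nn_integral) auto
    moreover have "(\<integral>\<^sup>+\<omega>. ennreal (Y j \<omega>) \<partial>M) = (\<integral>\<^sup>+d. ennreal (scaled_taut (2 ^ i) (?\<epsilon> * sqrt (real m)) d) \<partial>std_normal_vector (2 ^ i))" for j
      unfolding Y_def using \<epsilon>' h by (intro nn_integral_block_energy) auto
    ultimately show ?thesis unfolding \<mu>_def by simp
  qed
  have "\<mu> \<le> a"
  proof -
    have "ennreal \<mu> = (\<integral>\<^sup>+\<omega>. ennreal (Y 0 \<omega>) \<partial>M)" unfolding \<mu>_def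
      using Y0 Y1 by (intro nn_integral_eq_integral[symmetric]) auto
    also have "\<dots> \<le> ennreal a" using order_trans[OF Yn[of 0 1] a(2)] by simp
    finally show ?thesis using a(1) by simp
  qed
  have second: "expectation (\<lambda>\<omega>. (Y j \<omega>)\<^sup>2) \<le> s" for j
  proof -
    have "ennreal (expectation (\<lambda>\<omega>. (Y j \<omega>)\<^sup>2)) = (\<integral>\<^sup>+\<omega>. ennreal ((Y j \<omega>)\<^sup>2) \<partial>M)"
      using Y2 by (intro nn_integral_eq_integral[symmetric]) auto
    also have "\<dots> \<le> ennreal s" using order_trans[OF Yn[of j 2] s(2)] .
    finally show ?thesis using s(1) by simp
  qed
  have "(\<integral>\<^sup>+\<omega>. ennreal (max 0 (?X i \<omega> - a)) \<partial>M) \<le> (\<integral>\<^sup>+\<omega>. ennreal \<bar>(\<Sum>j<m. Y j \<omega>) / real m - \<mu>\<bar> \<partial>M)"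
  proof (intro nn_integral_mono ennreal_leI)
    fix \<omega>
    have "?X i \<omega> \<le> (\<Sum>j<m. Y j \<omega>) / real m"
      using scaled_taut_blocks[OF \<epsilon> assms(3), of "2 ^ i" "\<lambda>k. noise 0 h k \<omega>"]
      by (simp add: Y_def block_energy_def h_def)
    then show "max 0 (?X i \<omega> - a) \<le> \<bar>(\<Sum>j<m. Y j \<omega>) / real m - \<mu>\<bar>" using \<open>\<mu> \<le> a\<close> by linarith
  qed
  also have "\<dots> \<le> ennreal (sqrt (s / real m))"
  proof (rule average_deviation_le[OF assms(3)])
    show "indep_vars (\<lambda>_. borel) Y {..<m}" unfolding Y_def using \<epsilon>' h by (intro block_energy_indep) auto
  qed (use Y2 mean second in auto)
  finally show "(\<integral>\<^sup>+\<omega>. ennreal (max 0 (?X i \<omega> - a)) \<partial>M) \<le> ennreal (sqrt (s / real m))" .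
qed

lemma pinned_minus_free:
  assumes "T > 0" "r > 0" "m > 0"
    and \<mu>: "0 \<le> \<mu>" "taut_moment 1 (r / sqrt T * sqrt (real m)) \<le> ennreal \<mu>"
  shows "(\<integral>\<^sup>+\<omega>. ennreal ((taut_length T r 0 \<omega> - taut_length T r r \<omega>)\<^sup>2) \<partial>M) \<le>
    ennreal (8 * (r / sqrt T) ^ 4 * real m + 2 / real m * \<mu>)"
proof -
  let ?\<epsilon> = "r / sqrt T"
  have \<epsilon>: "?\<epsilon> > 0" using assms by simp
  let ?X = "\<lambda>i \<omega>. scaled_taut (m * 2 ^ i) ?\<epsilon> (\<lambda>k. noise 0 (T / real (m * 2 ^ i)) k \<omega>)"
  let ?F = "\<lambda>i \<omega>. scaled_free (m * 2 ^ i) ?\<epsilon> (\<lambda>k. noise 0 (T / real (m * 2 ^ i)) k \<omega>)"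
  let ?D = "\<lambda>i \<omega>. max 0 (sqrt (?X i \<omega>) - sqrt (?F i \<omega>))"
  let ?B = "8 * ?\<epsilon> ^ 4 * real m + 2 / real m * \<mu>"
  have "(\<integral>\<^sup>+\<omega>. ennreal ((max 0 (taut_length T r 0 \<omega> - taut_length T r r \<omega>))\<^sup>2) \<partial>M) \<le> ennreal ?B"
  proof (rule nn_integral_le_of_limit)
    show "(\<lambda>i. (?D i \<omega>)\<^sup>2) \<longlonglongrightarrow> (max 0 (taut_length T r 0 \<omega> - taut_length T r r \<omega>))\<^sup>2" if \<omega>: "\<omega> \<in> space M" for \<omega>
    proof -
      have "(\<lambda>i. sqrt (?X i \<omega>)) \<longlonglongrightarrow> sqrt ((taut_length T r 0 \<omega>)\<^sup>2)"
        "(\<lambda>i. sqrt (?F i \<omega>)) \<longlonglongrightarrow> sqrt ((taut_length T r r \<omega>)\<^sup>2)"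
        by (intro tendsto_real_sqrt pinned_limit_blocks assms \<omega>)+
      then have "(\<lambda>i. (?D i \<omega>)\<^sup>2) \<longlonglongrightarrow> (max 0 (sqrt ((taut_length T r 0 \<omega>)\<^sup>2) - sqrt ((taut_length T r r \<omega>)\<^sup>2)))\<^sup>2"
        by (intro tendsto_power tendsto_max tendsto_const tendsto_diff)
      then show ?thesis using assms by (simp add: taut_length_nonneg)
    qed
    fix i
    define h where "h = T / real (m * 2 ^ i)"
    have h: "h > 0" using assms by (simp add: h_def)
    have [measurable]: "?X i \<in> borel_measurable M" "?F i \<in> borel_measurable M"
      unfolding h_def[symmetric] using \<epsilon> h
      by (intro scaled_taut_noise_measurable scaled_free_noise_measurable; simp)+
    show "(\<lambda>\<omega>. (?D i \<omega>)\<^sup>2) \<in> borel_measurable M" by measurable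
    \<comment> \<open>the last block, on which the free string is steered to the end of the path\<close>
    define Y where "Y = block_energy (?\<epsilon> * sqrt (real m)) h (2 ^ i) (m - 1)"
    have \<epsilon>': "?\<epsilon> * sqrt (real m) > 0" using \<epsilon> assms by simp
    have Ym [measurable]: "Y \<in> borel_measurable M" unfolding Y_def using \<epsilon>' h by (intro block_energy_measurable)
    have Y0: "0 \<le> Y \<omega>" for \<omega> using \<epsilon>' by (simp add: Y_def block_energy_nonneg)
    have YE: "(\<integral>\<^sup>+\<omega>. ennreal (Y \<omega>) \<partial>M) \<le> ennreal \<mu>"
      using order_trans[OF nn_integral_block_energy_le[OF \<epsilon>' h, of i "m - 1" 1] \<mu>(2)] by (simp add: Y_def)
    show "(\<integral>\<^sup>+\<omega>. ennreal ((?D i \<omega>)\<^sup>2) \<partial>M) \<le> ennreal ?B"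
    proof (rule nn_integral_affine_le[where g = Y, OF Ym Y0 YE \<mu>(1)])
      fix \<omega>
      have "sqrt (?X i \<omega>) - sqrt (?F i \<omega>) \<le> sqrt (Y \<omega> / real m) + 2 * ?\<epsilon>\<^sup>2 * sqrt (real m)"
        using sqrt_scaled_taut_le_free[OF \<epsilon> assms(3), of "2 ^ i" "\<lambda>k. noise 0 h k \<omega>"]
        unfolding Y_def block_energy_def h_def by simp
      then have "?D i \<omega> \<le> sqrt (Y \<omega> / real m) + 2 * ?\<epsilon>\<^sup>2 * sqrt (real m)" using Y0[of \<omega>] by simp
      then have "(?D i \<omega>)\<^sup>2 \<le> (sqrt (Y \<omega> / real m) + 2 * ?\<epsilon>\<^sup>2 * sqrt (real m))\<^sup>2" by (intro power_mono) auto
      also have "\<dots> \<le> 2 * (sqrt (Y \<omega> / real m))\<^sup>2 + 2 * (2 * ?\<epsilon>\<^sup>2 * sqrt (real m))\<^sup>2"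
        by (rule sum_squares_two)
      also have "(2 * ?\<epsilon>\<^sup>2 * sqrt (real m))\<^sup>2 = 4 * ?\<epsilon> ^ 4 * real m"
        unfolding power_mult_distrib by (simp flip: power_mult)
      also have "(sqrt (Y \<omega> / real m))\<^sup>2 = Y \<omega> / real m" using Y0[of \<omega>] by simp
      finally show "(?D i \<omega>)\<^sup>2 \<le> 8 * ?\<epsilon> ^ 4 * real m + 2 / real m * Y \<omega>" by simp
    qed auto
  qed
  also have "(\<integral>\<^sup>+\<omega>. ennreal ((max 0 (taut_length T r 0 \<omega> - taut_length T r r \<omega>))\<^sup>2) \<partial>M) =
      (\<integral>\<^sup>+\<omega>. ennreal ((taut_length T r 0 \<omega> - taut_length T r r \<omega>)\<^sup>2) \<partial>M)"
    using free_le_pinned[OF assms(1,2)] by (intro nn_integral_cong) (simp add: max_def)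
  finally show ?thesis .
qed

end

section \<open>Convergence to the constant\<close>

definition taut_constant :: real where
  "taut_constant = enn2real (INF \<epsilon>\<in>{0<..}. taut_moment 1 \<epsilon>)"

text \<open>
  Splitting \<open>[0, T]\<close> into \<open>m\<close> blocks raises the ratio from \<open>\<epsilon>\<close> to \<open>\<epsilon> * sqrt m\<close>; rounding \<open>m\<close> upwards brings it to at
  least \<open>\<epsilon>0\<close>, and close to \<open>\<epsilon>0\<close> when \<open>\<epsilon>\<close> is small.
\<close>

lemma block_count:
  fixes \<epsilon> \<epsilon>0 :: real
  assumes "0 < \<epsilon>" "0 < \<epsilon>0"
  obtains m :: nat where "m > 0" "1 / real m \<le> (\<epsilon> / \<epsilon>0)\<^sup>2" "\<epsilon>0 \<le> \<epsilon> * sqrt (real m)"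
    "(\<epsilon> * sqrt (real m) / \<epsilon>0)\<^sup>2 \<le> 1 + (\<epsilon> / \<epsilon>0)\<^sup>2" "\<epsilon>\<^sup>2 * real m \<le> \<epsilon>0\<^sup>2 + \<epsilon>\<^sup>2"
proof -
  define m where "m = nat \<lceil>(\<epsilon>0 / \<epsilon>)\<^sup>2\<rceil>"
  have pos: "(\<epsilon>0 / \<epsilon>)\<^sup>2 > 0" using assms by simp
  have m: "(\<epsilon>0 / \<epsilon>)\<^sup>2 \<le> real m" "real m \<le> (\<epsilon>0 / \<epsilon>)\<^sup>2 + 1" using pos unfolding m_def by linarith+
  have m0: "m > 0" using pos m by (cases m) auto
  have m1: "\<epsilon>0\<^sup>2 \<le> \<epsilon>\<^sup>2 * real m" "\<epsilon>\<^sup>2 * real m \<le> \<epsilon>0\<^sup>2 + \<epsilon>\<^sup>2"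
    using m assms by (simp_all add: power_divide field_simps)
  have sq: "(\<epsilon> * sqrt (real m))\<^sup>2 = \<epsilon>\<^sup>2 * real m" by (simp add: power_mult_distrib)
  show ?thesis
  proof (rule that[OF m0])
    show "1 / real m \<le> (\<epsilon> / \<epsilon>0)\<^sup>2" using m1(1) m0 assms by (simp add: power_divide field_simps)
    show "\<epsilon>0 \<le> \<epsilon> * sqrt (real m)"
      by (rule power2_le_imp_le) (use m1 sq assms in auto)
    show "(\<epsilon> * sqrt (real m) / \<epsilon>0)\<^sup>2 \<le> 1 + (\<epsilon> / \<epsilon>0)\<^sup>2"
      unfolding power_divide sq using m1(2) assms by (simp add: field_simps)
  qed (rule m1(2))
qed

text \<open>
  The three terms dominate for small, intermediate and large \<open>y\<close>, respectively.
\<close>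

lemma powr_interpolation:
  fixes q \<eta> :: real
  assumes "q > 0" "\<eta> > 0" and k: "q < real (2 * k)"
  obtains K where "K > 0" "\<And>y. y \<ge> 0 \<Longrightarrow> y powr q \<le> \<eta> + K * y\<^sup>2 + \<eta> * y ^ (2 * k)"
proof -
  define a where "a = \<eta> powr (1 / q)"
  define b where "b = (1 / \<eta>) powr (1 / (real (2 * k) - q))"
  have ab: "a > 0" "b > 0" using assms by (simp_all add: a_def b_def)
  define K where "K = b powr q / a\<^sup>2"
  have K: "K > 0" using ab by (simp add: K_def)
  show ?thesis
  proof (rule that[OF K])
    fix y :: real assume y: "y \<ge> 0"
    have nn: "0 \<le> K * y\<^sup>2" "0 \<le> \<eta> * y ^ (2 * k)" using K y assms by auto
    consider "y \<le> a" | "a < y" "y \<le> b" | "a < y" "b < y" by linarith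
    then show "y powr q \<le> \<eta> + K * y\<^sup>2 + \<eta> * y ^ (2 * k)"
    proof cases
      case 1
      have "y powr q \<le> a powr q" using 1 y assms by (intro powr_mono2) auto
      also have "a powr q = \<eta>" using assms by (simp add: a_def powr_powr)
      finally show ?thesis using nn by linarith
    next
      case 2
      have "y powr q \<le> b powr q" using 2 y assms by (intro powr_mono2) auto
      also have "\<dots> = K * a\<^sup>2" using ab by (simp add: K_def)
      also have "\<dots> \<le> K * y\<^sup>2" using 2 ab K by (intro mult_left_mono power_mono) auto
      finally show ?thesis using nn assms by linarith
    next
      case 3
      have y0: "y > 0" using 3 ab by linarith
      have "1 / \<eta> = b powr (real (2 * k) - q)" using assms by (simp add: b_def powr_powr)
      also have "\<dots> \<le> y powr (real (2 * k) - q)" using 3 ab k by (intro powr_mono2) auto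
      also have "\<dots> = y ^ (2 * k) / y powr q" using y0 by (simp only: powr_diff powr_realpow)
      finally have "y powr q \<le> \<eta> * y ^ (2 * k)" using y0 assms by (simp add: field_simps)
      then show ?thesis using nn assms by linarith
    qed
  qed
qed

context wiener_process
begin

lemma taut_constant_properties:
  shows taut_constant_eq: "ennreal taut_constant = (INF \<epsilon>\<in>{0<..}. taut_moment 1 \<epsilon>)"
    and taut_constant_pos: "taut_constant > 0"
proof -
  have "(INF \<epsilon>\<in>{0<..}. taut_moment 1 \<epsilon>) \<le> taut_moment 1 1" by (intro INF_lower) auto
  also have "\<dots> < \<infinity>" by (intro taut_moment_finite) auto
  finally have fin: "(INF \<epsilon>\<in>{0<..}. taut_moment 1 \<epsilon>) < \<infinity>" .
  then show eq: "ennreal taut_constant = (INF \<epsilon>\<in>{0<..}. taut_moment 1 \<epsilon>)" by (simp add: taut_constant_def)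
  have "excess_constant \<le> (INF \<epsilon>\<in>{0<..}. taut_moment 1 \<epsilon>)"
    by (intro INF_greatest excess_constant_le_moment) auto
  then have "0 < ennreal taut_constant" using excess_constant_pos eq by simp
  then show "taut_constant > 0" by simp
qed

lemma taut_constant_le: "\<epsilon> > 0 \<Longrightarrow> ennreal taut_constant \<le> taut_moment 1 \<epsilon>"
  unfolding taut_constant_eq by (intro INF_lower) auto

lemma taut_moment_real:
  assumes "\<epsilon> > 0" "p \<ge> 1"
  obtains B where "B \<ge> 0" "taut_moment p \<epsilon> = ennreal B"
  using taut_moment_finite[OF assms] by (cases "taut_moment p \<epsilon>") auto

text \<open>
  Choose \<open>\<epsilon>0\<close> with \<open>E (V \<epsilon>0) < c + \<eta>\<close>, where \<open>V\<close> is the squared normalised length and \<open>c\<close> the constant, and split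
  into blocks of a ratio just above \<open>\<epsilon>0\<close>. The deviation above \<open>a = (1 + t) * (c + \<eta>)\<close> is small in mean by
  the law of large numbers, where \<open>t = (\<epsilon> / \<epsilon>0)^2 \<rightarrow> 0\<close>. Finally \<open>|x - c| + x = 2 * max 0 (x - c) + c\<close>
  and \<open>E (V \<epsilon>) \<ge> c\<close> turn the bound for the positive part into one for the absolute value.
\<close>

lemma pinned_energy_L1:
  assumes e: "e > 0"
  obtains \<delta> where "\<delta> > 0" "\<And>T r. T > 0 \<Longrightarrow> r > 0 \<Longrightarrow> r / sqrt T < \<delta> \<Longrightarrow>
    (\<integral>\<^sup>+\<omega>. ennreal \<bar>(taut_length T r 0 \<omega>)\<^sup>2 - taut_constant\<bar> \<partial>M) \<le> ennreal e"
proof -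
  let ?c = taut_constant
  define \<eta> where "\<eta> = e / 4"
  have \<eta>: "\<eta> > 0" using e by (simp add: \<eta>_def)
  have c: "?c > 0" by (rule taut_constant_pos)
  have "(INF \<epsilon>\<in>{0<..}. taut_moment 1 \<epsilon>) < ennreal (?c + \<eta>)"
    unfolding taut_constant_eq[symmetric] using \<eta> c by (simp add: ennreal_less_iff)
  then obtain \<epsilon>0 where \<epsilon>0: "\<epsilon>0 > 0" "taut_moment 1 \<epsilon>0 < ennreal (?c + \<eta>)"
    by (auto simp: INF_less_iff)
  obtain s0 where s0: "s0 \<ge> 0" "taut_moment 2 \<epsilon>0 = ennreal s0" using taut_moment_real[OF \<epsilon>0(1), of 2] by auto
  define f where "f t = 2 * (sqrt ((1 + t)\<^sup>2 * s0 * t) + ((1 + t) * (?c + \<eta>) - ?c))" for t :: real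
  have "isCont f 0" unfolding f_def by (intro continuous_intros)
  then have "f \<midarrow>0\<rightarrow> f 0" by (simp add: isCont_def)
  moreover have "f 0 < e" using e by (simp add: f_def \<eta>_def)
  ultimately have "eventually (\<lambda>t. f t < e) (at 0)" by (rule order_tendstoD)
  then obtain d where d: "d > 0" "\<And>t. t \<noteq> 0 \<Longrightarrow> dist t 0 < d \<Longrightarrow> f t < e"
    by (auto simp: eventually_at)
  define \<delta> where "\<delta> = \<epsilon>0 * sqrt d"
  show ?thesis
  proof (rule that[of \<delta>])
    show "\<delta> > 0" using \<epsilon>0 d by (simp add: \<delta>_def)
    fix T r :: real assume T: "T > 0" and r: "r > 0" and lt: "r / sqrt T < \<delta>"
    define \<epsilon> where "\<epsilon> = r / sqrt T"
    have \<epsilon>: "\<epsilon> > 0" using T r by (simp add: \<epsilon>_def)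
    define t where "t = (\<epsilon> / \<epsilon>0)\<^sup>2"
    have t: "t > 0" using \<epsilon> \<epsilon>0 by (simp add: t_def)
    have "\<epsilon> / \<epsilon>0 < sqrt d" using lt \<epsilon>0 by (simp add: \<epsilon>_def[symmetric] \<delta>_def field_simps)
    then have "t < (sqrt d)\<^sup>2" unfolding t_def using \<epsilon> \<epsilon>0 by (intro power_strict_mono) auto
    then have "t < d" using d by simp
    then have fe: "f t < e" using t d(2)[of t] by simp
    obtain m :: nat where m: "m > 0" "1 / real m \<le> t" "\<epsilon>0 \<le> \<epsilon> * sqrt (real m)"
      "(\<epsilon> * sqrt (real m) / \<epsilon>0)\<^sup>2 \<le> 1 + t"
      using block_count[OF \<epsilon> \<epsilon>0(1)] unfolding t_def by metis
    define \<kappa> where "\<kappa> = (\<epsilon> * sqrt (real m) / \<epsilon>0)\<^sup>2"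
    have \<kappa>: "0 \<le> \<kappa>" "\<kappa> \<le> 1 + t" using m by (simp_all add: \<kappa>_def)
    have mom: "taut_moment p (\<epsilon> * sqrt (real m)) \<le> ennreal ((1 + t) ^ p) * taut_moment p \<epsilon>0" for p
    proof -
      have "taut_moment p (\<epsilon> * sqrt (real m)) \<le> ennreal (\<kappa> ^ p) * taut_moment p \<epsilon>0"
        unfolding \<kappa>_def by (rule taut_moment_mono[OF \<epsilon>0(1) m(3)])
      also have "\<dots> \<le> ennreal ((1 + t) ^ p) * taut_moment p \<epsilon>0"
        using \<kappa> by (intro mult_right_mono ennreal_leI power_mono) auto
      finally show ?thesis .
    qed
    define a where "a = (1 + t) * (?c + \<eta>)"
    define s where "s = (1 + t)\<^sup>2 * s0"
    have a0: "0 \<le> a" "?c \<le> a"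
    proof -
      show "0 \<le> a" using t c \<eta> by (simp add: a_def)
      have "1 * (?c + \<eta>) \<le> a" unfolding a_def using t c \<eta> by (intro mult_right_mono) auto
      then show "?c \<le> a" using \<eta> by simp
    qed
    have a1: "taut_moment 1 (\<epsilon> * sqrt (real m)) \<le> ennreal a"
    proof -
      have "ennreal ((1 + t) ^ 1) * taut_moment 1 \<epsilon>0 \<le> ennreal (1 + t) * ennreal (?c + \<eta>)"
        using \<epsilon>0(2) by (intro mult_mono) auto
      also have "\<dots> = ennreal a" unfolding a_def using t c \<eta> by (intro ennreal_mult[symmetric]) auto
      finally show ?thesis using mom[of 1] by (rule order_trans[rotated])
    qed
    have s1: "taut_moment 2 (\<epsilon> * sqrt (real m)) \<le> ennreal s"
      using mom[of 2] t s0 by (simp add: s_def ennreal_mult)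
    have ss: "0 \<le> s" using s0 by (simp add: s_def)
    let ?R = "\<lambda>\<omega>. (taut_length T r 0 \<omega>)\<^sup>2"
    have Rm [measurable]: "?R \<in> borel_measurable M" using pinned_measurable[OF T r] by measurable
    have up: "(\<integral>\<^sup>+\<omega>. ennreal (max 0 (?R \<omega> - a)) \<partial>M) \<le> ennreal (sqrt (s / real m))"
      using a0 a1 ss s1 unfolding \<epsilon>_def by (intro pinned_upper_deviation T r m)
    have pos: "(\<integral>\<^sup>+\<omega>. ennreal (max 0 (?R \<omega> - ?c)) \<partial>M) \<le> ennreal ((a - ?c) + 1 * sqrt (s / real m))"
      by (rule nn_integral_affine_le[OF _ _ up]) (use a0 ss in auto)
    have ER: "(\<integral>\<^sup>+\<omega>. ennreal (?R \<omega>) \<partial>M) = taut_moment 1 \<epsilon>"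
      using nn_integral_pinned[OF T r, of 1] by (simp add: \<epsilon>_def)
    have "(\<integral>\<^sup>+\<omega>. ennreal \<bar>?R \<omega> - ?c\<bar> \<partial>M) + (\<integral>\<^sup>+\<omega>. ennreal (?R \<omega>) \<partial>M) =
        (\<integral>\<^sup>+\<omega>. 2 * ennreal (max 0 (?R \<omega> - ?c)) + ennreal ?c \<partial>M)"
    proof (subst nn_integral_add[symmetric], measurable, intro nn_integral_cong)
      fix \<omega>
      have "\<bar>?R \<omega> - ?c\<bar> + ?R \<omega> = 2 * max 0 (?R \<omega> - ?c) + ?c" by (simp add: max_def)
      then have "ennreal (\<bar>?R \<omega> - ?c\<bar> + ?R \<omega>) = ennreal (2 * max 0 (?R \<omega> - ?c) + ?c)" by (simp only:)
      then show "ennreal \<bar>?R \<omega> - ?c\<bar> + ennreal (?R \<omega>) = 2 * ennreal (max 0 (?R \<omega> - ?c)) + ennreal ?c"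
        using c by (simp add: ennreal_plus ennreal_mult del: ennreal_plus[symmetric])
    qed
    also have "\<dots> = 2 * (\<integral>\<^sup>+\<omega>. ennreal (max 0 (?R \<omega> - ?c)) \<partial>M) + ennreal ?c"
      by (subst nn_integral_add) (auto simp: emeasure_space_1 nn_integral_cmult)
    also have "\<dots> \<le> 2 * (\<integral>\<^sup>+\<omega>. ennreal (max 0 (?R \<omega> - ?c)) \<partial>M) + (\<integral>\<^sup>+\<omega>. ennreal (?R \<omega>) \<partial>M)"
      unfolding ER by (intro add_left_mono taut_constant_le \<epsilon>)
    finally have "(\<integral>\<^sup>+\<omega>. ennreal \<bar>?R \<omega> - ?c\<bar> \<partial>M) \<le> 2 * (\<integral>\<^sup>+\<omega>. ennreal (max 0 (?R \<omega> - ?c)) \<partial>M)"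
      using taut_moment_finite[OF \<epsilon>, of 1] unfolding ER
      by (auto simp: ennreal_add_left_cancel_le add.commute[of _ "taut_moment 1 \<epsilon>"])
    also have "\<dots> \<le> 2 * ennreal (sqrt (s / real m) + (a - ?c))"
      using pos by (intro mult_left_mono) (auto simp: add.commute)
    also have "\<dots> = ennreal (2 * (sqrt (s / real m) + (a - ?c)))"
      unfolding ennreal_numeral[symmetric] using a0 ss by (intro ennreal_mult[symmetric]) auto
    also have "\<dots> \<le> ennreal (f t)"
    proof (intro ennreal_leI)
      have "s / real m = s * (1 / real m)" by simp
      also have "\<dots> \<le> s * t" using m ss by (intro mult_left_mono) auto
      finally have "sqrt (s / real m) \<le> sqrt (s * t)" by simp
      then show "2 * (sqrt (s / real m) + (a - ?c)) \<le> f t" by (simp add: f_def s_def a_def)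
    qed
    also have "\<dots> \<le> ennreal e" using fe by (intro ennreal_leI) simp
    finally show "(\<integral>\<^sup>+\<omega>. ennreal \<bar>?R \<omega> - ?c\<bar> \<partial>M) \<le> ennreal e" .
  qed
qed

lemma pinned_moment_bounded:
  assumes "p \<ge> 1"
  obtains B where "B \<ge> 0" "\<And>T r. T > 0 \<Longrightarrow> r > 0 \<Longrightarrow> r / sqrt T < 1 \<Longrightarrow>
    (\<integral>\<^sup>+\<omega>. ennreal ((taut_length T r 0 \<omega>)\<^sup>2 ^ p) \<partial>M) \<le> ennreal B"
proof -
  obtain B where B: "B \<ge> 0" "taut_moment p 1 = ennreal B" using taut_moment_real[of 1 p] assms by auto
  show ?thesis
  proof (rule that[of "2 ^ p * B"])
    show "0 \<le> 2 ^ p * B" using B by simp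
    fix T r :: real assume T: "T > 0" and r: "r > 0" and lt: "r / sqrt T < 1"
    define \<epsilon> where "\<epsilon> = r / sqrt T"
    have \<epsilon>: "\<epsilon> > 0" "\<epsilon> < 1" using T r lt by (simp_all add: \<epsilon>_def)
    obtain m :: nat where m: "m > 0" "1 \<le> \<epsilon> * sqrt (real m)" "(\<epsilon> * sqrt (real m) / 1)\<^sup>2 \<le> 1 + (\<epsilon> / 1)\<^sup>2"
      using block_count[OF \<epsilon>(1), of 1] by (metis zero_less_one)
    have "(\<epsilon> * sqrt (real m) / 1)\<^sup>2 \<le> 2" using m(3) power_le_one[of \<epsilon> 2] \<epsilon> by simp
    then have le: "(\<epsilon> * sqrt (real m) / 1)\<^sup>2 ^ p \<le> 2 ^ p" by (intro power_mono) auto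
    have "(\<integral>\<^sup>+\<omega>. ennreal ((taut_length T r 0 \<omega>)\<^sup>2 ^ p) \<partial>M) \<le> taut_moment p (\<epsilon> * sqrt (real m))"
      unfolding \<epsilon>_def by (rule pinned_moment_le_block[OF T r m(1) assms])
    also have "\<dots> \<le> ennreal ((\<epsilon> * sqrt (real m) / 1)\<^sup>2 ^ p) * taut_moment p 1"
      using m by (intro taut_moment_mono) auto
    also have "\<dots> \<le> ennreal (2 ^ p) * ennreal B"
      unfolding B(2) using le by (intro mult_right_mono ennreal_leI) auto
    also have "\<dots> = ennreal (2 ^ p * B)" using B by (simp add: ennreal_mult)
    finally show "(\<integral>\<^sup>+\<omega>. ennreal ((taut_length T r 0 \<omega>)\<^sup>2 ^ p) \<partial>M) \<le> ennreal (2 ^ p * B)" .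
  qed
qed

lemma pinned_minus_free_small:
  obtains B where "B \<ge> 0" "\<And>T r. T > 0 \<Longrightarrow> r > 0 \<Longrightarrow> r / sqrt T < 1 \<Longrightarrow>
    (\<integral>\<^sup>+\<omega>. ennreal ((taut_length T r 0 \<omega> - taut_length T r r \<omega>)\<^sup>2) \<partial>M) \<le> ennreal ((r / sqrt T)\<^sup>2 * B)"
proof -
  obtain B where B: "B \<ge> 0" "taut_moment 1 1 = ennreal B" using taut_moment_real[of 1 1] by auto
  show ?thesis
  proof (rule that[of "4 * B + 16"])
    show "0 \<le> 4 * B + 16" using B by simp
    fix T r :: real assume T: "T > 0" and r: "r > 0" and lt: "r / sqrt T < 1"
    define \<epsilon> where "\<epsilon> = r / sqrt T"
    have \<epsilon>: "\<epsilon> > 0" "\<epsilon> < 1" using T r lt by (simp_all add: \<epsilon>_def)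
    obtain m :: nat where m: "m > 0" "1 / real m \<le> (\<epsilon> / 1)\<^sup>2" "1 \<le> \<epsilon> * sqrt (real m)"
      "(\<epsilon> * sqrt (real m) / 1)\<^sup>2 \<le> 1 + (\<epsilon> / 1)\<^sup>2" "\<epsilon>\<^sup>2 * real m \<le> 1\<^sup>2 + \<epsilon>\<^sup>2"
      using block_count[OF \<epsilon>(1), of 1] by (metis zero_less_one)
    have e1: "\<epsilon>\<^sup>2 \<le> 1" using power_le_one[of \<epsilon> 2] \<epsilon> by simp
    have le: "(\<epsilon> * sqrt (real m) / 1)\<^sup>2 ^ 1 \<le> 2" using m(4) e1 by simp
    have "taut_moment 1 (\<epsilon> * sqrt (real m)) \<le> ennreal ((\<epsilon> * sqrt (real m) / 1)\<^sup>2 ^ 1) * taut_moment 1 1"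
      using m by (intro taut_moment_mono) auto
    also have "\<dots> \<le> ennreal 2 * ennreal B"
      unfolding B(2) using le by (intro mult_right_mono ennreal_leI) auto
    also have "\<dots> = ennreal (2 * B)" using B by (simp add: ennreal_mult)
    finally have mom: "taut_moment 1 (\<epsilon> * sqrt (real m)) \<le> ennreal (2 * B)" .
    have "(\<integral>\<^sup>+\<omega>. ennreal ((taut_length T r 0 \<omega> - taut_length T r r \<omega>)\<^sup>2) \<partial>M) \<le>
        ennreal (8 * \<epsilon> ^ 4 * real m + 2 / real m * (2 * B))"
      using B mom unfolding \<epsilon>_def by (intro pinned_minus_free[OF T r m(1)]) auto
    also have "\<dots> \<le> ennreal (\<epsilon>\<^sup>2 * (4 * B + 16))"
    proof (rule ennreal_leI)
      have "8 * \<epsilon> ^ 4 * real m = 8 * \<epsilon>\<^sup>2 * (\<epsilon>\<^sup>2 * real m)" by (simp add: power2_eq_square eval_nat_numeral)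
      also have "\<dots> \<le> 8 * \<epsilon>\<^sup>2 * 2" using m(5) e1 by (intro mult_left_mono) auto
      finally have "8 * \<epsilon> ^ 4 * real m \<le> 16 * \<epsilon>\<^sup>2" by simp
      moreover have "1 / real m * (4 * B) \<le> \<epsilon>\<^sup>2 * (4 * B)" using m(2) B by (intro mult_right_mono) auto
      ultimately show "8 * \<epsilon> ^ 4 * real m + 2 / real m * (2 * B) \<le> \<epsilon>\<^sup>2 * (4 * B + 16)"
        by (simp add: algebra_simps)
    qed
    finally show "(\<integral>\<^sup>+\<omega>. ennreal ((taut_length T r 0 \<omega> - taut_length T r r \<omega>)\<^sup>2) \<partial>M) \<le> ennreal ((r / sqrt T)\<^sup>2 * (4 * B + 16))"
      unfolding \<epsilon>_def .
  qed
qed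

lemma pinned_L2:
  assumes e: "e > 0"
  obtains \<delta> where "\<delta> > 0" "\<And>T r. T > 0 \<Longrightarrow> r > 0 \<Longrightarrow> r / sqrt T < \<delta> \<Longrightarrow>
    (\<integral>\<^sup>+\<omega>. ennreal ((taut_length T r 0 \<omega> - sqrt taut_constant)\<^sup>2) \<partial>M) \<le> ennreal e"
proof -
  obtain \<delta> where \<delta>: "\<delta> > 0" "\<And>T r. T > 0 \<Longrightarrow> r > 0 \<Longrightarrow> r / sqrt T < \<delta> \<Longrightarrow>
    (\<integral>\<^sup>+\<omega>. ennreal \<bar>(taut_length T r 0 \<omega>)\<^sup>2 - taut_constant\<bar> \<partial>M) \<le> ennreal e"
    using pinned_energy_L1[OF e] by blast
  show ?thesis
  proof (rule that[OF \<delta>(1)])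
    fix T r :: real assume T: "T > 0" and r: "r > 0" and lt: "r / sqrt T < \<delta>"
    have "(x - sqrt taut_constant)\<^sup>2 \<le> \<bar>x\<^sup>2 - taut_constant\<bar>" if "x \<ge> 0" for x
    proof -
      have c: "sqrt taut_constant \<ge> 0" "taut_constant = (sqrt taut_constant)\<^sup>2" using taut_constant_pos by auto
      have "(x - sqrt taut_constant)\<^sup>2 = \<bar>x - sqrt taut_constant\<bar> * \<bar>x - sqrt taut_constant\<bar>"
        by (simp add: power2_eq_square)
      also have "\<dots> \<le> \<bar>x - sqrt taut_constant\<bar> * \<bar>x + sqrt taut_constant\<bar>"
        using that c(1) by (intro mult_left_mono) linarith+
      also have "\<dots> = \<bar>x\<^sup>2 - (sqrt taut_constant)\<^sup>2\<bar>"
        by (simp add: abs_mult[symmetric] power2_eq_square algebra_simps)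
      finally show ?thesis using c(2) by simp
    qed
    then have "(\<integral>\<^sup>+\<omega>. ennreal ((taut_length T r 0 \<omega> - sqrt taut_constant)\<^sup>2) \<partial>M) \<le>
        (\<integral>\<^sup>+\<omega>. ennreal \<bar>(taut_length T r 0 \<omega>)\<^sup>2 - taut_constant\<bar> \<partial>M)"
      using T r by (intro nn_integral_mono ennreal_leI) (auto simp: taut_length_nonneg)
    also have "\<dots> \<le> ennreal e" by (rule \<delta>(2)[OF T r lt])
    finally show "(\<integral>\<^sup>+\<omega>. ennreal ((taut_length T r 0 \<omega> - sqrt taut_constant)\<^sup>2) \<partial>M) \<le> ennreal e" .
  qed
qed

text \<open>
  The free length differs from the pinned one by \<open>O(\<epsilon>)\<close> in the \<open>L_2\<close> norm.
\<close>

lemma free_L2: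
  assumes e: "e > 0"
  obtains \<delta> where "\<delta> > 0" "\<And>T r. T > 0 \<Longrightarrow> r > 0 \<Longrightarrow> r / sqrt T < \<delta> \<Longrightarrow>
    (\<integral>\<^sup>+\<omega>. ennreal ((taut_length T r r \<omega> - sqrt taut_constant)\<^sup>2) \<partial>M) \<le> ennreal e"
proof -
  obtain \<delta>1 where \<delta>1: "\<delta>1 > 0" "\<And>T r. T > 0 \<Longrightarrow> r > 0 \<Longrightarrow> r / sqrt T < \<delta>1 \<Longrightarrow>
    (\<integral>\<^sup>+\<omega>. ennreal ((taut_length T r 0 \<omega> - sqrt taut_constant)\<^sup>2) \<partial>M) \<le> ennreal (e / 4)"
    using pinned_L2[of "e / 4"] e by auto
  obtain B where B: "B \<ge> 0" "\<And>T r. T > 0 \<Longrightarrow> r > 0 \<Longrightarrow> r / sqrt T < 1 \<Longrightarrow>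
    (\<integral>\<^sup>+\<omega>. ennreal ((taut_length T r 0 \<omega> - taut_length T r r \<omega>)\<^sup>2) \<partial>M) \<le> ennreal ((r / sqrt T)\<^sup>2 * B)"
    using pinned_minus_free_small by blast
  define \<delta> where "\<delta> = min (min \<delta>1 1) (sqrt (e / (4 * (B + 1))))"
  show ?thesis
  proof (rule that[of \<delta>])
    show "\<delta> > 0" using \<delta>1 e B by (simp add: \<delta>_def)
    fix T r :: real assume T: "T > 0" and r: "r > 0" and lt: "r / sqrt T < \<delta>"
    let ?p = "\<lambda>\<omega>. taut_length T r 0 \<omega>" and ?f = "\<lambda>\<omega>. taut_length T r r \<omega>" and ?C = "sqrt taut_constant"
    have [measurable]: "?p \<in> borel_measurable M" "?f \<in> borel_measurable M"
      by (rule taut_length_measurable[OF T r])+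
    have small: "(r / sqrt T)\<^sup>2 * B \<le> e / 4"
    proof -
      have "(r / sqrt T)\<^sup>2 \<le> (sqrt (e / (4 * (B + 1))))\<^sup>2"
        using lt T r by (intro power_mono) (auto simp: \<delta>_def)
      also have "\<dots> = e / (4 * (B + 1))" using e B by simp
      finally have "(r / sqrt T)\<^sup>2 * B \<le> e / (4 * (B + 1)) * B" using B by (intro mult_right_mono)
      also have "\<dots> = e / 4 * (B / (B + 1))" by simp
      also have "\<dots> \<le> e / 4 * 1" using e B by (intro mult_left_mono) (auto simp: field_simps)
      finally show ?thesis by simp
    qed
    have "(\<integral>\<^sup>+\<omega>. ennreal ((?f \<omega> - ?C)\<^sup>2) \<partial>M) \<le> ennreal (0 + 2 * (e / 4) + 2 * (e / 4))"
    proof (rule nn_integral_affine2_le)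
      fix \<omega>
      have "(?f \<omega> - ?C)\<^sup>2 = ((?p \<omega> - ?C) + (- (?p \<omega> - ?f \<omega>)))\<^sup>2" by simp
      also have "\<dots> \<le> 2 * (?p \<omega> - ?C)\<^sup>2 + 2 * (- (?p \<omega> - ?f \<omega>))\<^sup>2" by (rule sum_squares_two)
      finally show "(?f \<omega> - ?C)\<^sup>2 \<le> 0 + 2 * (?p \<omega> - ?C)\<^sup>2 + 2 * (?p \<omega> - ?f \<omega>)\<^sup>2" by (simp only: power2_minus add_0_left)
      show "(\<integral>\<^sup>+\<omega>. ennreal ((?p \<omega> - ?C)\<^sup>2) \<partial>M) \<le> ennreal (e / 4)" using lt by (intro \<delta>1(2) T r) (simp add: \<delta>_def)
      show "(\<integral>\<^sup>+\<omega>. ennreal ((?p \<omega> - ?f \<omega>)\<^sup>2) \<partial>M) \<le> ennreal (e / 4)"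
        using lt by (intro order_trans[OF B(2)[OF T r] ennreal_leI[OF small]]) (simp add: \<delta>_def)
    qed (use e in auto)
    then show "(\<integral>\<^sup>+\<omega>. ennreal ((?f \<omega> - ?C)\<^sup>2) \<partial>M) \<le> ennreal e" by simp
  qed
qed

text \<open>
  Mean square convergence improves to \<open>L_q\<close>, because the free and the pinned length are bounded by the
  pinned one, all of whose moments stay bounded.
\<close>

lemma taut_length_Lq:
  assumes q: "q > 0" and e: "e > 0" and \<rho>: "\<And>r. \<rho> r \<in> {0, r}"
    and L2: "\<And>e. e > 0 \<Longrightarrow> \<exists>\<delta>>0. \<forall>T>0. \<forall>r>0. r / sqrt T < \<delta> \<longrightarrow>
      (\<integral>\<^sup>+\<omega>. ennreal ((taut_length T r (\<rho> r) \<omega> - sqrt taut_constant)\<^sup>2) \<partial>M) \<le> ennreal e"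
  shows "\<exists>\<delta>>0. \<forall>T>0. \<forall>r>0. r / sqrt T < \<delta> \<longrightarrow>
    (\<integral>\<^sup>+\<omega>. ennreal (\<bar>taut_length T r (\<rho> r) \<omega> - sqrt taut_constant\<bar> powr q) \<partial>M) \<le> ennreal e"
proof -
  let ?C = "sqrt taut_constant"
  obtain k :: nat where k: "q < real k" using reals_Archimedean2 by blast
  then have k1: "k \<ge> 1" "q < real (2 * k)" using q by (cases k, auto)
  obtain B where B: "B \<ge> 0" "\<And>T r. T > 0 \<Longrightarrow> r > 0 \<Longrightarrow> r / sqrt T < 1 \<Longrightarrow>
    (\<integral>\<^sup>+\<omega>. ennreal ((taut_length T r 0 \<omega>)\<^sup>2 ^ k) \<partial>M) \<le> ennreal B"
    using pinned_moment_bounded[OF k1(1)] by blast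
  have C0: "?C \<ge> 0" using taut_constant_pos by simp
  define D where "D = 2 ^ (2 * k) * (B + ?C ^ (2 * k))"
  have D: "D \<ge> 0" using B C0 by (simp add: D_def)
  define \<eta> where "\<eta> = e / (2 * (1 + D))"
  have \<eta>: "\<eta> > 0" using e D by (simp add: \<eta>_def)
  obtain K where K: "K > 0" "\<And>y. y \<ge> 0 \<Longrightarrow> y powr q \<le> \<eta> + K * y\<^sup>2 + \<eta> * y ^ (2 * k)"
    using powr_interpolation[OF q \<eta> k1(2)] by blast
  obtain \<delta>1 where \<delta>1: "\<delta>1 > 0" "\<And>T r. T > 0 \<Longrightarrow> r > 0 \<Longrightarrow> r / sqrt T < \<delta>1 \<Longrightarrow>
      (\<integral>\<^sup>+\<omega>. ennreal ((taut_length T r (\<rho> r) \<omega> - ?C)\<^sup>2) \<partial>M) \<le> ennreal (e / (2 * K))"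
    using L2[of "e / (2 * K)"] e K by auto
  show ?thesis
  proof (intro exI[of _ "min \<delta>1 1"] conjI allI impI)
    show "min \<delta>1 1 > 0" using \<delta>1 by simp
    fix T r :: real assume T: "T > 0" and r: "r > 0" and lt: "r / sqrt T < min \<delta>1 1"
    let ?R = "\<lambda>\<omega>. taut_length T r (\<rho> r) \<omega>"
    have Rm [measurable]: "?R \<in> borel_measurable M" using \<rho>[of r] taut_length_measurable[OF T r] by auto
    have Pm [measurable]: "taut_length T r 0 \<in> borel_measurable M" by (rule pinned_measurable[OF T r])
    have Rle: "?R \<omega> \<le> taut_length T r 0 \<omega>" if "\<omega> \<in> space M" for \<omega>
      using \<rho>[of r] free_le_pinned[OF T r that] by auto
    have high: "(\<integral>\<^sup>+\<omega>. ennreal (\<bar>?R \<omega> - ?C\<bar> ^ (2 * k)) \<partial>M) \<le> ennreal D"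
    proof -
      have "(\<integral>\<^sup>+\<omega>. ennreal (\<bar>?R \<omega> - ?C\<bar> ^ (2 * k)) \<partial>M) \<le> ennreal (2 ^ (2 * k) * ?C ^ (2 * k) + 2 ^ (2 * k) * B)"
      proof (rule nn_integral_affine_le[where g = "\<lambda>\<omega>. (taut_length T r 0 \<omega>)\<^sup>2 ^ k"])
        show "(\<integral>\<^sup>+\<omega>. ennreal ((taut_length T r 0 \<omega>)\<^sup>2 ^ k) \<partial>M) \<le> ennreal B" using lt by (intro B(2) T r) simp
        fix \<omega> assume \<omega>: "\<omega> \<in> space M"
        let ?P = "taut_length T r 0 \<omega>"
        have P0: "0 \<le> ?P" "0 \<le> ?R \<omega>" using T r by (simp_all add: taut_length_nonneg)
        have "?P \<le> max ?P ?C" "?C \<le> max ?P ?C" by simp_all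
        then have "\<bar>?R \<omega> - ?C\<bar> \<le> 2 * max ?P ?C" using Rle[OF \<omega>] P0 C0 by linarith
        then have "\<bar>?R \<omega> - ?C\<bar> ^ (2 * k) \<le> (2 * max ?P ?C) ^ (2 * k)" by (intro power_mono) auto
        also have "\<dots> = 2 ^ (2 * k) * (max ?P ?C) ^ (2 * k)" by (rule power_mult_distrib)
        also have "\<dots> \<le> 2 ^ (2 * k) * (?P ^ (2 * k) + ?C ^ (2 * k))"
          using P0 C0 by (intro mult_left_mono) (auto simp: max_def)
        also have "?P ^ (2 * k) = ?P\<^sup>2 ^ k" by (rule power_mult)
        finally show "\<bar>?R \<omega> - ?C\<bar> ^ (2 * k) \<le> 2 ^ (2 * k) * ?C ^ (2 * k) + 2 ^ (2 * k) * ?P\<^sup>2 ^ k"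
          by (simp add: distrib_left add.commute)
      qed (use B(1) C0 in auto)
      then show ?thesis by (simp add: D_def distrib_left add.commute)
    qed
    have "(\<integral>\<^sup>+\<omega>. ennreal (\<bar>?R \<omega> - ?C\<bar> powr q) \<partial>M) \<le> ennreal (\<eta> + K * (e / (2 * K)) + \<eta> * D)"
    proof (rule nn_integral_affine2_le[OF _ _ _ _ _ _ high D])
      show "\<bar>?R \<omega> - ?C\<bar> powr q \<le> \<eta> + K * (?R \<omega> - ?C)\<^sup>2 + \<eta> * \<bar>?R \<omega> - ?C\<bar> ^ (2 * k)" for \<omega>
        using K(2)[of "\<bar>?R \<omega> - ?C\<bar>"] by (simp only: power2_abs abs_ge_zero)
      show "(\<integral>\<^sup>+\<omega>. ennreal ((?R \<omega> - ?C)\<^sup>2) \<partial>M) \<le> ennreal (e / (2 * K))" using lt by (intro \<delta>1(2) T r) simp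
    qed (use e K \<eta> in auto)
    also have "K * (e / (2 * K)) = e / 2" using K by simp
    also have "\<eta> + e / 2 + \<eta> * D = e"
    proof -
      have "\<eta> + \<eta> * D = \<eta> * (1 + D)" by (simp add: algebra_simps)
      also have "\<dots> = e / 2" unfolding \<eta>_def using D by (simp add: field_simps)
      finally show ?thesis by simp
    qed
    finally show "(\<integral>\<^sup>+\<omega>. ennreal (\<bar>?R \<omega> - ?C\<bar> powr q) \<partial>M) \<le> ennreal e" .
  qed
qed

lemma tends_in_Lq_taut_length:
  assumes q: "q > 0" and \<rho>: "\<And>r. \<rho> r \<in> {0, r}"
    and L2: "\<And>e. e > 0 \<Longrightarrow> \<exists>\<delta>>0. \<forall>T>0. \<forall>r>0. r / sqrt T < \<delta> \<longrightarrow>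
      (\<integral>\<^sup>+\<omega>. ennreal ((taut_length T r (\<rho> r) \<omega> - sqrt taut_constant)\<^sup>2) \<partial>M) \<le> ennreal e"
    and X: "\<And>T r \<omega>. T > 0 \<Longrightarrow> r > 0 \<Longrightarrow> \<omega> \<in> space M \<Longrightarrow>
      X (T, r) \<omega> = ennreal (r / sqrt T) * I_within T r (\<rho> r) (\<lambda>t. W t \<omega>)"
  shows "tends_in_Lq M q X (sqrt taut_constant) small_ratio"
proof -
  let ?C = "sqrt taut_constant"
  have XR: "X (T, r) \<omega> = ennreal (taut_length T r (\<rho> r) \<omega>)" if "T > 0" "r > 0" "\<omega> \<in> space M" for T r \<omega>
  proof -
    have "I_within T r (\<rho> r) (\<lambda>t. W t \<omega>) < \<infinity>"
      using that \<rho>[of r] start path_continuous by (intro grid_energy_tendsto_I_within(1)) auto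
    then have "I_within T r (\<rho> r) (\<lambda>t. W t \<omega>) = ennreal (enn2real (I_within T r (\<rho> r) (\<lambda>t. W t \<omega>)))"
      by simp
    then have "X (T, r) \<omega> = ennreal (r / sqrt T) * ennreal (enn2real (I_within T r (\<rho> r) (\<lambda>t. W t \<omega>)))"
      using X[OF that] by simp
    also have "\<dots> = ennreal (taut_length T r (\<rho> r) \<omega>)"
      unfolding taut_length_def using that by (intro ennreal_mult[symmetric]) auto
    finally show ?thesis .
  qed
  have Rm: "taut_length T r (\<rho> r) \<in> borel_measurable M" if "T > 0" "r > 0" for T r
    using \<rho>[of r] taut_length_measurable[OF that] by auto
  have main: "X (T, r) \<in> borel_measurable M \<and> (AE \<omega> in M. X (T, r) \<omega> < \<infinity>) \<and>
      integrable M (\<lambda>\<omega>. \<bar>enn2real (X (T, r) \<omega>) - ?C\<bar> powr q) \<and>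
      (\<integral>\<omega>. \<bar>enn2real (X (T, r) \<omega>) - ?C\<bar> powr q \<partial>M) \<le> e"
    if T: "T > 0" and r: "r > 0" and e: "e > 0"
    and le: "(\<integral>\<^sup>+\<omega>. ennreal (\<bar>taut_length T r (\<rho> r) \<omega> - ?C\<bar> powr q) \<partial>M) \<le> ennreal e" for T r e
  proof (intro conjI)
    note [measurable] = Rm[OF T r]
    have "(\<lambda>\<omega>. ennreal (taut_length T r (\<rho> r) \<omega>)) \<in> borel_measurable M" by measurable
    then show "X (T, r) \<in> borel_measurable M"
      by (rule measurable_cong[THEN iffD1, rotated]) (use XR[OF T r] in auto)
    show "AE \<omega> in M. X (T, r) \<omega> < \<infinity>" using XR[OF T r] by (intro AE_I2) simp
    have eq: "\<bar>enn2real (X (T, r) \<omega>) - ?C\<bar> powr q = \<bar>taut_length T r (\<rho> r) \<omega> - ?C\<bar> powr q"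
      if "\<omega> \<in> space M" for \<omega>
      using XR[OF T r that] taut_length_nonneg[OF T r] by simp
    have int: "integrable M (\<lambda>\<omega>. \<bar>taut_length T r (\<rho> r) \<omega> - ?C\<bar> powr q)"
      using le by (intro integrableI_nonneg) (auto simp: order_le_less_trans)
    then show "integrable M (\<lambda>\<omega>. \<bar>enn2real (X (T, r) \<omega>) - ?C\<bar> powr q)"
      by (subst Bochner_Integration.integrable_cong[OF refl eq])
    have "(\<integral>\<omega>. \<bar>enn2real (X (T, r) \<omega>) - ?C\<bar> powr q \<partial>M) = (\<integral>\<omega>. \<bar>taut_length T r (\<rho> r) \<omega> - ?C\<bar> powr q \<partial>M)"
      by (intro Bochner_Integration.integral_cong refl eq)
    moreover have "ennreal (\<integral>\<omega>. \<bar>taut_length T r (\<rho> r) \<omega> - ?C\<bar> powr q \<partial>M) \<le> ennreal e"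
      using le int by (subst nn_integral_eq_integral[symmetric]) auto
    ultimately show "(\<integral>\<omega>. \<bar>enn2real (X (T, r) \<omega>) - ?C\<bar> powr q \<partial>M) \<le> e" using e by simp
  qed
  have Lq: "\<exists>\<delta>>0. \<forall>T>0. \<forall>r>0. r / sqrt T < \<delta> \<longrightarrow>
      (\<integral>\<^sup>+\<omega>. ennreal (\<bar>taut_length T r (\<rho> r) \<omega> - ?C\<bar> powr q) \<partial>M) \<le> ennreal e" if "e > 0" for e
    by (rule taut_length_Lq[where \<rho> = \<rho>, OF q that]) (fact \<rho>, fact L2)
  show ?thesis
    unfolding tends_in_Lq_def
  proof
    obtain \<delta> where \<delta>: "\<delta> > 0" "\<forall>T>0. \<forall>r>0. r / sqrt T < \<delta> \<longrightarrow>
        (\<integral>\<^sup>+\<omega>. ennreal (\<bar>taut_length T r (\<rho> r) \<omega> - ?C\<bar> powr q) \<partial>M) \<le> ennreal 1" using Lq[of 1] by auto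
    show "\<forall>\<^sub>F i in small_ratio. X i \<in> borel_measurable M \<and> (AE \<omega> in M. X i \<omega> < \<infinity>) \<and>
        integrable M (\<lambda>\<omega>. \<bar>enn2real (X i \<omega>) - ?C\<bar> powr q)"
      unfolding eventually_small_ratio using \<delta> main[of _ _ 1] by (intro exI[of _ \<delta>]) auto
    show "((\<lambda>i. \<integral>\<omega>. \<bar>enn2real (X i \<omega>) - ?C\<bar> powr q \<partial>M) \<longlongrightarrow> 0) small_ratio"
    proof (rule tendstoI)
      fix e :: real assume e: "e > 0"
      obtain \<delta> where \<delta>: "\<delta> > 0" "\<forall>T>0. \<forall>r>0. r / sqrt T < \<delta> \<longrightarrow>
        (\<integral>\<^sup>+\<omega>. ennreal (\<bar>taut_length T r (\<rho> r) \<omega> - ?C\<bar> powr q) \<partial>M) \<le> ennreal (e / 2)" using Lq[of "e / 2"] e by auto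
      show "\<forall>\<^sub>F i in small_ratio. dist (\<integral>\<omega>. \<bar>enn2real (X i \<omega>) - ?C\<bar> powr q \<partial>M) 0 < e"
        unfolding eventually_small_ratio
      proof (intro exI[of _ \<delta>] conjI allI impI \<delta>(1))
        fix T r :: real assume T: "T > 0" and r: "r > 0" and lt: "r / sqrt T < \<delta>"
        have "(\<integral>\<omega>. \<bar>enn2real (X (T, r) \<omega>) - ?C\<bar> powr q \<partial>M) \<le> e / 2"
          using main[OF T r, of "e / 2"] \<delta>(2) T r lt e by simp
        moreover have "0 \<le> (\<integral>\<omega>. \<bar>enn2real (X (T, r) \<omega>) - ?C\<bar> powr q \<partial>M)" by simp
        ultimately show "dist (\<integral>\<omega>. \<bar>enn2real (X (T, r) \<omega>) - ?C\<bar> powr q \<partial>M) 0 < e" using e by simp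
      qed
    qed
  qed
qed

lemma taut_strings_tend_in_Lq:
  assumes q: "q > 0"
  shows "tends_in_Lq M q (\<lambda>(T, r) \<omega>. ennreal (r / sqrt T) * I_free T r (\<lambda>t. W t \<omega>)) (sqrt taut_constant) small_ratio"
    and "tends_in_Lq M q (\<lambda>(T, r) \<omega>. ennreal (r / sqrt T) * I_pinned T r (\<lambda>t. W t \<omega>)) (sqrt taut_constant) small_ratio"
proof -
  show "tends_in_Lq M q (\<lambda>(T, r) \<omega>. ennreal (r / sqrt T) * I_free T r (\<lambda>t. W t \<omega>)) (sqrt taut_constant) small_ratio"
  proof (rule tends_in_Lq_taut_length[OF q, of "\<lambda>r. r"])
    show "\<exists>\<delta>>0. \<forall>T>0. \<forall>r>0. r / sqrt T < \<delta> \<longrightarrow>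
      (\<integral>\<^sup>+\<omega>. ennreal ((taut_length T r r \<omega> - sqrt taut_constant)\<^sup>2) \<partial>M) \<le> ennreal e" if "e > 0" for e
      using free_L2[OF that] by metis
  qed (use path_continuous in \<open>auto simp: I_free_eq\<close>)
  show "tends_in_Lq M q (\<lambda>(T, r) \<omega>. ennreal (r / sqrt T) * I_pinned T r (\<lambda>t. W t \<omega>)) (sqrt taut_constant) small_ratio"
  proof (rule tends_in_Lq_taut_length[OF q, of "\<lambda>r. 0"])
    show "\<exists>\<delta>>0. \<forall>T>0. \<forall>r>0. r / sqrt T < \<delta> \<longrightarrow>
      (\<integral>\<^sup>+\<omega>. ennreal ((taut_length T r 0 \<omega> - sqrt taut_constant)\<^sup>2) \<partial>M) \<le> ennreal e" if "e > 0" for e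
      using pinned_L2[OF that] by metis
  qed (auto simp: I_pinned_eq)
qed

end

theorem theorem1p1:
  shows "\<exists>C::real. 0 < C \<and>
    (\<forall>(M :: 'a measure) (W :: real \<Rightarrow> 'a \<Rightarrow> real). wiener_process M W \<longrightarrow>
      (\<forall>q>0.
        tends_in_Lq M q
          (\<lambda>(T, r) \<omega>. ennreal (r / sqrt T) * I_free T r (\<lambda>t. W t \<omega>)) C small_ratio \<and>
        tends_in_Lq M q
          (\<lambda>(T, r) \<omega>. ennreal (r / sqrt T) * I_pinned T r (\<lambda>t. W t \<omega>)) C small_ratio))"
\<comment> \<open>The positivity of the constant is derived from a Wiener process; if there is none on this
  type, the claim is vacuous and any positive number will do.\<close>
proof (cases "\<exists>(M :: 'a measure) W. wiener_process M W")
  case True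
  then have "0 < sqrt taut_constant" using wiener_process.taut_constant_pos by auto
  then show ?thesis using wiener_process.taut_strings_tend_in_Lq by blast
next
  case False
  then show ?thesis by (intro exI[of _ 1]) auto
qed

end
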